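(* Let $n\geqslant2$, let $K\subset\mathbb{R}^n$ be a convex body of class $C^2_+$, let $C=\frac12(K+(-K))$ be its central symmetral, and let $h_{\mathrm{odd}}$ be the odd part of its support function. Then $\mathcal A_2(K)=W_{n-2}(C)-W_{n-2}(K)$ satisfies $$\mathcal A_2(K)=\frac{1}{n(n-1)}\int_{\mathbb{S}^{n-1}}\left(|\nabla h_{\mathrm{odd}}|^2-(n-1)h_{\mathrm{odd}}^2\right)\mathrm{d}\sigma.$$ It is non-negative and vanishes if and only if $h_{\mathrm{odd}}$ is the restriction to $\mathbb{S}^{n-1}$ of a linear function, equivalently if and only if $K$ is centrally symmetric up to translation.
   Context: A convex body is a compact convex set with non-empty interior; it is of class $C^2_+$ if its boundary is $C^2$ with positive Gauss curvature. $h_K(u)=\max_{x\in K}\langle x,u\rangle$, $u\in\mathbb{S}^{n-1}$, is the support function and $h_{\mathrm{odd}}(u)=\frac{h_K(u)-h_K(-u)}2$. $\nabla$ is the gradient on the round unit sphere $\mathbb{S}^{n-1}$ and $\sigma$ its (unnormalized) surface measure. $B^n$ is the Euclidean unit ball. $V$ is the mixed volume, normalized by $V(K,\ldots,K)=\mathrm{Vol}_n(K)$, and $W_j(K)=V(K^{[n-j]},(B^n)^{[j]})$, where $[r]$ denotes repetition $r$ times. "Centrally symmetric up to translation" means that some translate $L$ of $K$ satisfies $L=-L$. *)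

theory Defs
  imports "HOL-Analysis.Analysis" "HOL-Library.Set_Algebras"
begin

definition convex_body :: "(real^'n) set \<Rightarrow> bool" where
  "convex_body K \<longleftrightarrow> compact K \<and> convex K \<and> interior K \<noteq> {}"


text \<open>
  A \<open>C\<^sup>2\<close> function \<open>g\<close> with gradient \<open>G \<noteq> 0\<close> and Hessian matrix \<open>H\<close>, which describes \<open>K\<close>
  in the open set \<open>U\<close>. As \<open>G\<close> has no zero in \<open>U\<close>, the part of \<open>frontier K\<close> in \<open>U\<close> is the
  regular level set \<open>g = 0\<close>, and \<open>sgn (G y) = G y / norm (G y)\<close> extends its outer unit normal to
  a \<open>C\<^sup>1\<close> field on \<open>U\<close>.
\<close>

definition C2_defining_function ::
  "(real^'n) set \<Rightarrow> (real^'n) set \<Rightarrow> (real^'n \<Rightarrow> real) \<Rightarrow> (real^'n \<Rightarrow> real^'n)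
    \<Rightarrow> (real^'n \<Rightarrow> real^'n^'n) \<Rightarrow> bool" where
  "C2_defining_function K U g G H \<longleftrightarrow>
     open U \<and> K \<inter> U = {y \<in> U. g y \<le> 0} \<and>
     (\<forall>y\<in>U. GDERIV g y :> G y \<and> G y \<noteq> 0 \<and> (G has_derivative (\<lambda>h. H y *v h)) (at y)) \<and>
     continuous_on U H"

text \<open>
  Gauss curvature at \<open>x\<close> of a hypersurface with unit normal \<open>\<nu>\<close>, where \<open>\<nu>\<close> is extended to a
  neighbourhood of \<open>x\<close>: the determinant of the Weingarten map, that is, of the derivative of \<open>\<nu>\<close>
  as an endomorphism of the tangent space \<open>{v. v \<bullet> \<nu> x = 0}\<close>. The endomorphism is extended by the
  identity on the normal line, which does not change its determinant. The derivative is applied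
  to tangent vectors only, so the extension of \<open>\<nu>\<close> off the hypersurface is irrelevant.
\<close>

definition gauss_curvature :: "(real^'n \<Rightarrow> real^'n) \<Rightarrow> real^'n \<Rightarrow> real" where
  "gauss_curvature \<nu> x =
     det (matrix (\<lambda>v. frechet_derivative \<nu> (at x) (v - (v \<bullet> \<nu> x) *\<^sub>R \<nu> x) + (v \<bullet> \<nu> x) *\<^sub>R \<nu> x))"

definition C2_plus :: "(real^'n) set \<Rightarrow> bool" where
  "C2_plus K \<longleftrightarrow>
     (\<forall>x\<in>frontier K. \<exists>U g G H. x \<in> U \<and> C2_defining_function K U g G H \<and>
        gauss_curvature (\<lambda>y. sgn (G y)) x > 0)"


definition support_function :: "(real^'n) set \<Rightarrow> real^'n \<Rightarrow> real" where
  "support_function K u = (SUP x\<in>K. x \<bullet> u)"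

definition h_odd :: "(real^'n) set \<Rightarrow> real^'n \<Rightarrow> real" where
  "h_odd K u = (support_function K u - support_function K (- u)) / 2"

definition central_symmetral :: "(real^'n) set \<Rightarrow> (real^'n) set" where
  "central_symmetral K = (*\<^sub>R) (1/2) ` (K + uminus ` K)"

definition centrally_symmetric_up_to_translation :: "(real^'n) set \<Rightarrow> bool" where
  "centrally_symmetric_up_to_translation K \<longleftrightarrow> (\<exists>a L. L = (+) a ` K \<and> L = uminus ` L)"


text \<open>
  Gradient on the round unit sphere: the tangent vector at \<open>u\<close> that represents the derivative of
  \<open>f\<close> along the sphere. The values of \<open>f\<close> off the sphere do not enter. The condition \<open>w \<bullet> u = 0\<close>
  makes \<open>w\<close> unique, since a derivative within the sphere is determined on tangent vectors only.
\<close>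

definition sphere_gradient :: "(real^'n \<Rightarrow> real) \<Rightarrow> real^'n \<Rightarrow> real^'n" where
  "sphere_gradient f u =
     (THE w. w \<bullet> u = 0 \<and> (f has_derivative (\<lambda>h. w \<bullet> h)) (at u within sphere 0 1))"

text \<open>
  Unnormalized surface measure on the unit sphere, as the cone measure: a Borel set \<open>A\<close> of the
  sphere has measure \<open>n\<close> times the volume of \<open>{t *\<^sub>R u | t u. 0 < t \<and> t \<le> 1 \<and> u \<in> A}\<close>, the
  preimage of \<open>A\<close> in the punctured unit ball under \<open>sgn x = x / norm x\<close>.
\<close>

definition sphere_measure :: "(real^'n) measure" where
  "sphere_measure =
     distr (restrict_space (scale_measure (of_nat CARD('n)) lborel) (cball 0 1 - {0}))
       (restrict_space borel (sphere 0 1)) sgn"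


text \<open>
  Minkowski's expansion for a list \<open>Ks\<close> of \<open>n\<close> compact convex sets, with coefficients indexed by
  lists \<open>[i\<^sub>1, \<dots>, i\<^sub>n]\<close> of indices below \<open>n\<close> and symmetric in the indices:
  the volume of \<open>l\<^sub>0 K\<^sub>0 + \<dots> + l\<^sub>n\<^sub>-\<^sub>1 K\<^sub>n\<^sub>-\<^sub>1\<close> is the sum of the
  \<open>c [i\<^sub>1, \<dots>, i\<^sub>n] l\<^bsub>i\<^sub>1\<^esub> \<dots> l\<^bsub>i\<^sub>n\<^esub>\<close>. The mixed volume is the coefficient of index
  \<open>[0, \<dots>, n - 1]\<close>.
\<close>

definition minkowski_coefficients ::
  "(real^'n) set list \<Rightarrow> (nat list \<Rightarrow> real) \<Rightarrow> bool" where
  "minkowski_coefficients Ks c \<longleftrightarrow>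
     (\<forall>is js. mset is = mset js \<longrightarrow> c is = c js) \<and>
     (\<forall>l. (\<forall>i<CARD('n). l i \<ge> 0) \<longrightarrow>
        measure lebesgue (\<Sum>i<CARD('n). (*\<^sub>R) (l i) ` (Ks ! i)) =
        (\<Sum>is | length is = CARD('n) \<and> set is \<subseteq> {..<CARD('n)}. c is * (\<Prod>i\<leftarrow>is. l i)))"

definition mixed_volume :: "(real^'n) set list \<Rightarrow> real" where
  "mixed_volume Ks = (THE v. \<exists>c. minkowski_coefficients Ks c \<and> v = c [0..<CARD('n)])"

definition quermassintegral :: "nat \<Rightarrow> (real^'n) set \<Rightarrow> real" where
  "quermassintegral j K = mixed_volume (replicate (CARD('n) - j) K @ replicate j (cball 0 1))"

definition asymmetry_2 :: "(real^'n) set \<Rightarrow> real" where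
  "asymmetry_2 K =
     quermassintegral (CARD('n) - 2) (central_symmetral K) - quermassintegral (CARD('n) - 2) K"


lemma sum_Pow_alternating_subset:
  assumes "finite N" "S \<subseteq> N"
  shows "(\<Sum>X\<in>Pow N. (-1) ^ card (N - X) * (if S \<subseteq> X then 1 else 0)) = (if S = N then 1 else (0::real))"
proof -
  have "(\<Prod>x\<in>N - X. - (if x \<in> S then 0 else 1)) =
      (-1) ^ card (N - X) * (if S \<subseteq> X then 1 else (0::real))" if "X \<subseteq> N" for X
  proof (cases "S \<subseteq> X")
    case True
    then have "(\<Prod>x\<in>N - X. - (if x \<in> S then 0 else 1)) = (\<Prod>x\<in>N - X. (-1::real))"
      by (intro prod.cong) auto
    with True show ?thesis by simp
  next
    case False
    then obtain x where "x \<in> S" "x \<notin> X" by auto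
    with assms have "x \<in> N - X" by auto
    with \<open>x \<in> S\<close> have "(\<Prod>x\<in>N - X. - (if x \<in> S then 0 else (1::real))) = 0"
      using assms by (intro prod_zero) auto
    with False show ?thesis by simp
  qed
  moreover have "(\<Prod>x\<in>N. 1 + - (if x \<in> S then 0 else 1)) = (if S = N then 1 else (0::real))"
  proof (cases "S = N")
    case False
    with assms obtain x where "x \<in> N" "x \<notin> S" by auto
    then show ?thesis
      using assms False by (auto intro!: prod_zero)
  qed auto
  ultimately show ?thesis
    using prod_add[OF assms(1), of "\<lambda>_. 1" "\<lambda>x. - (if x \<in> S then 0 else (1::real))"] by simp
qed

lemma minkowski_coefficients_unique:
  fixes Ks :: "(real^'n) set list"
  assumes c: "minkowski_coefficients Ks c" and d: "minkowski_coefficients Ks d"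
  shows "c [0..<CARD('n)] = d [0..<CARD('n)]"
proof -
  let ?n = "CARD('n)"
  let ?N = "{..<?n}"
  let ?I = "{is. length is = ?n \<and> set is \<subseteq> ?N}"
  let ?J = "{is. length is = ?n \<and> set is = ?N}"
  define P where "P = (\<Sum>X\<in>Pow ?N. (-1) ^ card (?N - X) *
    measure lebesgue (\<Sum>i<?n. (*\<^sub>R) (if i \<in> X then 1 else 0) ` (Ks ! i)))"
  have fin: "finite ?I"
    using finite_lists_length_eq[of ?N ?n] by (simp add: conj_commute)
  have ind: "(\<Prod>i\<leftarrow>is. if i \<in> X then 1 else 0) = (if set is \<subseteq> X then 1 else (0::real))" for X :: "nat set" and "is"
    by (induction "is") auto
  have vol: "measure lebesgue (\<Sum>i<?n. (*\<^sub>R) (if i \<in> X then 1 else 0) ` (Ks ! i)) =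
      (\<Sum>is\<in>?I. e is * (if set is \<subseteq> X then 1 else 0))" if e: "minkowski_coefficients Ks e" for e X
    unfolding ind[symmetric]
    by (rule e[unfolded minkowski_coefficients_def, THEN conjunct2, rule_format]) simp
  have P: "P = real (card ?J) * e [0..<?n]" if e: "minkowski_coefficients Ks e" for e
  proof -
    have "P = (\<Sum>X\<in>Pow ?N. (-1) ^ card (?N - X) *
        (\<Sum>is\<in>?I. e is * (if set is \<subseteq> X then 1 else 0)))"
      unfolding P_def vol[OF e] ..
    also have "\<dots> = (\<Sum>X\<in>Pow ?N. \<Sum>is\<in>?I. e is * ((-1) ^ card (?N - X) * (if set is \<subseteq> X then 1 else 0)))"
      by (simp only: sum_distrib_left mult.left_commute)
    also have "\<dots> = (\<Sum>is\<in>?I. e is * (\<Sum>X\<in>Pow ?N. (-1) ^ card (?N - X) * (if set is \<subseteq> X then 1 else 0)))"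
      by (subst sum.swap) (simp only: sum_distrib_left)
    also have "\<dots> = (\<Sum>is\<in>?I. e is * (if set is = ?N then 1 else 0))"
    proof (intro sum.cong refl)
      fix "is" assume "is \<in> ?I"
      then have "set is \<subseteq> ?N" by blast
      then show "e is * (\<Sum>X\<in>Pow ?N. (-1) ^ card (?N - X) * (if set is \<subseteq> X then 1 else 0)) =
          e is * (if set is = ?N then 1 else 0)"
        by (subst sum_Pow_alternating_subset) auto
    qed
    also have "\<dots> = (\<Sum>is\<in>?J. e is)"
      by (rule sum.mono_neutral_cong_right[OF fin]) auto
    also have "\<dots> = (\<Sum>is\<in>?J. e [0..<?n])"
    proof (intro sum.cong refl)
      fix "is" assume *: "is \<in> ?J"
      then have "distinct is" by (intro card_distinct) auto
      then have "mset is = mset [0..<?n]"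
        using * by (subst set_eq_iff_mset_eq_distinct[symmetric]) (simp_all add: atLeast0LessThan)
      then show "e is = e [0..<?n]"
        by (rule e[unfolded minkowski_coefficients_def, THEN conjunct1, rule_format])
    qed
    finally show ?thesis by simp
  qed
  have "[0..<?n] \<in> ?J" by auto
  moreover have "finite ?J" by (rule finite_subset[OF _ fin]) auto
  ultimately have "card ?J \<noteq> 0" by (metis card_0_eq empty_iff)
  then show ?thesis
    using P[OF c] P[OF d] by simp
qed

lemma mixed_volume_eqI:
  fixes Ks :: "(real^'n) set list"
  assumes "minkowski_coefficients Ks c"
  shows "mixed_volume Ks = c [0..<CARD('n)]"
  unfolding mixed_volume_def
  using assms minkowski_coefficients_unique by (intro the_equality) blast+

end

(*
  For a body K with C^2 support function h, gradient p and Hessian A of h, sweeping out s K + t B by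
  the boundaries of the bodies r K + t B writes its volume as a polynomial in s and t, in which the
  coefficient of s^2 t^(n-2) is half the integral of h tr A over the sphere.

  Let (x, y) be uniform in the unit ball of R^n x R^n. As the y-average of y y^T is a multiple of the
  identity, integrals over the sphere of h tr A and of |grad f|^2 - (n-1) f^2 become means of
  h(x) <A(x) y, y> and of <grad f(x), y>^2 - f(x)^2. The ball is invariant under
  (x, y) -> (cos t x + sin t y, - sin t x + cos t y), so these means are averages of integrals over
  great circles. There an integration by parts gives the formula for W_(n-2). Even and odd part of h
  are orthogonal for the Dirichlet form, so the asymmetry is the form at h_odd, and Wirtinger's
  inequality for antiperiodic functions, with its equality case, gives the rest.
*)

theory Submission
  imports Defs
begin

text \<open>Every function on the sphere is replaced by its extension of degree one. The gradient
  \<open>P\<close> of such an extension has degree zero and equals \<nabla>f(u) + f(u) u on unit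
  vectors u, so that |P|^2 - n f^2 = |\<nabla>f|^2 - (n-1) f^2; the left-hand side is the integrand
  carried through all computations. Pairs (x, y) give integration by parts on the sphere without
  charts: y is the velocity of x under the rotation, so f(x) has derivative <P(x), y>, and
  derivatives of functions of the rotated pair integrate to zero over a period. Linear functions lie
  in the kernel of the quadratic form. This gives one half of the equality case, and it permits
  translations: the sweep needs the origin inside the body to make h positive, and moving K there
  changes h_odd by a linear function. No moment of the ball in R^n x R^n is evaluated: it is a
  positive factor common to both sides. In the constant 1/(n(n-1)) the factor 1/n comes from the
  cone measure, and 1/(n-1) is the quotient of n/2 by the binomial coefficient n(n-1)/2.\<close>

section \<open>Change of variables over an arbitrary finite index type\<close>

text \<open>
  The library proves the change of variables theorem for well-ordered index types only. It is
  transported along a well-ordered copy of the index type.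
\<close>

typedef 'n indexed_copy = "UNIV :: 'n set" by simp

lemma bij_Rep_indexed_copy: "bij Rep_indexed_copy"
  by (rule bij_betw_byWitness[where f' = Abs_indexed_copy])
    (auto simp: Rep_indexed_copy_inverse Abs_indexed_copy_inverse)

instance indexed_copy :: (finite) finite
proof
  show "finite (UNIV :: 'a indexed_copy set)"
    using bij_betw_finite[OF bij_Rep_indexed_copy[where 'a = 'a]] by simp
qed

instantiation indexed_copy :: (finite) wellorder
begin

definition indexed_copy_number :: "'a indexed_copy \<Rightarrow> nat" where
  "indexed_copy_number = (SOME f. inj f)"

definition less_eq_indexed_copy :: "'a indexed_copy \<Rightarrow> 'a indexed_copy \<Rightarrow> bool" where
  "x \<le> y \<longleftrightarrow> indexed_copy_number x \<le> indexed_copy_number y"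

definition less_indexed_copy :: "'a indexed_copy \<Rightarrow> 'a indexed_copy \<Rightarrow> bool" where
  "x < y \<longleftrightarrow> indexed_copy_number x < indexed_copy_number y"

instance
proof
  have "\<exists>f :: 'a indexed_copy \<Rightarrow> nat. inj f"
    using finite_imp_inj_to_nat_seg[of "UNIV :: 'a indexed_copy set"] by auto
  then have inj: "inj (indexed_copy_number :: 'a indexed_copy \<Rightarrow> nat)"
    unfolding indexed_copy_number_def by (rule someI_ex)
  fix x y z :: "'a indexed_copy"
  show "x < y \<longleftrightarrow> x \<le> y \<and> \<not> y \<le> x" "x \<le> x" "x \<le> y \<or> y \<le> x"
    by (auto simp: less_eq_indexed_copy_def less_indexed_copy_def)
  show "x \<le> y \<Longrightarrow> y \<le> z \<Longrightarrow> x \<le> z"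
    by (simp add: less_eq_indexed_copy_def)
  show "x \<le> y \<Longrightarrow> y \<le> x \<Longrightarrow> x = y"
    using injD[OF inj] by (simp add: less_eq_indexed_copy_def)
next
  fix P :: "'a indexed_copy \<Rightarrow> bool" and x
  assume step: "\<And>x. (\<And>y. y < x \<Longrightarrow> P y) \<Longrightarrow> P x"
  show "P x"
  proof (induction "indexed_copy_number x" arbitrary: x rule: less_induct)
    case less
    show ?case by (rule step) (rule less, simp add: less_indexed_copy_def)
  qed
qed

end

definition reindex :: "('m \<Rightarrow> 'n) \<Rightarrow> 'a^'n \<Rightarrow> 'a^'m" where
  "reindex r x = (\<chi> i. x $ r i)"

lemma reindex_nth [simp]: "reindex r x $ i = x $ r i"
  by (simp add: reindex_def)

lemma linear_reindex: "linear (reindex r :: real^'n::finite \<Rightarrow> real^'m::finite)"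
  by (rule linearI) (simp_all add: vec_eq_iff)

lemma reindex_inv:
  fixes r :: "'m::finite \<Rightarrow> 'n::finite" and x :: "'a^'n" and y :: "'a^'m"
  assumes "bij r"
  shows "reindex (inv r) (reindex r x) = x" "reindex r (reindex (inv r) y) = y"
  using assms by (simp_all add: vec_eq_iff bij_is_surj bij_is_inj surj_f_inv_f inv_f_f)

lemma prod_Basis_vec: "(\<Prod>b\<in>(Basis :: (real^'n) set). f (x \<bullet> b) (y \<bullet> b)) = (\<Prod>i\<in>UNIV. f (x $ i) (y $ i))"
proof -
  have B: "(Basis :: (real^'n) set) = (\<lambda>i. axis i 1) ` UNIV"
    by (auto simp: Basis_vec_def)
  show ?thesis
    unfolding B by (subst prod.reindex) (auto simp: inj_on_def axis_eq_axis inner_axis)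
qed

text \<open>Preimages of boxes are boxes with the same side lengths, and boxes determine
  \<open>lborel\<close>. Besides the transport to the ordered copy, this yields the invariance under
  coordinate transpositions used for second moments.\<close>

lemma lborel_distr_reindex:
  fixes r :: "'m::finite \<Rightarrow> 'n::finite"
  assumes r: "bij r"
  shows "distr lborel borel (reindex r :: real^'n \<Rightarrow> real^'m) = lborel"
proof (rule lborel_eqI[symmetric])
  have meas [measurable]: "(reindex r :: real^'n \<Rightarrow> real^'m) \<in> borel_measurable borel"
    by (intro borel_measurable_continuous_onI linear_continuous_on linear_conv_bounded_linear[THEN iffD1] linear_reindex)
  fix l u :: "real^'m"
  assume "\<And>b. b \<in> Basis \<Longrightarrow> l \<bullet> b \<le> u \<bullet> b"
  then have le: "l $ i \<le> u $ i" for i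
    by (metis Basis_real_def axis_in_Basis_iff inner_axis inner_real_def mult.right_neutral singletonI)
  have vim: "reindex r -` box l u = box (reindex (inv r) l) (reindex (inv r) u)"
    using r by (auto simp: mem_box_cart bij_is_inj inv_f_f) (metis bij_inv_eq_iff)+
  have "emeasure (distr lborel borel (reindex r)) (box l u) = emeasure lborel (reindex r -` box l u)"
    by (subst emeasure_distr) auto
  also have "\<dots> = (\<Prod>b\<in>Basis. (reindex (inv r) u - reindex (inv r) l) \<bullet> b)"
    unfolding vim by (rule emeasure_lborel_box) (auto simp: Basis_vec_def inner_axis le)
  also have "(\<Prod>b\<in>Basis. (reindex (inv r) u - reindex (inv r) l) \<bullet> b) = (\<Prod>i\<in>UNIV. u $ inv r i - l $ inv r i)"
    using prod_Basis_vec[of "\<lambda>x y. x" "reindex (inv r) u - reindex (inv r) l" 0] by simp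
  also have "\<dots> = (\<Prod>i\<in>UNIV. u $ i - l $ i)"
    using prod.reindex_bij_betw[of "inv r" UNIV UNIV "\<lambda>i. u $ i - l $ i"] r
    by (simp add: bij_imp_bij_inv)
  also have "\<dots> = (\<Prod>b\<in>Basis. (u - l) \<bullet> b)"
    using prod_Basis_vec[of "\<lambda>x y. x" "u - l" 0] by simp
  finally show "emeasure (distr lborel borel (reindex r)) (box l u) = (\<Prod>b\<in>Basis. (u - l) \<bullet> b)" .
qed simp

lemma borel_measurable_reindex [measurable]:
  "(reindex r :: real^'n::finite \<Rightarrow> real^'m::finite) \<in> borel_measurable borel"
  by (intro borel_measurable_continuous_onI linear_continuous_on linear_conv_bounded_linear[THEN iffD1] linear_reindex)

lemma lebesgue_distr_reindex:
  fixes r :: "'m::finite \<Rightarrow> 'n::finite"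
  assumes r: "bij r"
  shows "distr lebesgue lebesgue (reindex r :: real^'n \<Rightarrow> real^'m) = lebesgue"
    and "(reindex r :: real^'n \<Rightarrow> real^'m) \<in> lebesgue \<rightarrow>\<^sub>M lebesgue"
proof -
  let ?f = "reindex r :: real^'n \<Rightarrow> real^'m"
  have eq: "distr lebesgue lborel ?f = lborel"
    using lborel_distr_reindex[OF r] by (subst distr_completion) (auto cong: distr_cong)
  have m: "?f \<in> lebesgue \<rightarrow>\<^sub>M lborel"
    by (rule measurable_completion) simp
  show "distr lebesgue lebesgue ?f = lebesgue"
    using completion.completion_distr_eq[OF m] eq by simp
  show "?f \<in> lebesgue \<rightarrow>\<^sub>M lebesgue"
    using m by (rule completion.measurable_completion2) (simp add: eq)
qed

lemma
  fixes r :: "'m::finite \<Rightarrow> 'n::finite" and S :: "(real^'n) set"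
  assumes r: "bij r" and S: "S \<in> lmeasurable"
  shows lmeasurable_reindex: "(reindex r :: real^'n \<Rightarrow> real^'m) ` S \<in> lmeasurable"
    and measure_reindex: "measure lebesgue ((reindex r :: real^'n \<Rightarrow> real^'m) ` S) = measure lebesgue S"
proof -
  have "y \<in> (reindex r :: real^'n \<Rightarrow> real^'m) ` S \<longleftrightarrow> y \<in> reindex (inv r) -` S" for y
    using reindex_inv[OF r, where 'a = real] by (auto simp: image_iff) metis
  then have im: "(reindex r :: real^'n \<Rightarrow> real^'m) ` S = reindex (inv r) -` S" by blast
  have inv: "bij (inv r)" by (rule bij_imp_bij_inv[OF r])
  have "emeasure lebesgue S = emeasure (distr lebesgue lebesgue (reindex (inv r) :: real^'m \<Rightarrow> real^'n)) S"
    using lebesgue_distr_reindex(1)[OF inv] by simp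
  also have "\<dots> = emeasure lebesgue (reindex (inv r) -` S)"
    using lebesgue_distr_reindex(2)[OF inv] S by (subst emeasure_distr) (auto simp: fmeasurable_def)
  finally have e: "emeasure lebesgue ((reindex r :: real^'n \<Rightarrow> real^'m) ` S) = emeasure lebesgue S"
    by (simp add: im)
  moreover have "(reindex r :: real^'n \<Rightarrow> real^'m) ` S \<in> sets lebesgue"
    using measurable_sets[OF lebesgue_distr_reindex(2)[OF inv], of S] S
    by (auto simp: im fmeasurable_def)
  ultimately show "(reindex r :: real^'n \<Rightarrow> real^'m) ` S \<in> lmeasurable"
    using S by (auto simp: fmeasurable_def)
  show "measure lebesgue ((reindex r :: real^'n \<Rightarrow> real^'m) ` S) = measure lebesgue S"
    using e by (simp add: measure_def)
qed

text \<open>Relabelling rows and columns by one bijection conjugates the permutations in the Leibniz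
  formula, and conjugation keeps the sign.\<close>

lemma det_reindex:
  fixes r :: "'m::finite \<Rightarrow> 'n::finite" and A :: "'a::comm_ring_1^'n^'n"
  assumes r: "bij r"
  shows "det (\<chi> i j. A $ r i $ r j) = det A"
proof -
  let ?c = "map_permutation UNIV r"
  have c: "?c p = r \<circ> p \<circ> inv r" for p
    using bij_is_surj[OF r] by (simp add: map_permutation_def restrict_id_def fun_eq_iff)
  have bij: "bij_betw ?c {p. p permutes UNIV} {p. p permutes UNIV}"
  proof (rule bij_betw_byWitness[where f' = "\<lambda>p. inv r \<circ> p \<circ> r"])
    show "?c ` {p. p permutes UNIV} \<subseteq> {p. p permutes UNIV}"
      using map_permutation_permutes[of r UNIV UNIV] r by auto
    show "(\<lambda>p. inv r \<circ> p \<circ> r) ` {p. p permutes UNIV} \<subseteq> {p. p permutes UNIV}"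
      using r by (auto simp: bij_imp_bij_inv intro!: bij_imp_permutes bij_comp dest: permutes_bij)
    show "\<forall>p\<in>{p. p permutes UNIV}. inv r \<circ> ?c p \<circ> r = p"
      using r by (simp add: c fun_eq_iff bij_is_inj inv_f_f)
    show "\<forall>p\<in>{p. p permutes UNIV}. ?c (inv r \<circ> p \<circ> r) = p"
      using r by (simp add: c fun_eq_iff bij_is_surj surj_f_inv_f)
  qed
  have "det A = (\<Sum>p | p permutes UNIV. of_int (sign (?c p)) * (\<Prod>i\<in>UNIV. A $ i $ ?c p i))"
    unfolding det_def by (rule sum.reindex_bij_betw[OF bij, symmetric])
  also have "\<dots> = (\<Sum>p | p permutes UNIV. of_int (sign p) * (\<Prod>i\<in>UNIV. A $ r i $ r (p i)))"
  proof (intro sum.cong refl arg_cong2[where f = "(*)"])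
    fix p :: "'m \<Rightarrow> 'm" assume p: "p \<in> {p. p permutes UNIV}"
    show "of_int (sign (?c p)) = (of_int (sign p) :: 'a)"
      using p r by (subst sign_map_permutation) (auto simp: bij_is_inj)
    show "(\<Prod>i\<in>UNIV. A $ i $ ?c p i) = (\<Prod>i\<in>UNIV. A $ r i $ r (p i))"
      using prod.reindex_bij_betw[OF r, of "\<lambda>i. A $ i $ ?c p i"] r
      by (simp add: c bij_is_inj inv_f_f)
  qed
  finally show ?thesis by (simp add: det_def)
qed


text \<open>Conjugation by the relabelling \<open>P\<close> turns \<open>f\<close> into a map on the
  ordered copy. Its Jacobian matrix is relabelled in rows and columns alike, so the determinant
  stays the same.\<close>

lemma measure_differentiable_image_finite:
  fixes f :: "real^'n \<Rightarrow> real^'n::finite"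
  assumes S: "S \<in> sets borel"
    and der: "\<And>x. x \<in> S \<Longrightarrow> (f has_derivative f' x) (at x within S)"
    and inj: "inj_on f S"
    and int: "set_integrable lborel S (\<lambda>x. \<bar>det (matrix (f' x))\<bar>)"
  shows "f ` S \<in> lmeasurable" (is ?th1)
    and "measure lebesgue (f ` S) = (LINT x:S|lborel. \<bar>det (matrix (f' x))\<bar>)" (is ?th2)
proof -
  define r where "r = (Rep_indexed_copy :: 'n indexed_copy \<Rightarrow> 'n)"
  have r: "bij r" and r': "bij (inv r)"
    using bij_Rep_indexed_copy bij_imp_bij_inv by (auto simp: r_def)
  define P where "P = (reindex r :: real^'n \<Rightarrow> real^'n indexed_copy)"
  define Q where "Q = (reindex (inv r) :: real^'n indexed_copy \<Rightarrow> real^'n)"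
  have QP [simp]: "Q (P x) = x" "P (Q y) = y" for x y
    unfolding P_def Q_def by (rule reindex_inv[OF r])+
  have lin: "linear P" "linear Q" unfolding P_def Q_def by (rule linear_reindex)+
  have bl: "bounded_linear P" "bounded_linear Q"
    using lin by (simp_all add: linear_conv_bounded_linear)
  have [measurable]: "P \<in> borel_measurable borel" "Q \<in> borel_measurable borel"
    by (auto simp: P_def Q_def)
  define T where "T = P ` S"
  have T: "T = Q -` S" unfolding T_def by (auto simp: image_iff) (metis QP(2))
  have Tb: "T \<in> sets borel" unfolding T using S by (metis Q_def borel_measurable_reindex measurable_sets_borel)
  define g where "g y = P (f (Q y))" for y
  define g' where "g' y v = P (f' (Q y) (Q v))" for y v
  have QT: "Q ` T = S" by (auto simp: T_def image_image)
  have gder: "(g has_derivative g' y) (at y within T)" if "y \<in> T" for y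
  proof -
    have Qy: "Q y \<in> S" using that by (simp add: T)
    have "((\<lambda>y. f (Q y)) has_derivative (\<lambda>v. f' (Q y) (Q v))) (at y within T)"
      by (rule has_derivative_in_compose[OF bounded_linear_imp_has_derivative[OF bl(2)]])
         (use Qy der in \<open>simp_all add: QT\<close>)
    from has_derivative_compose[OF this bounded_linear_imp_has_derivative[OF bl(1)]]
    show ?thesis by (simp add: g_def[abs_def] g'_def[abs_def])
  qed
  have ginj: "inj_on g T"
    using inj unfolding inj_on_def g_def T vimage_def by simp (metis QP)
  have detg: "det (matrix (g' y)) = det (matrix (f' (Q y)))" for y
  proof -
    have "Q (axis i 1) = axis (r i) 1" for i
      using r by (simp add: Q_def vec_eq_iff axis_def) (metis bij_inv_eq_iff)
    then have "matrix (g' y) $ i $ j = matrix (f' (Q y)) $ r i $ r j" for i j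
      by (simp add: matrix_def g'_def P_def)
    then have "matrix (g' y) = (\<chi> i j. matrix (f' (Q y)) $ r i $ r j)"
      by (simp add: vec_eq_iff)
    then show ?thesis by (simp add: det_reindex[OF r])
  qed
  let ?F = "\<lambda>x. indicator S x *\<^sub>R \<bar>det (matrix (f' x))\<bar>"
  have F: "integrable lborel ?F" using int by (simp add: set_integrable_def)
  then have Fd: "integrable (distr lborel borel Q) ?F"
    by (simp add: Q_def lborel_distr_reindex[OF r'])
  then have I1: "set_integrable lborel T (\<lambda>y. \<bar>det (matrix (g' y))\<bar>)"
    unfolding set_integrable_def by (subst (asm) integrable_distr_eq) (use F in \<open>auto simp: detg T indicator_def\<close>)
  have I2: "(LINT y:T|lborel. \<bar>det (matrix (g' y))\<bar>) = (LINT x:S|lborel. \<bar>det (matrix (f' x))\<bar>)"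
  proof -
    have "(LINT x:S|lborel. \<bar>det (matrix (f' x))\<bar>) = integral\<^sup>L (distr lborel borel Q) ?F"
      by (simp add: Q_def lborel_distr_reindex[OF r'] set_lebesgue_integral_def)
    also have "\<dots> = (LINT y:T|lborel. \<bar>det (matrix (g' y))\<bar>)"
      unfolding set_lebesgue_integral_def
      by (subst integral_distr) (use F in \<open>auto simp: detg T indicator_def\<close>)
    finally show ?thesis ..
  qed
  have hi: "((\<lambda>y. \<bar>det (matrix (g' y))\<bar>) has_integral (LINT y:T|lborel. \<bar>det (matrix (g' y))\<bar>)) T"
    using set_borel_integral_eq_integral[OF I1] by (simp add: has_integral_integral)
  have Tl: "T \<in> sets lebesgue" using Tb by simp
  have *: "g ` T \<in> lmeasurable \<and> measure lebesgue (g ` T) = (LINT y:T|lborel. \<bar>det (matrix (g' y))\<bar>)"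
    using hi has_measure_differentiable_image[OF Tl gder ginj] by blast
  have Qg: "Q ` (g ` T) = f ` S" unfolding g_def image_image T_def by simp
  show ?th1 ?th2
    using * I2 lmeasurable_reindex[OF r', of "g ` T"] measure_reindex[OF r', of "g ` T"]
    by (simp_all add: Q_def[symmetric] Qg)
qed

section \<open>Determinants of rank-one updates and of \<open>mat t + A\<close>\<close>

text \<open>In orthonormal coordinates with \<open>b\<close> along the axis \<open>k\<close>, the
  update changes only column \<open>k\<close> of the identity matrix; by Cramer's rule the
  determinant is then entry \<open>k\<close> of that column.\<close>

lemma det_rank_one_update:
  fixes a b :: "real^'n"
  shows "det (matrix (\<lambda>v. v + (b \<bullet> v) *\<^sub>R a)) = 1 + a \<bullet> b"
proof -
  obtain k :: 'n where True by blast
  obtain f :: "real^'n \<Rightarrow> real^'n" where f: "orthogonal_transformation f" and fb: "f (axis k (norm b)) = b"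
    by (rule orthogonal_transformation_exists[of "axis k (norm b)" b])
       (auto simp: norm_eq_sqrt_inner inner_axis_axis)
  define g where "g = inv f"
  have g: "orthogonal_transformation g" using f by (simp add: g_def orthogonal_transformation_inv)
  have gf [simp]: "g (f v) = v" "f (g v) = v" for v
    using orthogonal_transformation_bij[OF f] by (simp_all add: g_def bij_is_inj bij_is_surj surj_f_inv_f)
  have lin: "linear f" "linear g" using f g by (auto simp: orthogonal_transformation_linear)
  have inner: "f v \<bullet> w = v \<bullet> g w" for v w
    using f gf(2)[of w] unfolding orthogonal_transformation_def by metis
  have gb: "g b = axis k (norm b)" using gf(1)[of "axis k (norm b)"] by (simp add: fb)
  let ?T = "\<lambda>v. v + (b \<bullet> v) *\<^sub>R a"
  define x where "x = axis k 1 + norm b *\<^sub>R g a"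
  have lT: "linear ?T" by (rule linearI) (auto simp: algebra_simps inner_add_right)
  have "matrix (g \<circ> ?T \<circ> f) = matrix g ** matrix ?T ** matrix f"
    using lin lT by (simp add: matrix_compose linear_compose matrix_mul_assoc)
  then have "det (matrix (g \<circ> ?T \<circ> f)) = det (matrix g ** matrix f) * det (matrix ?T)"
    by (simp add: det_mul)
  also have "matrix g ** matrix f = mat 1"
    using matrix_compose[OF lin] by (simp add: o_def matrix_id_mat_1 flip: id_def)
  finally have 1: "det (matrix ?T) = det (matrix (g \<circ> ?T \<circ> f))" by (simp add: o_def)
  have "(g \<circ> ?T \<circ> f) v = v + (norm b * v $ k) *\<^sub>R g a" for v
  proof -
    have "b \<bullet> f v = norm b * v $ k"
      using inner[of v b] by (simp add: gb inner_commute inner_axis)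
    then show ?thesis using lin(2) by (simp add: linear_add linear_scale)
  qed
  then have "matrix (g \<circ> ?T \<circ> f) $ i $ j = (if j = k then x $ i else mat 1 $ i $ j)" for i j
    by (auto simp: matrix_def x_def axis_def mat_def)
  then have "matrix (g \<circ> ?T \<circ> f) = (\<chi> i j. if j = k then x $ i else mat 1 $ i $ j)"
    by (simp add: vec_eq_iff)
  then have "det (matrix (g \<circ> ?T \<circ> f)) = x $ k"
    using cramer_lemma[of k "mat 1 :: real^'n^'n" x]
    by (simp only: matrix_vector_mul_lid det_I mult.right_neutral)
  also have "x $ k = 1 + a \<bullet> b"
    using inner[of "axis k (norm b)" a] by (simp add: fb x_def inner_axis' inner_axis inner_commute)
  finally show ?thesis using 1 by simp
qed

text \<open>The coefficient of \<open>t ^ k\<close> in \<open>det (mat t + A)\<close>, that is, the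
  elementary symmetric polynomial of degree n - k in the eigenvalues. In the Leibniz formula
  \<open>X\<close> is the set of rows from which the summand \<open>t\<close> is taken;
  \<open>t\<close> stands on the diagonal only, so \<open>p\<close> has to fix
  \<open>X\<close>.\<close>

definition char_coeff :: "nat \<Rightarrow> real^'n^'n \<Rightarrow> real" where
  "char_coeff k A = (\<Sum>p | p permutes (UNIV :: 'n set). of_int (sign p) *
     (\<Sum>X | card X = k \<and> (\<forall>i\<in>X. p i = i). \<Prod>i\<in>- X. A $ i $ p i))"

lemma det_add_mat:
  fixes A :: "real^'n^'n"
  shows "det (mat t + A) = (\<Sum>k\<le>CARD('n). char_coeff k A * t ^ k)"
proof -
  have "(\<Prod>i\<in>UNIV. (mat t + A) $ i $ p i) =
      (\<Sum>k\<le>CARD('n). (\<Sum>X | card X = k \<and> (\<forall>i\<in>X. p i = i). \<Prod>i\<in>- X. A $ i $ p i) * t ^ k)" for p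
  proof -
    have *: "(\<Prod>i\<in>X. if p i = i then t else 0) = (if \<forall>i\<in>X. p i = i then t ^ card X else 0)" for X
      by (induction X rule: infinite_finite_induct) auto
    have "(\<Prod>i\<in>UNIV. (mat t + A) $ i $ p i) = (\<Prod>i\<in>UNIV. (if p i = i then t else 0) + A $ i $ p i)"
      by (intro prod.cong) (auto simp: mat_def)
    also have "\<dots> = (\<Sum>X\<in>UNIV. (if \<forall>i\<in>X. p i = i then t ^ card X else 0) * (\<Prod>i\<in>- X. A $ i $ p i))"
      by (subst prod_add) (auto simp: * Compl_eq_Diff_UNIV)
    also have "\<dots> = (\<Sum>X\<in>UNIV. \<Sum>k\<le>CARD('n). if card X = k then (if \<forall>i\<in>X. p i = i then t ^ k else 0) * (\<Prod>i\<in>- X. A $ i $ p i) else 0)"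
      by (intro sum.cong refl) (auto simp: card_mono)
    also have "\<dots> = (\<Sum>k\<le>CARD('n). \<Sum>X\<in>UNIV. if card X = k then (if \<forall>i\<in>X. p i = i then t ^ k else 0) * (\<Prod>i\<in>- X. A $ i $ p i) else 0)"
      by (rule sum.swap)
    also have "\<dots> = (\<Sum>k\<le>CARD('n). (\<Sum>X | card X = k \<and> (\<forall>i\<in>X. p i = i). \<Prod>i\<in>- X. A $ i $ p i) * t ^ k)"
      unfolding sum_distrib_right
      by (intro sum.cong refl sum.mono_neutral_cong_right) (auto split: if_splits)
    finally show ?thesis .
  qed
  then show ?thesis
    unfolding det_def char_coeff_def
    by (simp add: sum_distrib_left sum_distrib_right mult.assoc) (subst sum.swap, simp)
qed

lemma char_coeff_0: "char_coeff 0 A = det A"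
  using det_add_mat[of 0 A] by (simp add: power_0_left sum.delta if_distrib cong: if_cong)

text \<open>A permutation that fixes all indices but one is the identity, so only single diagonal
  entries survive.\<close>

lemma char_coeff_trace: "char_coeff (CARD('n) - 1) (A :: real^'n^'n) = trace A"
proof -
  have *: "{X :: 'n set. card X = CARD('n) - 1 \<and> (\<forall>i\<in>X. p i = i)} =
      (if p = id then (\<lambda>i. - {i}) ` UNIV else {})" if p: "p permutes UNIV" for p
  proof -
    have X: "\<exists>i. X = - {i}" if "card X = CARD('n) - 1" for X :: "'n set"
    proof -
      have "card (- X) = 1" using that by (simp add: Compl_eq_Diff_UNIV card_Diff_subset Suc_leI)
      then show ?thesis by (metis card_1_singletonE double_complement)
    qed
    have pid: "p = id" if *: "\<forall>j\<in>- {i}. p j = j" for i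
    proof -
      have "p i = i"
      proof (rule ccontr)
        assume "p i \<noteq> i"
        then have "p (p i) = p i" using * by simp
        then show False using permutes_inj[OF p] \<open>p i \<noteq> i\<close> by (simp add: inj_eq)
      qed
      then show ?thesis using * by (simp add: fun_eq_iff) (metis ComplI singletonD)
    qed
    have card: "card (- {i}) = CARD('n) - 1" for i :: 'n
      by (simp add: Compl_eq_Diff_UNIV card_Diff_subset)
    show ?thesis
    proof (cases "p = id")
      case True
      then show ?thesis using X card by auto
    next
      case False
      then have "\<not> (card X = CARD('n) - 1 \<and> (\<forall>i\<in>X. p i = i))" for X :: "'n set"
        using X pid by metis
      with False show ?thesis by simp
    qed
  qed
  have "char_coeff (CARD('n) - 1) A =
      (\<Sum>p | p permutes (UNIV :: 'n set). if p = id then (\<Sum>i\<in>UNIV. A $ i $ i) else 0)"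
    unfolding char_coeff_def
    by (intro sum.cong refl, subst *) (auto simp: sum.reindex inj_on_def)
  then show ?thesis by (simp add: sum.delta permutes_id trace_def)
qed

lemma continuous_on_char_coeff [continuous_intros]:
  "continuous_on S f \<Longrightarrow> continuous_on S (\<lambda>x. char_coeff k (f x))"
  unfolding char_coeff_def by (intro continuous_intros)

lemma det_mat_add_singular:
  fixes A :: "real^'n^'n"
  assumes "u \<noteq> 0" "A *v u = 0"
  shows "det (mat t + A) = t * (\<Sum>j<CARD('n). char_coeff (Suc j) A * t ^ j)"
proof -
  have "det A = 0"
    using assms by (metis invertible_det_nz invertible_left_inverse matrix_left_invertible_ker)
  have "det (mat t + A) = (\<Sum>k<Suc (CARD('n)). char_coeff k A * t ^ k)"
    by (simp add: det_add_mat lessThan_Suc_atMost)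
  also have "\<dots> = t * (\<Sum>j<CARD('n). char_coeff (Suc j) A * t ^ j)"
    using \<open>det A = 0\<close>
    by (simp add: sum.lessThan_Suc_shift char_coeff_0 sum_distrib_left algebra_simps del: sum.lessThan_Suc)
  finally show ?thesis .
qed

lemma mat_vector_mult: "mat t *v v = t *\<^sub>R (v :: real^'n)"
proof -
  have "mat t = t *\<^sub>R (mat 1 :: real^'n^'n)" by (simp add: vec_eq_iff mat_def)
  then show ?thesis by (simp add: scaleR_matrix_vector_assoc[symmetric])
qed

text \<open>All matrices on the segment from \<open>mat t\<close> to \<open>mat t + A\<close> have a
  positive definite quadratic form, hence trivial kernel; so the determinant cannot change its sign
  on the way.\<close>

lemma det_mat_add_pos:
  fixes A :: "real^'n^'n"
  assumes psd: "\<And>v. v \<bullet> (A *v v) \<ge> 0" and t: "t > 0"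
  shows "det (mat t + A) > 0"
proof (rule ccontr)
  define F where "F s = det (mat t + s *\<^sub>R A)" for s
  assume "\<not> det (mat t + A) > 0"
  then have 1: "F 1 \<le> 0" by (simp add: F_def)
  have 0: "F 0 \<ge> 0" using t by (simp add: F_def det_diagonal mat_def)
  have "continuous_on {0..1} F" unfolding F_def det_def by (intro continuous_intros)
  then obtain s where s: "0 \<le> s" "s \<le> 1" "F s = 0"
    using IVT2'[of F 1 0 0] 0 1 by auto
  then obtain v where v: "v \<noteq> 0" "(mat t + s *\<^sub>R A) *v v = 0"
    unfolding F_def by (metis invertible_det_nz invertible_left_inverse matrix_left_invertible_ker)
  have "v \<bullet> ((mat t + s *\<^sub>R A) *v v) = t * (v \<bullet> v) + s * (v \<bullet> (A *v v))"
  proof -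
    have "(s *\<^sub>R A) *v v = s *\<^sub>R (A *v v)" by (simp add: scaleR_matrix_vector_assoc)
    then show ?thesis by (simp add: matrix_vector_mult_add_rdistrib inner_add_right mat_vector_mult)
  qed
  moreover have "t * (v \<bullet> v) > 0" using t v(1) by simp
  moreover have "s * (v \<bullet> (A *v v)) \<ge> 0" using s psd by simp
  ultimately show False using v(2) by simp
qed

text \<open>The two rank-one updates on either side turn the block triangular map into \<open>mat \<tau> + A\<close>.\<close>

lemma det_polar_jacobian:
  fixes A :: "real^'n^'n" and u q :: "real^'n"
  assumes u: "norm u = 1" and Au: "A *v u = 0" and uA: "\<And>v. u \<bullet> (A *v v) = 0" and tau: "\<tau> \<noteq> 0"
  shows "det (matrix (\<lambda>v. (u \<bullet> v) *\<^sub>R q + A *v v + \<tau> *\<^sub>R (v - (u \<bullet> v) *\<^sub>R u))) =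
    (q \<bullet> u) * (\<Sum>j<CARD('n). char_coeff (Suc j) A * \<tau> ^ j)"
proof -
  let ?D = "\<lambda>v. (u \<bullet> v) *\<^sub>R q + A *v v + \<tau> *\<^sub>R (v - (u \<bullet> v) *\<^sub>R u)"
  let ?S = "\<lambda>v. v + (u \<bullet> v) *\<^sub>R ((\<tau> - 1) *\<^sub>R u)"
  let ?P = "\<lambda>v. v + (u \<bullet> v) *\<^sub>R (q - u)"
  let ?M = "\<lambda>v. (mat \<tau> + A) *v v"
  have uu: "u \<bullet> u = 1" using u by (simp add: dot_square_norm)
  have lin: "linear ?D" "linear ?S" "linear ?P" "linear ?M"
    by (auto intro!: linearI simp: algebra_simps inner_add_right matrix_vector_right_distrib matrix_vector_mult_scaleR)
  have "?D (?S v) = ?P (?M v)" for v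
  proof -
    have a: "u \<bullet> ?S v = \<tau> * (u \<bullet> v)" by (simp add: inner_add_right uu algebra_simps)
    have b: "A *v ?S v = A *v v"
      by (simp add: matrix_vector_right_distrib matrix_vector_mult_scaleR Au)
    have M: "?M v = \<tau> *\<^sub>R v + A *v v"
      by (simp add: mat_vector_mult matrix_vector_mult_add_rdistrib)
    have c: "u \<bullet> ?M v = \<tau> * (u \<bullet> v)" unfolding M by (simp add: inner_add_right uA)
    show ?thesis unfolding a b c unfolding M by (simp add: algebra_simps)
  qed
  then have "?D \<circ> ?S = ?P \<circ> ?M" by (simp add: fun_eq_iff)
  then have "det (matrix ?D ** matrix ?S) = det (matrix ?P ** matrix ?M)"
    using matrix_compose[OF lin(2,1)] matrix_compose[OF lin(4,3)] by simp
  then have "\<tau> * det (matrix ?D) = (q \<bullet> u) * det (mat \<tau> + A)"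
    by (simp add: det_mul det_rank_one_update uu inner_diff_left mult.commute del: scaleR_scaleR)
  also have "det (mat \<tau> + A) = \<tau> * (\<Sum>j<CARD('n). char_coeff (Suc j) A * \<tau> ^ j)"
    by (rule det_mat_add_singular[OF _ Au]) (use u in auto)
  finally show ?thesis using tau by simp
qed

section \<open>The inverse Gauss map of a body of class \<open>C\<^sup>2\<^sub>+\<close>\<close>

lemma has_derivative_sgn:
  fixes x :: "'a::real_inner"
  assumes "x \<noteq> 0"
  shows "(sgn has_derivative (\<lambda>v. (v - (sgn x \<bullet> v) *\<^sub>R sgn x) /\<^sub>R norm x)) (at x)"
proof -
  have "((\<lambda>x. inverse (norm x) *\<^sub>R x) has_derivative (\<lambda>v. (v - (sgn x \<bullet> v) *\<^sub>R sgn x) /\<^sub>R norm x)) (at x)"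
    using assms
    by (auto intro!: derivative_eq_intros has_derivative_norm simp: sgn_div_norm field_simps power2_eq_square scaleR_diff_right inner_commute)
  then show ?thesis by (simp add: sgn_div_norm[abs_def])
qed

lemma matrix_inv_cancel:
  fixes A :: "real^'n^'n"
  assumes "det A \<noteq> 0"
  shows "A ** matrix_inv A = mat 1" "matrix_inv A ** A = mat 1"
proof -
  have "\<exists>B. A ** B = mat 1 \<and> B ** A = mat 1"
    using assms by (simp add: invertible_det_nz[symmetric] invertible_def)
  then have "A ** matrix_inv A = mat 1 \<and> matrix_inv A ** A = mat 1"
    unfolding matrix_inv_def by (rule someI_ex)
  then show "A ** matrix_inv A = mat 1" "matrix_inv A ** A = mat 1" by auto
qed

lemma matrix_apply:
  fixes f :: "real^'n \<Rightarrow> real^'m"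
  shows "linear f \<Longrightarrow> matrix f *v v = f v"
  using matrix_vector_mul(2) by (rule fun_cong)

lemma det_nonzero_kernel:
  fixes A :: "real^'n^'n"
  assumes "det A \<noteq> 0" "A *v v = 0"
  shows "v = 0"
proof -
  have "v = (matrix_inv A ** A) *v v" using matrix_inv_cancel(2)[OF assms(1)] by simp
  also have "\<dots> = 0" using assms(2) by (simp add: matrix_vector_mul_assoc[symmetric])
  finally show ?thesis .
qed

lemma continuous_on_det_matrix:
  fixes M :: "'a::topological_space \<Rightarrow> real^'n^'n"
  shows "continuous_on S M \<Longrightarrow> continuous_on S (\<lambda>x. det (M x))"
  unfolding det_def by (intro continuous_intros)

text \<open>By Cramer's rule the entries of the inverse are quotients of determinants.\<close>

lemma continuous_on_matrix_inv:
  fixes M :: "'a::topological_space \<Rightarrow> real^'n^'n"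
  assumes "continuous_on S M" "\<And>x. x \<in> S \<Longrightarrow> det (M x) \<noteq> 0"
  shows "continuous_on S (\<lambda>x. matrix_inv (M x))"
proof -
  have eq: "matrix_inv (M x) = (\<chi> i j. det (\<chi> k l. if l = i then axis j 1 $ k else M x $ k $ l) / det (M x))"
    if "x \<in> S" for x
  proof -
    have "M x *v (matrix_inv (M x) *v axis j 1) = axis j 1" for j
      using matrix_inv_cancel(1)[OF assms(2)[OF that]] by (simp add: matrix_vector_mul_assoc)
    then have "matrix_inv (M x) *v axis j 1 = (\<chi> i. det (\<chi> k l. if l = i then axis j 1 $ k else M x $ k $ l) / det (M x))" for j
      using cramer[OF assms(2)[OF that]] by blast
    then show ?thesis
      by (simp add: vec_eq_iff matrix_vector_mult_basis column_def)
  qed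
  have minor: "continuous_on S (\<lambda>x. det (\<chi> k l. if l = i then axis j 1 $ k else M x $ k $ l))" for i j
  proof -
    have "continuous_on S (\<lambda>x. if l = i then c else M x $ k $ l)" for k l c
      using assms(1) by (cases "l = i") (auto intro!: continuous_intros)
    then show ?thesis unfolding det_def by (auto intro!: continuous_intros)
  qed
  have "continuous_on S (\<lambda>x. \<chi> i j. det (\<chi> k l. if l = i then axis j 1 $ k else M x $ k $ l) / det (M x))"
    by (intro continuous_on_vec_lambda continuous_on_divide minor continuous_on_det_matrix[OF assms(1)] ballI)
       (use assms(2) in auto)
  then show ?thesis by (subst continuous_on_cong[OF refl eq]) auto
qed

lemma has_real_derivative_along_line:
  fixes g :: "'a::real_normed_vector \<Rightarrow> real"
  assumes "(g has_derivative g') (at y)"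
  shows "((\<lambda>t. g (y + t *\<^sub>R v)) has_real_derivative g' v) (at 0)"
proof -
  have "((\<lambda>t. y + t *\<^sub>R v) has_derivative (\<lambda>t. t *\<^sub>R v)) (at 0)"
    by (auto intro!: derivative_eq_intros)
  from has_derivative_compose[OF this, of g g'] have
    "((\<lambda>t. g (y + t *\<^sub>R v)) has_derivative (\<lambda>t. g' (t *\<^sub>R v))) (at 0)" using assms by simp
  moreover have "(\<lambda>t. g' (t *\<^sub>R v)) = (*) (g' v)"
    using linear_scale[OF has_derivative_linear[OF assms]] by (simp add: fun_eq_iff)
  ultimately show ?thesis by (simp add: has_field_derivative_def)
qed

lemma open_contains_line:
  fixes y v :: "'a::real_normed_vector"
  assumes "open U" "y \<in> U"
  shows "\<exists>e>0. \<forall>t. \<bar>t\<bar> < e \<longrightarrow> y + t *\<^sub>R v \<in> U"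
proof -
  have "isCont (\<lambda>t. y + t *\<^sub>R v) 0" by (intro continuous_intros)
  then have "((\<lambda>t. y + t *\<^sub>R v) \<longlongrightarrow> y) (at 0)" by (simp add: isCont_def)
  then have "\<forall>\<^sub>F t in at 0. y + t *\<^sub>R v \<in> U" using assms by (rule topological_tendstoD)
  then obtain e where "e > 0" "\<And>t. t \<noteq> 0 \<Longrightarrow> \<bar>t\<bar> < e \<Longrightarrow> y + t *\<^sub>R v \<in> U"
    by (auto simp: eventually_at dist_real_def)
  then show ?thesis using assms(2) by (metis add.right_neutral scaleR_zero_left)
qed

text \<open>For \<open>w \<noteq> 0\<close>: the point \<open>y\<close> lies on the boundary of
  \<open>K\<close> and has outer normal \<open>w\<close>.\<close>

definition contact_point :: "'a::real_inner set \<Rightarrow> 'a \<Rightarrow> 'a \<Rightarrow> bool" where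
  "contact_point K w y \<longleftrightarrow> y \<in> K \<and> (\<forall>k\<in>K. k \<bullet> w \<le> y \<bullet> w)"

lemma contact_point_frontier:
  fixes K :: "'a::euclidean_space set"
  assumes "contact_point K w y" "w \<noteq> 0"
  shows "y \<in> frontier K"
proof -
  have "y \<notin> interior K"
  proof
    assume "y \<in> interior K"
    then obtain e where e: "e > 0" "ball y e \<subseteq> K" by (meson mem_interior)
    define z where "z = y + (e / (2 * norm w)) *\<^sub>R w"
    have "dist y z < e" using e assms(2) by (simp add: z_def dist_norm)
    then have "z \<in> K" using e by auto
    then have "z \<bullet> w \<le> y \<bullet> w" using assms(1) by (simp add: contact_point_def)
    moreover have "z \<bullet> w = y \<bullet> w + (e / (2 * norm w)) * (w \<bullet> w)" by (simp add: z_def inner_add_left)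
    moreover have "(e / (2 * norm w)) * (w \<bullet> w) > 0" using e assms(2) by simp
    ultimately show False by linarith
  qed
  then show ?thesis using assms(1) closure_subset by (auto simp: contact_point_def frontier_def)
qed

text \<open>If \<open>g y < 0\<close>, then \<open>y\<close> would be an interior point. If the
  normal \<nu> = \<open>sgn (G y)\<close> differed from \<open>w\<close>, the direction
  \<open>w - \<nu>\<close> would decrease \<open>g\<close>, hence lead into \<open>K\<close>, and at
  the same time increase the functional \<open>w\<close>.\<close>

lemma contact_point_defining_function:
  assumes def: "C2_defining_function K U g G H" and c: "contact_point K w y" and y: "y \<in> U" and w: "norm w = 1"
  shows "g y = 0" "sgn (G y) = w"
proof -
  have op: "open U" and KU: "K \<inter> U = {y \<in> U. g y \<le> 0}" and Gy: "G y \<noteq> 0"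
    and der: "(g has_derivative (\<lambda>h. h \<bullet> G y)) (at y)"
    using def y by (auto simp: C2_defining_function_def gderiv_def)
  have yf: "y \<in> frontier K" using contact_point_frontier[OF c] w by force
  have gle: "g y \<le> 0" using c y KU by (auto simp: contact_point_def)
  show "g y = 0"
  proof (rule ccontr)
    assume "g y \<noteq> 0"
    then have "g y < 0" using gle by simp
    moreover have "isCont g y" using der has_derivative_continuous by blast
    ultimately have "\<forall>\<^sub>F z in at y. g z < 0" unfolding isCont_def by (simp add: order_tendstoD)
    moreover have "\<forall>\<^sub>F z in at y. z \<in> U" using op y by (rule eventually_at_in_open')
    ultimately have "\<forall>\<^sub>F z in at y. z \<in> K" by eventually_elim (use KU in force)
    then have "\<forall>\<^sub>F z in nhds y. z \<in> K" using c by (auto simp: eventually_at_filter contact_point_def elim!: eventually_mono)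
    then have "y \<in> interior K" by (auto simp: eventually_nhds intro: interiorI)
    then show False using yf by (simp add: frontier_def)
  qed
  define \<nu> where "\<nu> = sgn (G y)"
  have n: "norm \<nu> = 1" using Gy by (simp add: \<nu>_def norm_sgn)
  have GN: "G y = norm (G y) *\<^sub>R \<nu>" using Gy by (simp add: \<nu>_def sgn_div_norm)
  show "sgn (G y) = w"
  proof (rule ccontr)
    assume ne: "sgn (G y) \<noteq> w"
    have lt: "w \<bullet> \<nu> < 1"
    proof -
      have "norm (w - \<nu>) > 0" using ne by (simp add: \<nu>_def)
      then have "(w - \<nu>) \<bullet> (w - \<nu>) > 0" by simp
      moreover have "(w - \<nu>) \<bullet> (w - \<nu>) = 2 - 2 * (w \<bullet> \<nu>)"
        using n w by (simp add: inner_diff inner_commute norm_eq_1)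
      ultimately show ?thesis by linarith
    qed
    define v where "v = w - \<nu>"
    have "v \<bullet> G y < 0"
    proof -
      have "v \<bullet> \<nu> < 0" using lt n by (simp add: v_def inner_diff_left dot_square_norm)
      then show ?thesis using Gy by (subst GN) (simp add: mult_pos_neg)
    qed
    note gv = has_real_derivative_along_line[OF der, of v]
    from DERIV_neg_dec_right[OF gv \<open>v \<bullet> G y < 0\<close>] obtain d where
      d: "d > 0" "\<And>t. 0 < t \<Longrightarrow> t < d \<Longrightarrow> g (y + t *\<^sub>R v) < g y" by auto
    obtain e where e: "e > 0" "\<And>t. \<bar>t\<bar> < e \<Longrightarrow> y + t *\<^sub>R v \<in> U"
      using open_contains_line[OF op y, of v] by blast
    define t where "t = min d e / 2"
    have t: "t > 0" "t < d" "\<bar>t\<bar> < e" using d(1) e(1) by (auto simp: t_def)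
    then have "y + t *\<^sub>R v \<in> {y \<in> U. g y \<le> 0}" using d(2)[of t] e(2)[of t] gle by simp
    then have "y + t *\<^sub>R v \<in> K" unfolding KU[symmetric] by simp
    then have "t * (v \<bullet> w) \<le> 0" using c by (force simp: contact_point_def inner_add_left)
    moreover have "v \<bullet> w > 0" using lt w by (simp add: v_def inner_diff inner_commute dot_square_norm)
    ultimately show False using t(1) by (simp add: mult_le_0_iff)
  qed
qed

text \<open>A point \<open>k\<close> of \<open>K\<close> beyond the tangent plane at
  \<open>y\<close> is impossible: the segment from \<open>y\<close> to \<open>k\<close> stays in
  \<open>K\<close> by convexity, yet \<open>g\<close> increases from 0 along its beginning.\<close>

lemma contact_pointI_defining_function:
  assumes def: "C2_defining_function K U g G H" and K: "convex K" and y: "y \<in> U" "g y = 0"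
  shows "contact_point K (sgn (G y)) y"
  unfolding contact_point_def
proof (intro conjI ballI)
  have op: "open U" and KU: "K \<inter> U = {y \<in> U. g y \<le> 0}" and Gy: "G y \<noteq> 0"
    and der: "(g has_derivative (\<lambda>h. h \<bullet> G y)) (at y)"
    using def y(1) by (auto simp: C2_defining_function_def gderiv_def)
  have "y \<in> K \<inter> U" unfolding KU using y by simp
  then show yK: "y \<in> K" by simp
  fix k assume k: "k \<in> K"
  show "k \<bullet> sgn (G y) \<le> y \<bullet> sgn (G y)"
  proof (rule ccontr)
    assume neg: "\<not> ?thesis"
    define v where "v = k - y"
    have "v \<bullet> sgn (G y) > 0" using neg by (simp add: v_def inner_diff_left)
    then have pos: "v \<bullet> G y > 0" by (simp add: sgn_div_norm zero_less_mult_iff)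
    note gv = has_real_derivative_along_line[OF der, of v]
    from DERIV_pos_inc_right[OF gv pos] obtain d where
      d: "d > 0" "\<And>t. 0 < t \<Longrightarrow> t < d \<Longrightarrow> g (y + t *\<^sub>R v) > g y" by auto
    obtain e where e: "e > 0" "\<And>t. \<bar>t\<bar> < e \<Longrightarrow> y + t *\<^sub>R v \<in> U"
      using open_contains_line[OF op y(1), of v] by blast
    define t where "t = min (min d e) 1 / 2"
    have t: "t > 0" "t < d" "\<bar>t\<bar> < e" "t < 1" using d(1) e(1) by (auto simp: t_def)
    have "(1 - t) *\<^sub>R y + t *\<^sub>R k \<in> K" using K yK k t by (intro convexD) auto
    then have "y + t *\<^sub>R v \<in> K" by (simp add: v_def algebra_simps)
    then have "y + t *\<^sub>R v \<in> K \<inter> U" using e(2)[of t] t by simp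
    then have "g (y + t *\<^sub>R v) \<le> 0" unfolding KU by simp
    then show False using d(2)[of t] t y(2) by simp
  qed
qed

text \<open>
  At a contact point \<open>y\<close> the map \<open>x \<mapsto> (1 + g x) *\<^sub>R sgn (G x)\<close> is a local
  \<open>C\<^sup>1\<close> diffeomorphism, since the Gauss curvature is non-zero; its inverse restricted to the sphere is
  the inverse of the Gauss map.
\<close>

lemma local_inverse_gauss_map:
  fixes K :: "(real^'n) set"
  assumes K: "convex K" and def: "C2_defining_function K U g G H" and x0: "x0 \<in> U" "g x0 = 0"
    and curv: "gauss_curvature (\<lambda>y. sgn (G y)) x0 > 0"
  obtains U' V \<Theta> \<Theta>' where "open U'" "x0 \<in> U'" "U' \<subseteq> U" "inj_on (\<lambda>y. (1 + g y) *\<^sub>R sgn (G y)) U'"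
    "open V" "sgn (G x0) \<in> V"
    "\<And>w. w \<in> V \<Longrightarrow> norm w = 1 \<Longrightarrow> contact_point K w (\<Theta> w)"
    "\<And>w. w \<in> V \<Longrightarrow> (\<Theta> has_derivative (\<lambda>v. \<Theta>' w *v v)) (at w)"
    "continuous_on V \<Theta>'"
proof -
  have op: "open U" and KU: "K \<inter> U = {y \<in> U. g y \<le> 0}"
    and Gnz: "\<And>y. y \<in> U \<Longrightarrow> G y \<noteq> 0"
    and gder: "\<And>y. y \<in> U \<Longrightarrow> (g has_derivative (\<lambda>h. h \<bullet> G y)) (at y)"
    and Gder: "\<And>y. y \<in> U \<Longrightarrow> (G has_derivative (\<lambda>h. H y *v h)) (at y)"
    and Hc: "continuous_on U H"
    using def by (auto simp: C2_defining_function_def gderiv_def)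
  have gc: "continuous_on U g" and Gc: "continuous_on U G"
    using gder Gder by (meson continuous_at_imp_continuous_on has_derivative_continuous)+
  define \<nu> where "\<nu> y = sgn (G y)" for y
  define D where "D y v = (H y *v v - (\<nu> y \<bullet> (H y *v v)) *\<^sub>R \<nu> y) /\<^sub>R norm (G y)" for y v
  have \<nu>der: "(\<nu> has_derivative D y) (at y)" if "y \<in> U" for y
    using has_derivative_compose[OF Gder has_derivative_sgn, OF that Gnz[OF that]]
    by (simp add: \<nu>_def[abs_def] D_def[abs_def])
  have \<nu>n: "norm (\<nu> y) = 1" if "y \<in> U" for y using Gnz[OF that] by (simp add: \<nu>_def norm_sgn)
  have \<nu>c: "continuous_on U \<nu>"
    using \<nu>der by (meson continuous_at_imp_continuous_on has_derivative_continuous)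
  have \<nu>D: "\<nu> y \<bullet> D y v = 0" if "y \<in> U" for y v
    using \<nu>n[OF that] by (simp add: D_def inner_diff_right dot_square_norm)
  define \<Psi> where "\<Psi> y = (1 + g y) *\<^sub>R \<nu> y" for y
  define L where "L y v = (1 + g y) *\<^sub>R D y v + (v \<bullet> G y) *\<^sub>R \<nu> y" for y v
  define M where "M y = matrix (L y)" for y
  have \<Psi>der: "(\<Psi> has_derivative L y) (at y)" if "y \<in> U" for y
    unfolding \<Psi>_def[abs_def] L_def[abs_def]
    by (auto intro!: derivative_eq_intros gder[OF that] \<nu>der[OF that])
  have M: "M y *v v = L y v" if "y \<in> U" for y v
    using \<Psi>der[OF that] by (simp add: M_def matrix_apply has_derivative_linear)
  have Mc: "continuous_on U M"
  proof -
    have "continuous_on U (\<lambda>y. H y *v axis j 1)" for j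
      unfolding matrix_vector_mult_basis column_def using Hc by (intro continuous_intros)
    then show ?thesis
      unfolding M_def[abs_def] matrix_def L_def D_def
      using gc Gc \<nu>c Gnz by (intro continuous_intros) auto
  qed
  \<comment> \<open>At \<open>x0\<close> the factor \<open>1 + g\<close> is 1. The component along
    \<nu> shows that a kernel vector is tangent; it is then annihilated by the Weingarten map, whose
    determinant is the Gauss curvature.\<close>
  have det0: "det (M x0) \<noteq> 0"
  proof
    assume "det (M x0) = 0"
    then obtain v where v: "v \<noteq> 0" "M x0 *v v = 0"
      by (metis invertible_det_nz invertible_left_inverse matrix_left_invertible_ker)
    then have Lv: "D x0 v + (v \<bullet> G x0) *\<^sub>R \<nu> x0 = 0" using x0 by (simp add: M L_def)
    have "\<nu> x0 \<bullet> (D x0 v + (v \<bullet> G x0) *\<^sub>R \<nu> x0) = v \<bullet> G x0"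
      using \<nu>n[OF x0(1)] \<nu>D[OF x0(1)] by (simp add: inner_add_right dot_square_norm)
    then have vG: "v \<bullet> G x0 = 0" using Lv by simp
    then have Dv: "D x0 v = 0" using Lv by simp
    have v\<nu>: "v \<bullet> \<nu> x0 = 0" using vG by (simp add: \<nu>_def sgn_div_norm)
    let ?W = "\<lambda>v. D x0 (v - (v \<bullet> \<nu> x0) *\<^sub>R \<nu> x0) + (v \<bullet> \<nu> x0) *\<^sub>R \<nu> x0"
    have "frechet_derivative \<nu> (at x0) = D x0" using frechet_derivative_at[OF \<nu>der[OF x0(1)]] by simp
    then have "det (matrix ?W) \<noteq> 0"
      using curv by (simp add: gauss_curvature_def \<nu>_def[symmetric] flip: \<nu>_def[abs_def])
    moreover have "linear ?W"
    proof -
      have lD: "linear (D x0)" using \<nu>der[OF x0(1)] by (rule has_derivative_linear)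
      show ?thesis
        by (rule linearI) (simp_all add: linear_add[OF lD] linear_diff[OF lD] linear_scale[OF lD] algebra_simps inner_add_left)
    qed
    moreover have "matrix ?W *v v = ?W v"
      by (rule matrix_apply) fact
    ultimately have "?W v \<noteq> 0"
      using v(1) det_nonzero_kernel[of "matrix ?W" v] by auto
    then show False using Dv v\<nu> by simp
  qed
  \<comment> \<open>Keeps \<open>1 + g\<close> positive: a point of \<open>U1\<close> that is mapped
    to a unit vector then has \<open>1 + g = 1\<close> and lies on the boundary of
    \<open>K\<close>.\<close>
  define U1 where "U1 = {y \<in> U. - 1 < g y}"
  have "open U1"
    using continuous_open_preimage[OF gc op open_greaterThan[of "-1"]]
    by (simp add: U1_def vimage_def Int_def conj_commute)
  have x01: "x0 \<in> U1" "U1 \<subseteq> U" using x0 by (auto simp: U1_def)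
  have bl: "bounded_linear ((*v) A)" for A :: "real^'n^'n" by simp
  define B where "B = (\<lambda>A :: real^'n^'n. Blinfun ((*v) A))"
  have B: "blinfun_apply (B A) v = A *v v" for A v by (simp add: B_def bounded_linear_Blinfun_apply bl)
  have linB: "linear B"
    by (rule linearI; rule blinfun_eqI)
       (simp_all add: B plus_blinfun.rep_eq scaleR_blinfun.rep_eq matrix_vector_mult_add_rdistrib scaleR_matrix_vector_assoc)
  have Bc: "continuous_on UNIV B"
    using linB by (simp add: linear_conv_bounded_linear linear_continuous_on)
  have inv: "B (matrix_inv (M x0)) o\<^sub>L B (M x0) = id_blinfun"
    by (rule blinfun_eqI) (simp add: B matrix_vector_mul_assoc matrix_inv_cancel[OF det0])
  obtain U' V \<Theta> g' where *: "open U'" "U' \<subseteq> U1" "x0 \<in> U'" "open V" "\<Psi> x0 \<in> V" "homeomorphism U' V \<Psi> \<Theta>"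
    and \<Theta>der: "\<And>y. y \<in> V \<Longrightarrow> (\<Theta> has_derivative (g' y)) (at y)"
    and g': "\<And>y. y \<in> V \<Longrightarrow> g' y = inv (blinfun_apply (B (M (\<Theta> y))))"
    and bij: "\<And>y. y \<in> V \<Longrightarrow> bij (blinfun_apply (B (M (\<Theta> y))))"
  proof (rule inverse_function_theorem[of U1 \<Psi> "\<lambda>y. B (M y)" x0 "B (matrix_inv (M x0))"])
    show "(\<Psi> has_derivative blinfun_apply (B (M x))) (at x)" if "x \<in> U1" for x
    proof -
      have "blinfun_apply (B (M x)) = L x" using that M by (auto simp: B U1_def fun_eq_iff)
      then show ?thesis using \<Psi>der that by (simp add: U1_def)
    qed
    show "continuous_on U1 (\<lambda>y. B (M y))"
      using continuous_on_compose2[OF Bc Mc] x01(2) continuous_on_subset by blast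
  qed (use \<open>open U1\<close> x01 inv in auto)
  have \<Theta>in: "\<Theta> w \<in> U1" "\<Psi> (\<Theta> w) = w" if "w \<in> V" for w
    using *(2,6) that unfolding homeomorphism_def by auto
  have detV: "det (M (\<Theta> w)) \<noteq> 0" if "w \<in> V" for w
  proof
    assume "det (M (\<Theta> w)) = 0"
    then obtain v where "v \<noteq> 0" "M (\<Theta> w) *v v = 0"
      by (metis invertible_det_nz invertible_left_inverse matrix_left_invertible_ker)
    then have "blinfun_apply (B (M (\<Theta> w))) v = blinfun_apply (B (M (\<Theta> w))) 0" by (simp add: B)
    then show False using bij[OF that] \<open>v \<noteq> 0\<close> by (metis bij_is_inj injD)
  qed
  show ?thesis
  proof
    show "open U'" "x0 \<in> U'" "U' \<subseteq> U" "open V" using * x01 by auto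
    show "sgn (G x0) \<in> V" using *(5) x0 by (simp add: \<Psi>_def \<nu>_def)
    have "inj_on \<Psi> U'"
      by (rule inj_on_inverseI[of _ \<Theta>]) (use *(6) in \<open>simp add: homeomorphism_def\<close>)
    then show "inj_on (\<lambda>y. (1 + g y) *\<^sub>R sgn (G y)) U'"
      by (simp add: \<Psi>_def[abs_def] \<nu>_def)
    show "contact_point K w (\<Theta> w)" if w: "w \<in> V" "norm w = 1" for w
    proof -
      have U: "\<Theta> w \<in> U" and gt: "g (\<Theta> w) > -1" using \<Theta>in(1)[OF w(1)] by (auto simp: U1_def)
      have e: "(1 + g (\<Theta> w)) *\<^sub>R \<nu> (\<Theta> w) = w" using \<Theta>in(2)[OF w(1)] by (simp add: \<Psi>_def)
      then have "\<bar>1 + g (\<Theta> w)\<bar> = 1" using \<nu>n[OF U] w(2) by (metis mult.right_neutral norm_scaleR)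
      then have "g (\<Theta> w) = 0" using gt by simp
      then show ?thesis
        using contact_pointI_defining_function[OF def K U] e by (simp add: \<nu>_def)
    qed
    show "(\<Theta> has_derivative (\<lambda>v. matrix_inv (M (\<Theta> w)) *v v)) (at w)" if w: "w \<in> V" for w
    proof -
      have "g' w = (\<lambda>v. matrix_inv (M (\<Theta> w)) *v v)"
        unfolding g'[OF w] by (intro inv_equality) (simp_all add: B matrix_vector_mul_assoc matrix_inv_cancel[OF detV[OF w]])
      then show ?thesis using \<Theta>der[OF w] by simp
    qed
    have "continuous_on V \<Theta>" using *(6) by (simp add: homeomorphism_def)
    then have "continuous_on V (\<lambda>w. M (\<Theta> w))"
      using continuous_on_compose2[OF Mc, of V \<Theta>] \<Theta>in(1) by (auto simp: U1_def)
    then show "continuous_on V (\<lambda>w. matrix_inv (M (\<Theta> w)))"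
      using detV by (rule continuous_on_matrix_inv)
  qed
qed

text \<open>
  A convex body whose support function is \<open>C\<^sup>2\<close> off the origin, with gradient \<open>p\<close> and Hessian
  \<open>A\<close>; \<open>p x\<close> is the boundary point with outer normal \<open>x\<close>.
\<close>

locale smooth_body =
  fixes K :: "(real^'n) set" and p :: "real^'n \<Rightarrow> real^'n" and A :: "real^'n \<Rightarrow> real^'n^'n"
  assumes compact_body: "compact K" and convex_body: "convex K"
    and contact: "x \<noteq> 0 \<Longrightarrow> contact_point K x (p x)"
    and p_der: "x \<noteq> 0 \<Longrightarrow> (p has_derivative (\<lambda>v. A x *v v)) (at x)"
    and A_cont: "continuous_on (- {0}) A"

lemma contact_point_pos_scale:
  "c > 0 \<Longrightarrow> contact_point K (c *\<^sub>R w) y \<longleftrightarrow> contact_point K w y"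
  by (simp add: contact_point_def)

text \<open>The local inverses of the Gauss map agree because the contact point of a normal is
  unique; so they glue to one map \<open>p\<close>, extended to all non-zero vectors through
  \<open>sgn\<close>.\<close>

lemma C2_plus_imp_smooth_body:
  fixes K :: "(real^'n) set"
  assumes K: "convex_body K" and C2: "C2_plus K"
  obtains p A where "smooth_body K p A"
proof -
  have comp: "compact K" and conv: "convex K" and ne: "K \<noteq> {}"
    using K interior_subset by (auto simp: convex_body_def)
  \<comment> \<open>Keeps of the local inverse only what is used below: injectivity near
    \<open>y\<close> for the uniqueness of contact points, and the map \<open>\<Theta>\<close> for
    their smooth dependence on the normal.\<close>
  have loc: "\<exists>U' V \<Theta> \<Theta>' g G. open U' \<and> y \<in> U' \<and> inj_on (\<lambda>y. (1 + g y) *\<^sub>R sgn (G y)) U' \<and>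
      (\<forall>z\<in>U'. contact_point K w z \<longrightarrow> (1 + g z) *\<^sub>R sgn (G z) = w) \<and>
      open V \<and> w \<in> V \<and> (\<forall>w\<in>V. norm w = 1 \<longrightarrow> contact_point K w (\<Theta> w)) \<and>
      (\<forall>w\<in>V. (\<Theta> has_derivative (\<lambda>v. \<Theta>' w *v v)) (at w)) \<and> continuous_on V \<Theta>'"
    if c: "contact_point K w y" and w: "norm w = 1" for w y
  proof -
    have "w \<noteq> 0" using w by auto
    then have "y \<in> frontier K" using contact_point_frontier[OF c] by simp
    then obtain U g G H where y: "y \<in> U" and def: "C2_defining_function K U g G H"
      and curv: "gauss_curvature (\<lambda>y. sgn (G y)) y > 0"
      using C2 unfolding C2_plus_def by blast
    have gy: "g y = 0" "sgn (G y) = w"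
      using contact_point_defining_function[OF def c y w] by auto
    obtain U' V \<Theta> \<Theta>' where *: "open U'" "y \<in> U'" "U' \<subseteq> U" "inj_on (\<lambda>y. (1 + g y) *\<^sub>R sgn (G y)) U'"
      "open V" "sgn (G y) \<in> V"
      "\<And>w. w \<in> V \<Longrightarrow> norm w = 1 \<Longrightarrow> contact_point K w (\<Theta> w)"
      "\<And>w. w \<in> V \<Longrightarrow> (\<Theta> has_derivative (\<lambda>v. \<Theta>' w *v v)) (at w)"
      "continuous_on V \<Theta>'"
      by (rule local_inverse_gauss_map[OF conv def y gy(1) curv]) (rule that; assumption)
    have "(1 + g z) *\<^sub>R sgn (G z) = w" if "z \<in> U'" "contact_point K w z" for z
      using contact_point_defining_function[OF def that(2) _ w] that(1) *(3) by auto
    then show ?thesis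
      by (intro exI[of _ U'] exI[of _ V] exI[of _ \<Theta>] exI[of _ \<Theta>'] exI[of _ g] exI[of _ G])
         (use * gy(2) in auto)
  qed
  \<comment> \<open>By convexity the whole segment between two contact points consists of contact
    points. All of them near \<open>y0\<close> are mapped to \<open>w\<close>, against local
    injectivity.\<close>
  have uniq: "y1 = y0" if c0: "contact_point K w y0" and c1: "contact_point K w y1" and w: "norm w = 1" for w y0 y1
  proof (rule ccontr)
    assume ne: "y1 \<noteq> y0"
    obtain U' and g and G :: "real^'n \<Rightarrow> real^'n" where U': "open U'" "y0 \<in> U'" and inj: "inj_on (\<lambda>y. (1 + g y) *\<^sub>R sgn (G y)) U'"
      and val: "\<And>z. z \<in> U' \<Longrightarrow> contact_point K w z \<Longrightarrow> (1 + g z) *\<^sub>R sgn (G z) = w"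
      using loc[OF c0 w] by blast
    obtain e where e: "e > 0" "\<And>t. \<bar>t\<bar> < e \<Longrightarrow> y0 + t *\<^sub>R (y1 - y0) \<in> U'"
      using open_contains_line[OF U', of "y1 - y0"] by blast
    define t where "t = min e 1 / 2"
    have t: "0 < t" "t < 1" "\<bar>t\<bar> < e" using e(1) by (auto simp: t_def)
    define z where "z = y0 + t *\<^sub>R (y1 - y0)"
    have zc: "z = (1 - t) *\<^sub>R y0 + t *\<^sub>R y1" by (simp add: z_def algebra_simps)
    have "z \<in> K" unfolding zc using c0 c1 t conv by (intro convexD) (auto simp: contact_point_def)
    have "y1 \<bullet> w = y0 \<bullet> w" using c0 c1 by (simp add: contact_point_def order_antisym)
    then have "z \<bullet> w = y0 \<bullet> w" by (simp add: z_def inner_add_left inner_diff_left)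
    then have "contact_point K w z" using \<open>z \<in> K\<close> c0 by (simp add: contact_point_def)
    moreover have "z \<in> U'" using e(2)[OF t(3)] by (simp add: z_def)
    ultimately have "z = y0" using val[of z] val[OF U'(2) c0] inj U'(2) by (auto simp: inj_on_def)
    then show False using t ne by (simp add: z_def)
  qed
  have ex: "\<exists>y. contact_point K w y" for w
  proof -
    have "continuous_on K (\<lambda>y. y \<bullet> w)" by (intro continuous_intros)
    from continuous_attains_sup[OF comp ne this] show ?thesis by (auto simp: contact_point_def)
  qed
  define p where "p w = (SOME y. contact_point K w y)" for w
  have pc: "contact_point K w (p w)" for w unfolding p_def using ex by (rule someI_ex)
  \<comment> \<open>Defined through the Frechet derivative, \<open>A\<close> does not depend on the
    choice of a local inverse, so its continuity can be checked on each neighbourhood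
    separately.\<close>
  define A where "A x = matrix (frechet_derivative p (at x))" for x
  have main: "\<exists>W B. open W \<and> x0 \<in> W \<and> 0 \<notin> W \<and> (\<forall>x\<in>W. (p has_derivative (\<lambda>v. B x *v v)) (at x)) \<and> continuous_on W B"
    if x0: "x0 \<noteq> 0" for x0
  proof -
    have w: "norm (sgn x0) = 1" using x0 by (simp add: norm_sgn)
    obtain V \<Theta> \<Theta>' where V: "open V" "sgn x0 \<in> V"
      and \<Theta>: "\<And>w. w \<in> V \<Longrightarrow> norm w = 1 \<Longrightarrow> contact_point K w (\<Theta> w)"
      and \<Theta>der: "\<And>w. w \<in> V \<Longrightarrow> (\<Theta> has_derivative (\<lambda>v. \<Theta>' w *v v)) (at w)"
      and \<Theta>c: "continuous_on V \<Theta>'"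
      using loc[OF pc w] by blast
    define W where "W = {x \<in> - {0}. sgn x \<in> V}"
    have sgnc: "continuous_on (- {0}) (sgn :: real^'n \<Rightarrow> _)" by (intro continuous_intros) auto
    have "W = (- {0}) \<inter> sgn -` V" by (auto simp: W_def)
    then have W: "open W"
      using continuous_open_preimage[OF sgnc open_Compl[OF closed_singleton] V(1)] by simp
    have pW: "\<Theta> (sgn x) = p x" if "x \<in> W" for x
    proof -
      have x: "x \<noteq> 0" "sgn x \<in> V" using that by (auto simp: W_def)
      have n: "norm (sgn x) = 1" using x by (simp add: norm_sgn)
      have "contact_point K (sgn x) (p x)"
        using pc[of x] x contact_point_pos_scale[of "inverse (norm x)" K x] by (simp add: sgn_div_norm)
      then show ?thesis using uniq[OF _ \<Theta>[OF x(2) n] n] by simp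
    qed
    define S where "S x v = (v - (sgn x \<bullet> v) *\<^sub>R sgn x) /\<^sub>R norm x" for x v :: "real^'n"
    define B where "B x = \<Theta>' (sgn x) ** matrix (S x)" for x
    have "(p has_derivative (\<lambda>v. B x *v v)) (at x)" if x: "x \<in> W" for x
    proof -
      have nz: "x \<noteq> 0" "sgn x \<in> V" using x by (auto simp: W_def)
      have S: "(sgn has_derivative S x) (at x)" using has_derivative_sgn[OF nz(1)] by (simp add: S_def[abs_def])
      have "((\<lambda>x. \<Theta> (sgn x)) has_derivative (\<lambda>v. \<Theta>' (sgn x) *v S x v)) (at x)"
        using has_derivative_compose[OF S, of \<Theta> "\<lambda>v. \<Theta>' (sgn x) *v v"] \<Theta>der[OF nz(2)] by simp
      moreover have "\<Theta>' (sgn x) *v S x v = B x *v v" for v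
        using matrix_apply[OF has_derivative_linear[OF S]] by (simp add: B_def matrix_vector_mul_assoc[symmetric])
      ultimately have "((\<lambda>x. \<Theta> (sgn x)) has_derivative (\<lambda>v. B x *v v)) (at x)" by simp
      then show ?thesis
        by (rule has_derivative_transform_within_open[OF _ W x]) (rule pW)
    qed
    moreover have "continuous_on W B"
    proof -
      have "continuous_on W (\<lambda>x. \<Theta>' (sgn x))"
        by (rule continuous_on_compose2[OF \<Theta>c]) (auto intro!: continuous_intros simp: W_def)
      moreover have "continuous_on W (\<lambda>x. matrix (S x))"
        unfolding matrix_def S_def by (intro continuous_intros) (auto simp: W_def)
      ultimately show ?thesis
        unfolding B_def matrix_matrix_mult_def by (intro continuous_intros)
    qed
    ultimately show ?thesis using W V(2) x0 by (intro exI[of _ W] exI[of _ B]) (auto simp: W_def)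
  qed
  have AB: "A x = B" if "(p has_derivative (\<lambda>v. B *v v)) (at x)" for x B
  proof -
    have f: "frechet_derivative p (at x) = (\<lambda>v. B *v v)"
      by (rule frechet_derivative_at[OF that, symmetric])
    show ?thesis unfolding A_def f by (rule matrix_of_matrix_vector_mul)
  qed
  have "smooth_body K p A"
  proof
    show "(p has_derivative (\<lambda>v. A x *v v)) (at x)" if nz: "x \<noteq> 0" for x
    proof -
      obtain B where "(p has_derivative (\<lambda>v. B *v v)) (at x)" using main[OF nz] by blast
      then show ?thesis using AB by simp
    qed
    show "continuous_on (- {0}) A"
    proof (rule continuous_at_imp_continuous_on, rule ballI)
      fix x0 :: "real^'n" assume "x0 \<in> - {0}"
      then obtain W B where W: "open W" "x0 \<in> W" "\<And>x. x \<in> W \<Longrightarrow> (p has_derivative (\<lambda>v. B x *v v)) (at x)"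
        "continuous_on W B"
        using main[of x0] by auto
      have "continuous_on W A"
        using W(4) by (rule continuous_on_eq) (use AB[OF W(3)] in simp)
      then show "isCont A x0" using W(1,2) by (simp add: continuous_on_eq_continuous_at)
    qed
  qed (use comp conv pc in auto)
  then show ?thesis by (rule that)
qed

section \<open>Calculus of the support function\<close>

context smooth_body
begin

abbreviation h :: "real^'n \<Rightarrow> real" where "h \<equiv> support_function K"

lemma body_nonempty: "K \<noteq> {}"
proof -
  obtain k :: 'n where True by blast
  have "contact_point K (axis k 1) (p (axis k 1))" by (rule contact) (simp add: axis_eq_0_iff)
  then show ?thesis by (auto simp: contact_point_def)
qed

lemma p_in: "x \<noteq> 0 \<Longrightarrow> p x \<in> K"
  using contact by (simp add: contact_point_def)

lemma h_eq: "x \<noteq> 0 \<Longrightarrow> h x = p x \<bullet> x"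
  unfolding support_function_def
  using contact[of x] by (intro cSup_eq_maximum) (auto simp: contact_point_def)

lemma h_0 [simp]: "h 0 = 0"
  using body_nonempty by (simp add: support_function_def)

lemma inner_le_h: "k \<in> K \<Longrightarrow> k \<bullet> x \<le> h x"
  using contact[of x] by (cases "x = 0") (auto simp: h_eq contact_point_def)

lemma p_cont: "continuous_on (- {0}) p"
  using p_der by (intro continuous_at_imp_continuous_on ballI has_derivative_continuous) auto

text \<open>Among all \<open>y \<noteq> 0\<close> the value \<open>p y \<bullet> x\<close> is
  largest at \<open>y = x\<close>, so its derivative vanishes there.\<close>

lemma inner_A_left: 
  assumes "x \<noteq> 0"
  shows "x \<bullet> (A x *v v) = 0"
proof -
  have "((\<lambda>y. p y \<bullet> x) has_derivative (\<lambda>v. (A x *v v) \<bullet> x)) (at x)"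
    using p_der[OF assms] by (auto intro!: derivative_eq_intros)
  then have "(\<lambda>v. (A x *v v) \<bullet> x) = (\<lambda>v. 0)"
    by (rule differential_zero_maxmin[of x "- {0}", rotated 2]) (use assms in \<open>auto simp: h_eq[symmetric] intro!: disjI1 inner_le_h p_in\<close>)
  then show ?thesis by (metis inner_commute)
qed

text \<open>The envelope theorem: in the derivative of \<open>p y \<bullet> y\<close> the
  contribution of \<open>p\<close> drops out by \<open>inner_A_left\<close>.\<close>

lemma h_der:
  assumes "x \<noteq> 0"
  shows "(h has_derivative (\<lambda>v. p x \<bullet> v)) (at x)"
proof -
  have "((\<lambda>y. p y \<bullet> y) has_derivative (\<lambda>v. p x \<bullet> v + (A x *v v) \<bullet> x)) (at x)"
    using p_der[OF assms] by (auto intro!: derivative_eq_intros)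
  then have "((\<lambda>y. p y \<bullet> y) has_derivative (\<lambda>v. p x \<bullet> v)) (at x)"
    using inner_A_left[OF assms] by (simp add: inner_commute)
  then show ?thesis
    by (rule has_derivative_transform_within_open[of _ _ _ _ "- {0}"]) (use assms h_eq in auto)
qed

text \<open>The function \<open>h y - k \<bullet> y\<close> is non-negative and vanishes at
  \<open>x\<close>, hence its gradient \<open>p x - k\<close> is zero.\<close>

lemma contact_unique:
  assumes x: "x \<noteq> 0" and k: "k \<in> K" "k \<bullet> x = h x"
  shows "k = p x"
proof -
  have "((\<lambda>y. h y - k \<bullet> y) has_derivative (\<lambda>v. p x \<bullet> v - k \<bullet> v)) (at x)"
    using h_der[OF x] by (auto intro!: derivative_eq_intros)
  then have "(\<lambda>v. p x \<bullet> v - k \<bullet> v) = (\<lambda>v. 0)"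
    by (rule differential_zero_maxmin[of x UNIV, rotated 2]) (use k inner_le_h in auto)
  then have "p x \<bullet> (p x - k) - k \<bullet> (p x - k) = 0" by metis
  then have "(p x - k) \<bullet> (p x - k) = 0" by (simp add: inner_diff_left)
  then show ?thesis by simp
qed

lemma h_scale: "c \<ge> 0 \<Longrightarrow> h (c *\<^sub>R x) = c * h x"
proof (cases "c = 0 \<or> x = 0")
  case False
  assume "c \<ge> 0"
  with False have c: "c > 0" "x \<noteq> 0" by auto
  show ?thesis
  proof (rule antisym)
    have "p (c *\<^sub>R x) \<bullet> x \<le> h x" using c by (intro inner_le_h p_in) auto
    then show "h (c *\<^sub>R x) \<le> c * h x" using c by (simp add: h_eq)
    have "p x \<bullet> (c *\<^sub>R x) \<le> h (c *\<^sub>R x)" using c by (intro inner_le_h p_in) auto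
    then show "c * h x \<le> h (c *\<^sub>R x)" using c by (simp add: h_eq)
  qed
qed auto

lemma p_scale: "c > 0 \<Longrightarrow> p (c *\<^sub>R x) = p x"
proof (cases "x = 0")
  case False
  assume c: "c > 0"
  have "c * (p (c *\<^sub>R x) \<bullet> x) = c * h x"
    using h_eq[of "c *\<^sub>R x"] c False by (simp add: h_scale)
  then have "p (c *\<^sub>R x) = p x"
    using c False by (intro contact_unique) (auto simp: p_in)
  then show ?thesis .
qed auto

lemma A_scale:
  assumes c: "c > 0" and x: "x \<noteq> 0"
  shows "A (c *\<^sub>R x) = (1 / c) *\<^sub>R A x"
proof -
  have "((\<lambda>y. p (c *\<^sub>R y)) has_derivative (\<lambda>v. A (c *\<^sub>R x) *v (c *\<^sub>R v))) (at x)"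
    by (rule has_derivative_compose[of "\<lambda>y. c *\<^sub>R y" "\<lambda>v. c *\<^sub>R v" x UNIV p "\<lambda>v. A (c *\<^sub>R x) *v v"])
       (use p_der[of "c *\<^sub>R x"] c x in \<open>auto intro!: derivative_eq_intros\<close>)
  then have "(p has_derivative (\<lambda>v. A (c *\<^sub>R x) *v (c *\<^sub>R v))) (at x)"
    using p_scale[OF c] by simp
  from has_derivative_unique[OF this p_der[OF x]]
  have "A (c *\<^sub>R x) *v (c *\<^sub>R v) = A x *v v" for v by (rule fun_cong)
  then have "(c *\<^sub>R A (c *\<^sub>R x)) *v v = A x *v v" for v
    by (simp add: matrix_vector_mult_scaleR scaleR_matrix_vector_assoc)
  then have "c *\<^sub>R A (c *\<^sub>R x) = A x" by (simp add: matrix_eq)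
  then have "(1 / c) *\<^sub>R (c *\<^sub>R A (c *\<^sub>R x)) = (1 / c) *\<^sub>R A x" by simp
  then show ?thesis using c by simp
qed

text \<open>\<open>p\<close> is constant along the ray through \<open>x\<close>. Together with
  \<open>inner_A_left\<close> this makes \<open>A x\<close> an operator on the tangent space
  orthogonal to \<open>x\<close>.\<close>

lemma A_radial:
  assumes x: "x \<noteq> 0"
  shows "A x *v x = 0"
proof -
  have "((\<lambda>t. x + t *\<^sub>R x) has_derivative (\<lambda>t. t *\<^sub>R x)) (at 0)"
    by (auto intro!: derivative_eq_intros)
  then have 1: "((\<lambda>t::real. p (x + t *\<^sub>R x)) has_derivative (\<lambda>t. A x *v (t *\<^sub>R x))) (at 0)"
    by (rule has_derivative_compose) (use p_der[OF x] in simp)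
  have "((\<lambda>t::real. p x) has_derivative (\<lambda>t. A x *v (t *\<^sub>R x))) (at 0)"
    by (rule has_derivative_transform_within_open[OF 1, of "{-1<..<1}"])
       (use p_scale[of "1 + _" x] in \<open>auto simp: algebra_simps\<close>)
  from has_derivative_unique[OF this has_derivative_const]
  have "A x *v (1 *\<^sub>R x) = 0" by metis
  then show ?thesis by simp
qed

text \<open>The gradient of a convex function is monotone: the maximality of \<open>p x\<close> for
  the normal \<open>x\<close> and of \<open>p y\<close> for the normal \<open>y\<close> add up to
  \<open>(p y - p x) \<bullet> (y - x) \<ge> 0\<close>.\<close>

lemma A_nonneg:
  assumes x: "x \<noteq> 0"
  shows "v \<bullet> (A x *v v) \<ge> 0"
proof (rule ccontr)
  assume neg: "\<not> ?thesis"
  have "((\<lambda>y. p y \<bullet> v) has_derivative (\<lambda>w. (A x *v w) \<bullet> v)) (at x)"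
    using p_der[OF x] by (auto intro!: derivative_eq_intros)
  from has_real_derivative_along_line[OF this, of v]
  have "((\<lambda>t. p (x + t *\<^sub>R v) \<bullet> v) has_real_derivative (A x *v v) \<bullet> v) (at 0)" .
  from DERIV_neg_dec_right[OF this] obtain d where
    d: "d > 0" "\<And>t. 0 < t \<Longrightarrow> t < d \<Longrightarrow> p (x + t *\<^sub>R v) \<bullet> v < p x \<bullet> v"
    using neg by (auto simp: inner_commute)
  obtain e where e: "e > 0" "\<And>t. \<bar>t\<bar> < e \<Longrightarrow> x + t *\<^sub>R v \<in> - {0}"
    using open_contains_line[of "- {0}" x v] x by auto
  define t where "t = min d e / 2"
  have t: "t > 0" "t < d" "\<bar>t\<bar> < e" using d(1) e(1) by (auto simp: t_def)
  define y where "y = x + t *\<^sub>R v"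
  have y: "y \<noteq> 0" using e(2)[OF t(3)] by (simp add: y_def)
  have "p y \<bullet> x \<le> p x \<bullet> x" "p x \<bullet> y \<le> p y \<bullet> y"
    using inner_le_h[OF p_in[OF y], of x] inner_le_h[OF p_in[OF x], of y] x y by (simp_all add: h_eq)
  then have "t * (p x \<bullet> v) \<le> t * (p y \<bullet> v)" by (simp add: y_def inner_add_right)
  then show False using d(2)[OF t(1,2)] t(1) by (simp add: y_def)
qed

lemma h_cont: "continuous_on UNIV h"
proof (rule continuous_at_imp_continuous_on, rule ballI)
  fix x :: "real^'n"
  show "isCont h x"
  proof (cases "x = 0")
    case False
    then show ?thesis using h_der has_derivative_continuous by blast
  next
    case True
    obtain B where B: "B > 0" "\<And>k. k \<in> K \<Longrightarrow> norm k \<le> B"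
      using compact_imp_bounded[OF compact_body] by (auto simp: bounded_pos)
    have "\<bar>h y\<bar> \<le> B * norm y" for y
    proof (cases "y = 0")
      case False
      have "\<bar>p y \<bullet> y\<bar> \<le> norm (p y) * norm y" by (rule Cauchy_Schwarz_ineq2)
      also have "\<dots> \<le> B * norm y" using B(2)[OF p_in[OF False]] by (simp add: mult_right_mono)
      finally show ?thesis using False by (simp add: h_eq)
    qed auto
    then have "(h \<longlongrightarrow> 0) (at 0)"
      by (intro Lim_null_comparison[of h "\<lambda>y. B * norm y"]) (auto intro!: tendsto_eq_intros)
    then show ?thesis using True by (simp add: isCont_def)
  qed
qed

end

section \<open>Lebesgue measure on the unit ball\<close>

lemma borel_measurable_off_zero:
  fixes f :: "'a::euclidean_space \<Rightarrow> 'b::topological_space"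
  shows "continuous_on (- {0}) f \<Longrightarrow> f \<in> borel_measurable borel"
  by (rule borel_measurable_continuous_countable_exceptions[of "{0}"]) auto

lemma borel_measurable_sgn [measurable]: "(sgn :: 'a::euclidean_space \<Rightarrow> 'a) \<in> borel_measurable borel"
  by (rule borel_measurable_off_zero) (auto intro!: continuous_intros)

lemma borel_measurable_indicator_cball [measurable]:
  "indicator (cball a r) \<in> borel_measurable (borel :: 'a::euclidean_space measure)"
  by (intro borel_measurable_indicator) simp

text \<open>Lebesgue measure of the unit ball, not normalized. As a density on the whole space it
  lets plain Borel measurability suffice throughout.\<close>

definition lball :: "'a::euclidean_space measure" where
  "lball = density lborel (indicator (cball 0 1))"

lemma sets_lball [simp, measurable_cong]: "sets lball = sets borel"
  and space_lball [simp]: "space lball = UNIV"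
  by (simp_all add: lball_def)

lemma finite_measure_lball: "finite_measure (lball :: 'a::euclidean_space measure)"
proof
  have "emeasure (lball :: 'a measure) (space lball) = emeasure lborel (cball (0::'a) 1)"
    by (simp add: lball_def emeasure_density)
  then show "emeasure (lball :: 'a measure) (space lball) \<noteq> \<infinity>"
    using emeasure_lborel_cball_finite[of "0::'a" 1] by (metis infinity_ennreal_def less_irrefl)
qed

interpretation lball: finite_measure lball
  by (rule finite_measure_lball)

lemma AE_lball: "AE x in lborel. P x \<Longrightarrow> AE x in lball. P x"
  unfolding lball_def by (subst AE_density) auto

lemma AE_lball_cball: "AE x in lball. norm x \<le> 1"
  unfolding lball_def by (subst AE_density) (auto simp: indicator_def)

lemma AE_lball_nonzero: "AE x in lball. x \<noteq> 0"
  by (rule AE_lball) (rule AE_lborel_singleton)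

text \<open>The bound is asked for off the origin only, because functions such as
  \<open>q (sgn x)\<close> are controlled there while their value at 0 is arbitrary.\<close>

lemma integrable_lballI:
  fixes f :: "'a::euclidean_space \<Rightarrow> real"
  assumes "f \<in> borel_measurable borel" "\<And>x. norm x \<le> 1 \<Longrightarrow> x \<noteq> 0 \<Longrightarrow> \<bar>f x\<bar> \<le> B"
  shows "integrable lball f"
proof (rule lball.integrable_const_bound)
  show "AE x in lball. norm (f x) \<le> B"
    using AE_lball_cball AE_lball_nonzero by eventually_elim (use assms(2) in auto)
qed (use assms(1) in simp)

lemma integral_lball:
  fixes f :: "'a::euclidean_space \<Rightarrow> real"
  assumes [measurable]: "f \<in> borel_measurable borel"
  shows "integral\<^sup>L lball f = (LINT x:cball 0 1|lborel. f x)"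
  unfolding lball_def set_lebesgue_integral_def
  by (subst integral_density[of _ _ "indicator (cball 0 1)", simplified ennreal_indicator]) auto

lemma nn_integral_lball:
  fixes f :: "'a::euclidean_space \<Rightarrow> ennreal"
  assumes [measurable]: "f \<in> borel_measurable borel"
  shows "integral\<^sup>N lball f = (\<integral>\<^sup>+x. indicator (cball 0 1) x * f x \<partial>lborel)"
  unfolding lball_def by (subst nn_integral_density) auto

section \<open>Scaling and polar decomposition\<close>

lemma nn_integral_lborel_scale:
  fixes f :: "'a::euclidean_space \<Rightarrow> ennreal"
  assumes [measurable]: "f \<in> borel_measurable borel" and c: "c \<noteq> 0"
  shows "(\<integral>\<^sup>+x. f x \<partial>lborel) = ennreal (\<bar>c\<bar> ^ DIM('a)) * (\<integral>\<^sup>+x. f (t + c *\<^sub>R x) \<partial>lborel)"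
proof -
  have "(\<integral>\<^sup>+x. f x \<partial>lborel) = (\<integral>\<^sup>+x. f x \<partial>density (distr lborel borel (\<lambda>x. t + c *\<^sub>R x)) (\<lambda>_. \<bar>c\<bar> ^ DIM('a)))"
    using lborel_affine[OF c, of t] by simp
  also have "\<dots> = (\<integral>\<^sup>+x. ennreal (\<bar>c\<bar> ^ DIM('a)) * f (t + c *\<^sub>R x) \<partial>lborel)"
    by (subst nn_integral_density) (auto simp: nn_integral_distr)
  also have "\<dots> = ennreal (\<bar>c\<bar> ^ DIM('a)) * (\<integral>\<^sup>+x. f (t + c *\<^sub>R x) \<partial>lborel)"
    by (rule nn_integral_cmult) simp
  finally show ?thesis .
qed

lemma integral_lborel_scale:
  fixes f :: "'a::euclidean_space \<Rightarrow> real"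
  assumes [measurable]: "f \<in> borel_measurable borel" and c: "c \<noteq> 0"
  shows "(LINT x|lborel. f x) = \<bar>c\<bar> ^ DIM('a) * (LINT x|lborel. f (c *\<^sub>R x))"
proof -
  have "(LINT x|lborel. f x) = (LINT x|density (distr lborel borel (\<lambda>x. 0 + c *\<^sub>R x)) (\<lambda>_. \<bar>c\<bar> ^ DIM('a)). f x)"
    using lborel_affine[OF c, of "0::'a"] by simp
  also have "\<dots> = (LINT x|lborel. \<bar>c\<bar> ^ DIM('a) * f (c *\<^sub>R x))"
    by (subst integral_density) (auto simp: integral_distr)
  finally show ?thesis by simp
qed

lemma sgn_scale_pos: "c > 0 \<Longrightarrow> sgn (c *\<^sub>R x) = sgn (x :: 'a::real_normed_vector)"
  by (simp add: sgn_scaleR)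

text \<open>
  Polar decomposition of Lebesgue measure without a measure on the sphere: by Tonelli and the
  scaling \<open>x \<mapsto> norm y *\<^sub>R x\<close> the left-hand side times the integral of any \<open>v (norm y)\<close> is the
  integral of \<open>w (norm y)\<close> times a constant that does not depend on \<open>w\<close>.
\<close>

lemma nn_integral_polar:
  fixes f :: "'a::euclidean_space \<Rightarrow> ennreal" and w :: "real \<Rightarrow> ennreal"
  assumes [measurable]: "f \<in> borel_measurable borel" "w \<in> borel_measurable borel"
  shows "(\<integral>\<^sup>+x. f (sgn x) * w (norm x) \<partial>lborel) * emeasure lborel (cball (0::'a) 1) =
    (\<integral>\<^sup>+(x::'a). w (norm x) \<partial>lborel) * (\<integral>\<^sup>+x. f (sgn x) \<partial>lball)"
proof -
  define n where "n = DIM('a)"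
  define v where "v = (indicator {..1} :: real \<Rightarrow> ennreal)"
  have [measurable]: "v \<in> borel_measurable borel" by (simp add: v_def)
  \<comment> \<open>The exponent 2n has two sources in the substitution of y / |x| for y: the volume
    element contributes |x|^(-n), and so does the factor |y|^n left by the first scaling. The last
    scaling of x by |y| then removes every power of |y|.\<close>
  define C where "C = (\<integral>\<^sup>+(x::'a). f (sgn x) * (ennreal (inverse (norm x ^ (2 * n))) * v (inverse (norm x))) \<partial>lborel)"
  have nz: "AE x in (lborel :: 'a measure). x \<noteq> 0" by (rule AE_lborel_singleton)
  have key: "(\<integral>\<^sup>+x. f (sgn x) * w (norm x) \<partial>lborel) * (\<integral>\<^sup>+(y::'a). v (norm y) \<partial>lborel) =
    (\<integral>\<^sup>+(x::'a). w (norm x) \<partial>lborel) * C"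
    if [measurable]: "w \<in> borel_measurable borel" for w
  proof -
    have "(\<integral>\<^sup>+x. f (sgn x) * w (norm x) \<partial>lborel) * (\<integral>\<^sup>+(y::'a). v (norm y) \<partial>lborel) =
        (\<integral>\<^sup>+(y::'a). (\<integral>\<^sup>+(x::'a). f (sgn x) * w (norm x) \<partial>lborel) * v (norm y) \<partial>lborel)"
      by (rule nn_integral_cmult[symmetric]) simp
    also have "\<dots> = (\<integral>\<^sup>+(y::'a). \<integral>\<^sup>+(x::'a). f (sgn x) * (ennreal (norm y ^ n) * w (norm x * norm y) * v (norm y)) \<partial>lborel \<partial>lborel)"
    proof (rule nn_integral_cong_AE)
      show "AE (y::'a) in lborel. (\<integral>\<^sup>+(x::'a). f (sgn x) * w (norm x) \<partial>lborel) * v (norm y) =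
        (\<integral>\<^sup>+(x::'a). f (sgn x) * (ennreal (norm y ^ n) * w (norm x * norm y) * v (norm y)) \<partial>lborel)"
        using nz
      proof eventually_elim
        case (elim y)
        have "(\<integral>\<^sup>+(x::'a). f (sgn x) * w (norm x) \<partial>lborel) =
            ennreal (norm y ^ n) * (\<integral>\<^sup>+(x::'a). f (sgn x) * w (norm x * norm y) \<partial>lborel)"
          using elim by (subst nn_integral_lborel_scale[where c = "norm y" and t = 0])
            (simp_all add: n_def sgn_scale_pos mult.commute)
        also have "\<dots> * v (norm y) = (\<integral>\<^sup>+(x::'a). (ennreal (norm y ^ n) * v (norm y)) * (f (sgn x) * w (norm x * norm y)) \<partial>lborel)"
          by (subst nn_integral_cmult) (simp_all add: mult_ac)
        finally show ?case by (simp add: mult_ac)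
      qed
    qed
    also have "\<dots> = (\<integral>\<^sup>+(x::'a). \<integral>\<^sup>+(y::'a). f (sgn x) * (ennreal (norm y ^ n) * w (norm x * norm y) * v (norm y)) \<partial>lborel \<partial>lborel)"
      by (rule lborel_pair.Fubini') simp
    also have "\<dots> = (\<integral>\<^sup>+(x::'a). \<integral>\<^sup>+(y::'a). f (sgn x) * (ennreal (inverse (norm x ^ (2 * n)) * norm y ^ n) * w (norm y) * v (norm y / norm x)) \<partial>lborel \<partial>lborel)"
    proof (rule nn_integral_cong_AE)
      show "AE (x::'a) in lborel. (\<integral>\<^sup>+(y::'a). f (sgn x) * (ennreal (norm y ^ n) * w (norm x * norm y) * v (norm y)) \<partial>lborel) =
        (\<integral>\<^sup>+(y::'a). f (sgn x) * (ennreal (inverse (norm x ^ (2 * n)) * norm y ^ n) * w (norm y) * v (norm y / norm x)) \<partial>lborel)"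
        using nz
      proof eventually_elim
        case (elim x)
        have e: "ennreal (norm x ^ n) * ennreal (inverse (norm x ^ (2 * n)) * (norm x * r) ^ n) = ennreal (r ^ n)" for r
          unfolding mult_2 power_add using elim by (simp add: ennreal_mult'[symmetric] power_mult_distrib field_simps)
        have "(\<integral>\<^sup>+(y::'a). f (sgn x) * (ennreal (inverse (norm x ^ (2 * n)) * norm y ^ n) * w (norm y) * v (norm y / norm x)) \<partial>lborel)
          = (\<integral>\<^sup>+(y::'a). ennreal (norm x ^ n) * (f (sgn x) * (ennreal (inverse (norm x ^ (2 * n)) * (norm x * norm y) ^ n) * w (norm x * norm y) * v (norm y))) \<partial>lborel)"
          using elim by (subst nn_integral_lborel_scale[where c = "norm x" and t = 0])
            (simp_all add: n_def[symmetric] nn_integral_cmult)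
        also have "\<dots> = (\<integral>\<^sup>+(y::'a). f (sgn x) * (ennreal (norm y ^ n) * w (norm x * norm y) * v (norm y)) \<partial>lborel)"
        proof (intro nn_integral_cong)
          fix y :: 'a
          show "ennreal (norm x ^ n) * (f (sgn x) * (ennreal (inverse (norm x ^ (2 * n)) * (norm x * norm y) ^ n) * w (norm x * norm y) * v (norm y))) =
              f (sgn x) * (ennreal (norm y ^ n) * w (norm x * norm y) * v (norm y))"
            unfolding e[of "norm y", symmetric] by (simp only: mult_ac)
        qed
        finally show ?case ..
      qed
    qed
    also have "\<dots> = (\<integral>\<^sup>+(y::'a). \<integral>\<^sup>+(x::'a). f (sgn x) * (ennreal (inverse (norm x ^ (2 * n)) * norm y ^ n) * w (norm y) * v (norm y / norm x)) \<partial>lborel \<partial>lborel)"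
      by (rule lborel_pair.Fubini') simp
    also have "\<dots> = (\<integral>\<^sup>+(y::'a). w (norm y) * C \<partial>lborel)"
    proof (rule nn_integral_cong_AE)
      show "AE (y::'a) in lborel. (\<integral>\<^sup>+(x::'a). f (sgn x) * (ennreal (inverse (norm x ^ (2 * n)) * norm y ^ n) * w (norm y) * v (norm y / norm x)) \<partial>lborel) = w (norm y) * C"
        using nz
      proof eventually_elim
        case (elim y)
        have d: "norm y * (inverse (norm y) * r) = r" for r using elim by (simp add: mult.assoc[symmetric])
        have e: "ennreal (norm y ^ n) * ennreal (inverse ((norm y * r) ^ (2 * n)) * norm y ^ n) = ennreal (inverse (r ^ (2 * n)))" for r
          unfolding mult_2 power_add using elim by (simp add: ennreal_mult'[symmetric] power_mult_distrib field_simps)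
        have "(\<integral>\<^sup>+(x::'a). f (sgn x) * (ennreal (inverse (norm x ^ (2 * n)) * norm y ^ n) * w (norm y) * v (norm y / norm x)) \<partial>lborel)
          = (\<integral>\<^sup>+(x::'a). ennreal (norm y ^ n) * (f (sgn x) * (ennreal (inverse ((norm y * norm x) ^ (2 * n)) * norm y ^ n) * w (norm y) * v (inverse (norm x)))) \<partial>lborel)"
          using elim by (subst nn_integral_lborel_scale[where c = "norm y" and t = 0])
            (simp_all add: n_def[symmetric] sgn_scale_pos nn_integral_cmult divide_inverse d)
        also have "\<dots> = (\<integral>\<^sup>+(x::'a). w (norm y) * (f (sgn x) * (ennreal (inverse (norm x ^ (2 * n))) * v (inverse (norm x)))) \<partial>lborel)"
        proof (intro nn_integral_cong)
          fix x :: 'a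
          show "ennreal (norm y ^ n) * (f (sgn x) * (ennreal (inverse ((norm y * norm x) ^ (2 * n)) * norm y ^ n) * w (norm y) * v (inverse (norm x)))) =
              w (norm y) * (f (sgn x) * (ennreal (inverse (norm x ^ (2 * n))) * v (inverse (norm x))))"
            unfolding e[of "norm x", symmetric] by (simp only: mult_ac)
        qed
        also have "\<dots> = w (norm y) * C" unfolding C_def by (rule nn_integral_cmult) simp
        finally show ?case .
      qed
    qed
    also have "\<dots> = (\<integral>\<^sup>+(x::'a). w (norm x) \<partial>lborel) * C"
      by (rule nn_integral_multc) simp
    finally show ?thesis .
  qed
  have vb: "v (norm x) = indicator (cball 0 1) x" for x :: 'a by (simp add: v_def indicator_def)
  have v1: "(\<integral>\<^sup>+(y::'a). v (norm y) \<partial>lborel) = emeasure lborel (cball (0::'a) 1)"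
    by (simp add: vb)
  have v2: "(\<integral>\<^sup>+x. f (sgn x) * v (norm x) \<partial>lborel) = (\<integral>\<^sup>+x. f (sgn x) \<partial>lball)"
    by (simp add: nn_integral_lball vb mult.commute)
  have fin: "emeasure lborel (cball (0::'a) 1) \<noteq> 0" "emeasure lborel (cball (0::'a) 1) \<noteq> \<infinity>"
    using unit_ball_vol_pos[of "real DIM('a)", OF of_nat_0_le_iff, THEN less_imp_neq, symmetric]
    by (simp_all add: emeasure_cball)
  \<comment> \<open>The instance \<open>w = v\<close>, the indicator of the unit interval,
    identifies \<open>C\<close> after division by the volume of the ball.\<close>
  have "emeasure lborel (cball (0::'a) 1) * (\<integral>\<^sup>+x. f (sgn x) \<partial>lball) = emeasure lborel (cball (0::'a) 1) * C"
    using key[of v] unfolding v1 v2 by (simp add: mult.commute)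
  then have "(\<integral>\<^sup>+x. f (sgn x) \<partial>lball) = C"
    using fin by (simp only: ennreal_mult_cancel_left) simp
  then show ?thesis using key[of w] by (simp add: v1)
qed


lemma unit_ball_vol_eq: "measure lborel (cball (0::'a::euclidean_space) 1) = measure (lball :: 'a measure) UNIV"
  by (simp add: lball_def measure_def emeasure_density)

lemma measure_lball_pos: "measure (lball :: 'a::euclidean_space measure) UNIV > 0"
  unfolding unit_ball_vol_eq[symmetric] by (simp add: content_cball_gt_0_iff del: content_cball)

lemma emeasure_unit_cball: "emeasure lborel (cball (0::'a::euclidean_space) 1) = ennreal (measure (lball :: 'a measure) UNIV)"
proof -
  have "emeasure lborel (cball (0::'a) 1) \<noteq> top"
    using emeasure_lborel_cball_finite[of "0::'a" 1] by simp
  then show ?thesis by (simp add: unit_ball_vol_eq[symmetric] emeasure_eq_ennreal_measure)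
qed

lemma integral_lball_polar:
  fixes f :: "'a::euclidean_space \<Rightarrow> real" and w :: "real \<Rightarrow> real"
  assumes [measurable]: "f \<in> borel_measurable borel" "w \<in> borel_measurable borel"
    and f: "\<And>u. norm u = 1 \<Longrightarrow> \<bar>f u\<bar> \<le> B" and w: "\<And>r. 0 \<le> w r" "\<And>r. w r \<le> B'"
  shows "(LINT x|lball. f (sgn x) * w (norm x)) * measure (lball :: 'a measure) UNIV =
    (LINT (x::'a)|lball. w (norm x)) * (LINT x|lball. f (sgn x))"
proof -
  have main: "(LINT x|lball. f (sgn x) * w (norm x)) * measure (lball :: 'a measure) UNIV =
      (LINT (x::'a)|lball. w (norm x)) * (LINT x|lball. f (sgn x))"
    if [measurable]: "f \<in> borel_measurable borel" and f: "\<And>u. norm u = 1 \<Longrightarrow> f u \<le> B" "\<And>u. f u \<ge> 0"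
    for f :: "'a \<Rightarrow> real" and B
  proof -
    define W where "W r = ennreal (w r) * indicator {..1} r" for r
    have [measurable]: "W \<in> borel_measurable borel" by (simp add: W_def[abs_def])
    have cb: "indicator {..1} (norm x) = (indicator (cball 0 1) x :: ennreal)" for x :: 'a
      by (simp add: indicator_def)
    have i1: "integrable lball (\<lambda>x::'a. w (norm x))"
      by (rule integrable_lballI[of _ B']) (use w in auto)
    have i2: "integrable lball (\<lambda>x. f (sgn x))"
      by (rule integrable_lballI[of _ B]) (use f in \<open>auto simp: norm_sgn\<close>)
    have i3: "integrable lball (\<lambda>x. f (sgn x) * w (norm x))"
    proof (rule integrable_lballI[of _ "B * B'"])
      fix x :: 'a assume "x \<noteq> 0"
      then have "f (sgn x) \<le> B" "0 \<le> f (sgn x)" using f by (auto simp: norm_sgn)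
      then show "\<bar>f (sgn x) * w (norm x)\<bar> \<le> B * B'"
        using w[of "norm x"] by (auto simp: abs_mult intro!: mult_mono)
    qed simp
    have "(\<integral>\<^sup>+x. ennreal (f (sgn x)) * W (norm x) \<partial>lborel) * emeasure lborel (cball (0::'a) 1) =
        (\<integral>\<^sup>+(x::'a). W (norm x) \<partial>lborel) * (\<integral>\<^sup>+x. ennreal (f (sgn x)) \<partial>lball)"
      by (rule nn_integral_polar) simp_all
    also have "(\<integral>\<^sup>+x. ennreal (f (sgn x)) * W (norm x) \<partial>lborel) = (\<integral>\<^sup>+x. ennreal (f (sgn x) * w (norm x)) \<partial>lball)"
      by (subst nn_integral_lball) (auto simp: W_def cb mult_ac ennreal_mult f w intro!: nn_integral_cong)
    also have "(\<integral>\<^sup>+(x::'a). W (norm x) \<partial>lborel) = (\<integral>\<^sup>+(x::'a). ennreal (w (norm x)) \<partial>lball)"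
      by (subst nn_integral_lball) (auto simp: W_def cb mult_ac intro!: nn_integral_cong)
    also have "emeasure lborel (cball (0::'a) 1) = ennreal (measure (lball :: 'a measure) UNIV)"
      by (rule emeasure_unit_cball)
    finally show ?thesis
      using f w i1 i2 i3
      by (simp add: nn_integral_eq_integral ennreal_mult[symmetric] integral_nonneg)
  qed
  \<comment> \<open>Clamping makes the bound on the sphere a global one and the summand makes
    \<open>g\<close> non-negative; on unit vectors \<open>g\<close> is
    \<open>f + \<bar>B\<bar>\<close>.\<close>
  define g where "g u = max (- \<bar>B\<bar>) (min \<bar>B\<bar> (f u)) + \<bar>B\<bar>" for u
  have [measurable]: "g \<in> borel_measurable borel" unfolding g_def[abs_def] by measurable
  have g: "g u \<le> 2 * \<bar>B\<bar>" "g u \<ge> 0" for u unfolding g_def by auto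
  have fg: "f (sgn x) = g (sgn x) - \<bar>B\<bar>" if "x \<noteq> 0" for x
    using f[of "sgn x"] that unfolding g_def by (auto simp: norm_sgn)
  have i1: "integrable lball (\<lambda>x::'a. w (norm x))"
    by (rule integrable_lballI[of _ B']) (use w in auto)
  have i2: "integrable lball (\<lambda>x. g (sgn x))"
    by (rule integrable_lballI[of _ "2 * \<bar>B\<bar>"]) (use g in auto)
  have i3: "integrable lball (\<lambda>x. g (sgn x) * w (norm x))"
    by (rule integrable_lballI[of _ "2 * \<bar>B\<bar> * B'"]) (use g w in \<open>auto simp: abs_mult intro!: mult_mono\<close>)
  have "(LINT x|lball. f (sgn x) * w (norm x)) = (LINT x|lball. g (sgn x) * w (norm x) - \<bar>B\<bar> * w (norm x))"
    by (rule integral_cong_AE) (use AE_lball_nonzero in \<open>auto simp: fg algebra_simps elim!: eventually_mono\<close>)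
  also have "\<dots> = (LINT x|lball. g (sgn x) * w (norm x)) - \<bar>B\<bar> * (LINT (x::'a)|lball. w (norm x))"
    using i1 i3 by simp
  finally have 1: "(LINT x|lball. f (sgn x) * w (norm x)) = \<dots>" .
  have "(LINT x|lball. f (sgn x)) = (LINT x|lball. g (sgn x) - \<bar>B\<bar>)"
    by (rule integral_cong_AE) (use AE_lball_nonzero in \<open>auto simp: fg elim!: eventually_mono\<close>)
  also have "\<dots> = (LINT x|lball. g (sgn x)) - \<bar>B\<bar> * measure (lball :: 'a measure) UNIV"
    using i2 by simp
  finally have 2: "(LINT x|lball. f (sgn x)) = \<dots>" .
  show ?thesis
    using main[of g "2 * \<bar>B\<bar>"] g by (simp add: 1 2 algebra_simps)
qed

text \<open>For a uniform point of the ball \<open>norm x ^ n\<close> is uniformly distributed on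
  [0, 1]: its superlevel set at \<open>r\<close> is the ball without the ball of radius
  \<open>root n r\<close> and has the fraction \<open>1 - r\<close> of the volume. Hence the mean
  1/2.\<close>

lemma integral_lball_norm_power:
  "(LINT (x::'a::euclidean_space)|lball. norm x ^ DIM('a)) = measure (lball :: 'a measure) UNIV / 2"
proof -
  define n where "n = DIM('a)"
  have n: "n > 0" by (simp add: n_def)
  define \<omega> where "\<omega> = measure (lball :: 'a measure) UNIV"
  have \<omega>: "emeasure lborel (cball (0::'a) 1) = ennreal \<omega>" "\<omega> \<ge> 0"
    by (simp_all add: \<omega>_def emeasure_unit_cball)
  have sl: "emeasure lborel {x::'a. norm x \<le> 1 \<and> r < norm x ^ n} = ennreal ((1 - r) * \<omega>)" if r: "0 \<le> r" "r \<le> 1" for r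
  proof -
    have set: "{x::'a. norm x \<le> 1 \<and> r < norm x ^ n} = cball 0 1 - cball 0 (root n r)"
    proof -
      have root: "r < norm x ^ n \<longleftrightarrow> root n r < norm x" for x :: 'a
        using real_root_less_iff[OF n, of r "norm x ^ n"] n by (simp add: real_root_power_cancel)
      show ?thesis by (intro set_eqI) (simp add: root not_le)
    qed
    have rt: "root n r \<le> 1" "0 \<le> root n r" using r n by auto
    have "emeasure lborel (cball (0::'a) 1 - cball 0 (root n r)) = emeasure lborel (cball (0::'a) 1) - emeasure lborel (cball (0::'a) (root n r))"
      using rt emeasure_lborel_cball_finite[of "0::'a" "root n r"] by (intro emeasure_Diff) auto
    also have "emeasure lborel (cball (0::'a) (root n r)) = ennreal (r * \<omega>)"
      using r n rt \<omega> unfolding \<omega>_def unit_ball_vol_eq[symmetric]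
      by (simp add: emeasure_cball content_cball n_def[symmetric] mult.commute)
    also have "emeasure lborel (cball (0::'a) 1) - ennreal (r * \<omega>) = ennreal ((1 - r) * \<omega>)"
      using \<omega> r by (simp add: ennreal_minus algebra_simps)
    finally show ?thesis unfolding set .
  qed
  have int: "integrable lball (\<lambda>x::'a. norm x ^ n)"
    by (rule integrable_lballI[of _ 1]) (auto simp: power_le_one)
  have "ennreal (LINT (x::'a)|lball. norm x ^ n) = (\<integral>\<^sup>+(x::'a). ennreal (norm x ^ n) \<partial>lball)"
    using int by (simp add: nn_integral_eq_integral)
  also have "\<dots> = (\<integral>\<^sup>+(x::'a). indicator (cball 0 1) x * ennreal (norm x ^ n) \<partial>lborel)"
    by (rule nn_integral_lball) simp
  also have "\<dots> = (\<integral>\<^sup>+(x::'a). \<integral>\<^sup>+(r::real). indicator (cball 0 1) x * indicator {0..<norm x ^ n} r \<partial>lborel \<partial>lborel)"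
    by (intro nn_integral_cong) (simp add: nn_integral_cmult)
  also have "\<dots> = (\<integral>\<^sup>+(x::'a). \<integral>\<^sup>+(r::real). (if norm x \<le> 1 \<and> 0 \<le> r \<and> r < norm x ^ n then 1 else 0) \<partial>lborel \<partial>lborel)"
    by (intro nn_integral_cong) (auto simp: indicator_def)
  also have "\<dots> = (\<integral>\<^sup>+(r::real). \<integral>\<^sup>+(x::'a). (if norm x \<le> 1 \<and> 0 \<le> r \<and> r < norm x ^ n then 1 else 0) \<partial>lborel \<partial>lborel)"
    by (rule lborel_pair.Fubini'[symmetric]) simp
  also have "\<dots> = (\<integral>\<^sup>+(r::real). ennreal ((1 - r) * \<omega>) * indicator {0..1} r \<partial>lborel)"
  proof (intro nn_integral_cong)
    fix r :: real
    have "(\<integral>\<^sup>+(x::'a). (if norm x \<le> 1 \<and> 0 \<le> r \<and> r < norm x ^ n then 1 else 0) \<partial>lborel) =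
      (\<integral>\<^sup>+(x::'a). indicator {x. norm x \<le> 1 \<and> r < norm x ^ n} x * indicator {0..1} r \<partial>lborel)"
    proof (intro nn_integral_cong)
      fix x :: 'a
      have "norm x \<le> 1 \<Longrightarrow> norm x ^ n \<le> 1" by (simp add: power_le_one)
      then show "(if norm x \<le> 1 \<and> 0 \<le> r \<and> r < norm x ^ n then 1 else 0) =
          (indicator {x. norm x \<le> 1 \<and> r < norm x ^ n} x * indicator {0..1} r :: ennreal)"
        by (auto simp: indicator_def)
    qed
    also have "\<dots> = emeasure lborel {x::'a. norm x \<le> 1 \<and> r < norm x ^ n} * indicator {0..1} r"
      by (subst nn_integral_multc) auto
    also have "\<dots> = ennreal ((1 - r) * \<omega>) * indicator {0..1} r"
      by (cases "r \<in> {0..1}") (auto simp: sl)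
    finally show "(\<integral>\<^sup>+(x::'a). (if norm x \<le> 1 \<and> 0 \<le> r \<and> r < norm x ^ n then 1 else 0) \<partial>lborel) = \<dots>" .
  qed
  also have "\<dots> = ennreal ((1 - 1 / 2) * \<omega> - 0)"
    by (subst nn_integral_FTC_Icc[where F = "\<lambda>r. (r - r\<^sup>2 / 2) * \<omega>"])
       (auto intro!: derivative_eq_intros mult_nonneg_nonneg simp: \<omega>)
  finally show ?thesis
    using \<omega> by (simp add: n_def \<omega>_def integral_nonneg)
qed

section \<open>The Steiner polynomial\<close>

lemma bounded_on_unit_sphere:
  fixes q :: "real^'n \<Rightarrow> real"
  assumes "continuous_on (- {0}) q"
  shows "\<exists>B. \<forall>u. norm u = 1 \<longrightarrow> \<bar>q u\<bar> \<le> B"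
proof -
  have "continuous_on (sphere 0 1) q" by (rule continuous_on_subset[OF assms]) auto
  then have "bounded (q ` sphere 0 1)" by (intro compact_imp_bounded compact_continuous_image) auto
  then obtain B where "\<forall>y\<in>q ` sphere 0 1. \<bar>y\<bar> \<le> B" by (auto simp: bounded_iff)
  then show ?thesis by (intro exI[of _ B]) auto
qed

lemma compact_set_plus:
  fixes S T :: "'a::real_normed_vector set"
  assumes "compact S" "compact T"
  shows "compact (S + T)"
proof -
  have "S + T = (\<Union>x\<in>S. \<Union>y\<in>T. {x + y})" by (auto simp: set_plus_def)
  then show ?thesis using compact_sums'[OF assms] compact_sums[OF assms] by (simp add: set_plus_def Bex_def conj_commute)
qed

lemma convex_scale_plus:
  fixes K :: "'a::real_vector set"
  assumes K: "convex K" and s: "s \<ge> 0" "t \<ge> 0"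
  shows "(*\<^sub>R) s ` K + (*\<^sub>R) t ` K = (*\<^sub>R) (s + t) ` K"
proof (cases "s + t = 0")
  case True
  then have "s = 0" "t = 0" using s by auto
  then show ?thesis by (auto simp: set_plus_def)
next
  case False
  then have st: "s + t > 0" using s by simp
  show ?thesis
  proof (intro equalityI subsetI)
    fix z assume "z \<in> (*\<^sub>R) s ` K + (*\<^sub>R) t ` K"
    then obtain x y where xy: "x \<in> K" "y \<in> K" "z = s *\<^sub>R x + t *\<^sub>R y" by (auto simp: set_plus_def)
    have "(s / (s + t)) *\<^sub>R x + (t / (s + t)) *\<^sub>R y \<in> K"
      using K xy s st by (intro convexD) (auto simp: add_divide_distrib[symmetric])
    moreover have "z = (s + t) *\<^sub>R ((s / (s + t)) *\<^sub>R x + (t / (s + t)) *\<^sub>R y)"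
      using st xy by (simp add: scaleR_add_right)
    ultimately show "z \<in> (*\<^sub>R) (s + t) ` K" by blast
  next
    fix z assume "z \<in> (*\<^sub>R) (s + t) ` K"
    then obtain x where "x \<in> K" "z = s *\<^sub>R x + t *\<^sub>R x" by (auto simp: scaleR_add_left)
    then show "z \<in> (*\<^sub>R) s ` K + (*\<^sub>R) t ` K" by (auto simp: set_plus_def)
  qed
qed

lemma sum_scale_convex:
  fixes K :: "'a::real_vector set"
  assumes K: "convex K" "K \<noteq> {}" and "finite I" "\<And>i. i \<in> I \<Longrightarrow> l i \<ge> 0"
  shows "(\<Sum>i\<in>I. (*\<^sub>R) (l i) ` K) = (*\<^sub>R) (\<Sum>i\<in>I. l i) ` K"
  using assms(3,4)
proof (induction I rule: finite_induct)
  case empty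
  then show ?case using K(2) by (auto simp: image_def)
next
  case (insert i I)
  then show ?case by (simp add: convex_scale_plus K(1) sum_nonneg)
qed

lemma scale_unit_cball: "t \<ge> 0 \<Longrightarrow> (*\<^sub>R) t ` cball 0 1 = cball (0::'a::real_normed_vector) t"
  using cball_scale[of t 0 1] by (cases "t = 0") (simp_all add: image_constant_conv)

section \<open>Minkowski's expansion of a Steiner polynomial\<close>

text \<open>Pascal's rule, with \<open>g\<close> shifted in the summand that carries the factor
  \<open>t\<close>.\<close>

lemma binomial_recursion:
  fixes g :: "nat \<Rightarrow> real"
  shows "(\<Sum>j\<le>Suc m. real (Suc m choose j) * g j * s ^ (Suc m - j) * t ^ j) =
    s * (\<Sum>j\<le>m. real (m choose j) * g j * s ^ (m - j) * t ^ j) +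
    t * (\<Sum>j\<le>m. real (m choose j) * g (Suc j) * s ^ (m - j) * t ^ j)"
proof -
  have 1: "s * (\<Sum>j\<le>m. real (m choose j) * g j * s ^ (m - j) * t ^ j) =
      g 0 * s ^ Suc m + (\<Sum>j\<le>m. real (m choose Suc j) * g (Suc j) * s ^ (m - j) * t ^ Suc j)"
  proof -
    have "s * (\<Sum>j\<le>m. real (m choose j) * g j * s ^ (m - j) * t ^ j) =
        (\<Sum>j\<le>Suc m. real (m choose j) * g j * s ^ (Suc m - j) * t ^ j)"
      unfolding sum_distrib_left by (simp add: Suc_diff_le mult_ac)
    then show ?thesis by (simp only: sum.atMost_Suc_shift) simp
  qed
  show ?thesis
    unfolding 1 sum.atMost_Suc_shift
    by (simp add: sum_distrib_left sum.distrib algebra_simps)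
qed

text \<open>The weight of a word depends only on the number of its letters from 2 on, so the words
  group as in the binomial theorem. The induction removes the first letter; \<open>g\<close> is
  arbitrary because a letter from 2 on shifts its argument.\<close>

lemma sum_words:
  fixes l :: "nat \<Rightarrow> real"
  assumes n: "n \<ge> 2"
  shows "(\<Sum>is | length is = m \<and> set is \<subseteq> {..<n}. g (length (filter (\<lambda>i. i \<ge> 2) is)) * (\<Prod>i\<leftarrow>is. l i)) =
    (\<Sum>j\<le>m. real (m choose j) * g j * (\<Sum>i<2. l i) ^ (m - j) * (\<Sum>i\<in>{2..<n}. l i) ^ j)"
proof (induction m arbitrary: g)
  case 0
  have "{is. is = [] \<and> set is \<subseteq> {..<n}} = {[]}" by auto
  then show ?case by simp
next
  case (Suc m)
  let ?I = "{is. length is = m \<and> set is \<subseteq> {..<n}}"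
  let ?f = "\<lambda>is. length (filter (\<lambda>i. i \<ge> (2::nat)) is)"
  have set: "{is. length is = Suc m \<and> set is \<subseteq> {..<n}} = (\<lambda>(i, is). i # is) ` ({..<n} \<times> ?I)"
    by (auto simp: length_Suc_conv image_iff)
  have split: "{..<n} = {..<2} \<union> {2..<n}" using n by auto
  have "(\<Sum>is | length is = Suc m \<and> set is \<subseteq> {..<n}. g (?f is) * (\<Prod>i\<leftarrow>is. l i)) =
      (\<Sum>(i, is)\<in>{..<n} \<times> ?I. g (?f (i # is)) * (l i * (\<Prod>i\<leftarrow>is. l i)))"
    unfolding set by (subst sum.reindex) (auto simp: inj_on_def intro!: sum.cong)
  also have "\<dots> = (\<Sum>i<n. \<Sum>is\<in>?I. g (?f (i # is)) * (l i * (\<Prod>i\<leftarrow>is. l i)))"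
    by (rule sum.cartesian_product[symmetric])
  also have "\<dots> = (\<Sum>i<2. \<Sum>is\<in>?I. g (?f (i # is)) * (l i * (\<Prod>i\<leftarrow>is. l i))) +
      (\<Sum>i\<in>{2..<n}. \<Sum>is\<in>?I. g (?f (i # is)) * (l i * (\<Prod>i\<leftarrow>is. l i)))"
    unfolding split by (rule sum.union_disjoint) auto
  also have "(\<Sum>i<2. \<Sum>is\<in>?I. g (?f (i # is)) * (l i * (\<Prod>i\<leftarrow>is. l i))) =
      (\<Sum>i<2. l i) * (\<Sum>is\<in>?I. g (?f is) * (\<Prod>i\<leftarrow>is. l i))"
    unfolding sum_product by (intro sum.cong refl) auto
  also have "(\<Sum>i\<in>{2..<n}. \<Sum>is\<in>?I. g (?f (i # is)) * (l i * (\<Prod>i\<leftarrow>is. l i))) =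
      (\<Sum>i\<in>{2..<n}. l i) * (\<Sum>is\<in>?I. g (Suc (?f is)) * (\<Prod>i\<leftarrow>is. l i))"
    unfolding sum_product by (intro sum.cong refl) auto
  finally show ?case
    unfolding Suc.IH[of g] Suc.IH[of "\<lambda>j. g (Suc j)"] binomial_recursion .
qed

text \<open>
  Minkowski's expansion for the bodies \<open>K, K, B, \<dots>, B\<close> is the Steiner polynomial in
  \<open>l 0 + l 1\<close> and \<open>l 2 + \<dots> + l (n - 1)\<close>.
\<close>

lemma quermassintegral_eqI:
  fixes K :: "(real^'n) set"
  assumes n: "CARD('n) \<ge> 2" and K: "convex K" "K \<noteq> {}"
    and steiner: "\<And>s t. s \<ge> 0 \<Longrightarrow> t \<ge> 0 \<Longrightarrow>
      measure lebesgue ((*\<^sub>R) s ` K + cball 0 t) = (\<Sum>j\<le>CARD('n). c j * s ^ (CARD('n) - j) * t ^ j)"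
  shows "quermassintegral (CARD('n) - 2) K = c (CARD('n) - 2) / real (CARD('n) choose 2)"
proof -
  let ?n = "CARD('n)"
  define Ks where "Ks = replicate 2 K @ replicate (?n - 2) (cball (0::real^'n) 1)"
  \<comment> \<open>\<open>n choose j\<close> counts the possible positions of the \<open>j\<close>
    ball letters in a word, so \<open>g j\<close> is the mixed volume in which the ball occurs
    \<open>j\<close> times.\<close>
  define g where "g j = c j / real (?n choose j)" for j
  have "minkowski_coefficients Ks (\<lambda>is. g (length (filter (\<lambda>i. i \<ge> 2) is)))"
    unfolding minkowski_coefficients_def
  proof (intro conjI allI impI)
    fix "is" js :: "nat list" assume "mset is = mset js"
    then have "mset (filter (\<lambda>i. i \<ge> 2) is) = mset (filter (\<lambda>i. i \<ge> 2) js)" by simp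
    then have "length (filter (\<lambda>i. i \<ge> 2) is) = length (filter (\<lambda>i. i \<ge> 2) js)"
      using mset_eq_length by blast
    then show "g (length (filter (\<lambda>i. i \<ge> 2) is)) = g (length (filter (\<lambda>i. i \<ge> 2) js))" by simp
  next
    fix l :: "nat \<Rightarrow> real" assume l: "\<forall>i<?n. l i \<ge> 0"
    have split: "{..<?n} = {..<2} \<union> {2..<?n}" using n by auto
    have "(\<Sum>i<?n. (*\<^sub>R) (l i) ` (Ks ! i)) = (\<Sum>i<2. (*\<^sub>R) (l i) ` (Ks ! i)) + (\<Sum>i\<in>{2..<?n}. (*\<^sub>R) (l i) ` (Ks ! i))"
      unfolding split by (rule sum.union_disjoint) auto
    also have "(\<Sum>i<2. (*\<^sub>R) (l i) ` (Ks ! i)) = (\<Sum>i<2. (*\<^sub>R) (l i) ` K)"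
      by (intro sum.cong refl) (simp add: Ks_def nth_append)
    also have "\<dots> = (*\<^sub>R) (\<Sum>i<2. l i) ` K"
      using K l n by (intro sum_scale_convex) auto
    also have "(\<Sum>i\<in>{2..<?n}. (*\<^sub>R) (l i) ` (Ks ! i)) = (\<Sum>i\<in>{2..<?n}. (*\<^sub>R) (l i) ` cball 0 1)"
    proof (intro sum.cong refl)
      fix i assume i: "i \<in> {2..<?n}"
      then have "i - 2 < ?n - 2" by auto
      then show "(*\<^sub>R) (l i) ` (Ks ! i) = (*\<^sub>R) (l i) ` cball 0 1"
        using i by (simp add: Ks_def nth_append)
    qed
    also have "\<dots> = (*\<^sub>R) (\<Sum>i\<in>{2..<?n}. l i) ` cball 0 1"
      using l by (intro sum_scale_convex) auto
    also have "\<dots> = cball 0 (\<Sum>i\<in>{2..<?n}. l i)"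
      using l by (intro scale_unit_cball sum_nonneg) auto
    finally have sum: "(\<Sum>i<?n. (*\<^sub>R) (l i) ` (Ks ! i)) =
        (*\<^sub>R) (\<Sum>i<2. l i) ` K + cball 0 (\<Sum>i\<in>{2..<?n}. l i)" .
    have "(\<Sum>i<2. l i) \<ge> 0" "(\<Sum>i\<in>{2..<?n}. l i) \<ge> 0"
      using l n by (auto intro!: sum_nonneg)
    then have "measure lebesgue (\<Sum>i<?n. (*\<^sub>R) (l i) ` (Ks ! i)) =
        (\<Sum>j\<le>?n. c j * (\<Sum>i<2. l i) ^ (?n - j) * (\<Sum>i\<in>{2..<?n}. l i) ^ j)"
      unfolding sum by (rule steiner)
    also have "\<dots> = (\<Sum>j\<le>?n. real (?n choose j) * g j * (\<Sum>i<2. l i) ^ (?n - j) * (\<Sum>i\<in>{2..<?n}. l i) ^ j)"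
      by (intro sum.cong refl) (simp add: g_def)
    finally show "measure lebesgue (\<Sum>i<?n. (*\<^sub>R) (l i) ` (Ks ! i)) =
        (\<Sum>is | length is = ?n \<and> set is \<subseteq> {..<?n}. g (length (filter (\<lambda>i. i \<ge> 2) is)) * (\<Prod>i\<leftarrow>is. l i))"
      unfolding sum_words[OF n] .
  qed
  then have "mixed_volume Ks = g (length (filter (\<lambda>i. i \<ge> 2) [0..<?n]))"
    by (rule mixed_volume_eqI)
  also have "length (filter (\<lambda>i. i \<ge> 2) [0..<?n]) = ?n - 2"
  proof -
    have "[0..<?n] = [0..<2] @ [2..<?n]" using upt_add_eq_append[of 0 2 "?n - 2"] n
      by (simp only: le_add_diff_inverse zero_le)
    moreover have "filter (\<lambda>i. i \<ge> 2) [0..<2] = []" by (simp add: filter_empty_conv)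
    moreover have "filter (\<lambda>i. i \<ge> 2) [2..<?n] = [2..<?n]" by (simp add: filter_id_conv)
    ultimately show ?thesis by simp
  qed
  also have "g (?n - 2) = c (?n - 2) / real (?n choose 2)"
    using binomial_symmetric[OF n] by (simp add: g_def)
  finally show ?thesis using n by (simp add: quermassintegral_def Ks_def)
qed


section \<open>Parallel bodies swept out by their boundaries\<close>

lemma inner_unit_le: "norm u = 1 \<Longrightarrow> norm w = 1 \<Longrightarrow> u \<bullet> (w::'a::real_inner) \<le> 1"
  using norm_cauchy_schwarz[of u w] by simp

lemma inner_unit_eq: 
  fixes u w :: "'a::real_inner"
  assumes "norm u = 1" "norm w = 1" "u \<bullet> w \<ge> 1"
  shows "u = w"
proof -
  have "(u - w) \<bullet> (u - w) = 2 - 2 * (u \<bullet> w)"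
    using assms by (simp add: inner_diff inner_commute norm_eq_1)
  then have "(u - w) \<bullet> (u - w) = 0" using assms(3) inner_ge_zero[of "u - w"] by linarith
  then show ?thesis by simp
qed

text \<open>An interior origin makes \<open>h\<close> positive off 0. The sweep relies on this: the
  bodies grow strictly with the radius, and the Jacobian is positive.\<close>

locale smooth_body0 = smooth_body K p A
  for K :: "(real^'n) set" and p :: "real^'n \<Rightarrow> real^'n" and A :: "real^'n \<Rightarrow> real^'n^'n" +
  assumes zero_interior: "0 \<in> interior K"
begin

lemma h_cont_on: "continuous_on S h"
  by (rule continuous_on_subset[OF h_cont]) simp

lemma h_pos:
  assumes "x \<noteq> 0"
  shows "h x > 0"
proof -
  obtain e where e: "e > 0" "ball 0 e \<subseteq> K" using zero_interior by (meson mem_interior)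
  define k where "k = (e / (2 * norm x)) *\<^sub>R x"
  have "norm k < e" using e assms by (simp add: k_def)
  then have "k \<bullet> x \<le> h x" using e by (intro inner_le_h) auto
  moreover have "k \<bullet> x > 0" using e assms by (simp add: k_def)
  ultimately show ?thesis by simp
qed

text \<open>\<open>s * h u + t\<close> is the support function of the parallel body, and a compact
  convex set is the intersection of its supporting half-spaces. A hyperplane separating
  \<open>z\<close> would be contradicted at the boundary point \<open>s p(u) + t u\<close>.\<close>

lemma mem_parallel_iff:
  assumes s: "s \<ge> 0" and t: "t \<ge> 0"
  shows "z \<in> (*\<^sub>R) s ` K + cball 0 t \<longleftrightarrow> (\<forall>u. norm u = 1 \<longrightarrow> z \<bullet> u \<le> s * h u + t)"
proof (intro iffI allI impI)
  fix u :: "real^'n" assume z: "z \<in> (*\<^sub>R) s ` K + cball 0 t" and u: "norm u = 1"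
  then obtain k b where kb: "k \<in> K" "norm b \<le> t" "z = s *\<^sub>R k + b" by (auto simp: set_plus_def)
  have "b \<bullet> u \<le> t" using norm_cauchy_schwarz[of b u] kb u by simp
  moreover have "s * (k \<bullet> u) \<le> s * h u" using s kb by (intro mult_left_mono inner_le_h)
  ultimately show "z \<bullet> u \<le> s * h u + t" by (simp add: kb inner_add_left)
next
  assume *: "\<forall>u. norm u = 1 \<longrightarrow> z \<bullet> u \<le> s * h u + t"
  show "z \<in> (*\<^sub>R) s ` K + cball 0 t"
  proof (rule ccontr)
    assume z: "z \<notin> (*\<^sub>R) s ` K + cball 0 t"
    have "convex ((*\<^sub>R) s ` K + cball 0 t)"
      by (intro convex_set_plus convex_scaling convex_body convex_cball)
    moreover have "closed ((*\<^sub>R) s ` K + cball 0 t)"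
      by (intro compact_imp_closed compact_set_plus compact_scaling compact_body compact_cball)
    ultimately obtain a b where ab: "a \<bullet> z < b" "\<And>x. x \<in> (*\<^sub>R) s ` K + cball 0 t \<Longrightarrow> a \<bullet> x > b"
      using separating_hyperplane_closed_point[OF _ _ z] by blast
    have a: "a \<noteq> 0"
    proof
      assume "a = 0"
      obtain k where "k \<in> K" using body_nonempty by auto
      then have "s *\<^sub>R k + 0 \<in> (*\<^sub>R) s ` K + cball 0 t" using t by (intro set_plus_intro) auto
      then show False using ab \<open>a = 0\<close> by force
    qed
    define u where "u = - sgn a"
    have u: "norm u = 1" "u \<noteq> 0" using a by (auto simp: u_def norm_sgn sgn_zero_iff)
    have "s *\<^sub>R p u + t *\<^sub>R u \<in> (*\<^sub>R) s ` K + cball 0 t"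
      using u t p_in[OF u(2)] by (intro set_plus_intro) auto
    then have "a \<bullet> z < a \<bullet> (s *\<^sub>R p u + t *\<^sub>R u)" using ab by force
    then have "norm a * (sgn a \<bullet> z) < norm a * (sgn a \<bullet> (s *\<^sub>R p u + t *\<^sub>R u))"
      using a by (simp add: sgn_div_norm)
    then have "(s *\<^sub>R p u + t *\<^sub>R u) \<bullet> u < z \<bullet> u"
      using a by (simp add: u_def inner_commute)
    moreover have "(s *\<^sub>R p u + t *\<^sub>R u) \<bullet> u = s * h u + t"
      using u by (simp add: inner_add_left h_eq dot_square_norm)
    ultimately show False using * u by force
  qed
qed

text \<open>
  The point \<open>t *\<^sub>R u + r ^ n *\<^sub>R p u\<close> has outer normal \<open>u\<close> in the boundary of \<open>r ^ n K + t B\<close>. These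
  boundaries sweep out \<open>R ^ n K + t B\<close> minus \<open>t B\<close>. The exponent \<open>n\<close> keeps the Jacobian bounded at
  the origin: it cancels the factor \<open>r ^ (n - 1)\<close> of polar coordinates.
\<close>

definition G :: "real \<Rightarrow> real^'n \<Rightarrow> real^'n" where
  "G t x = t *\<^sub>R sgn x + norm x ^ CARD('n) *\<^sub>R p x"

lemma p_sgn: "x \<noteq> 0 \<Longrightarrow> p (sgn x) = p x"
  using p_scale[of "inverse (norm x)" x] by (simp add: sgn_div_norm)

lemma G_inner_sgn:
  assumes "x \<noteq> 0"
  shows "G t x \<bullet> sgn x = t + norm x ^ CARD('n) * h (sgn x)"
proof -
  have "sgn x \<noteq> 0" "norm (sgn x) = 1" using assms by (auto simp: norm_sgn sgn_zero_iff)
  then show ?thesis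
    using assms h_eq[of "sgn x"] by (simp add: G_def inner_add_left dot_square_norm p_sgn)
qed

lemma G_inner_le:
  assumes "x \<noteq> 0" "norm w = 1" "t \<ge> 0"
  shows "G t x \<bullet> w \<le> t * (sgn x \<bullet> w) + norm x ^ CARD('n) * h w"
  using assms by (simp add: G_def inner_add_left mult_left_mono inner_le_h p_in)

text \<open>Testing \<open>G t x = G t y\<close> against the normal \<open>sgn x\<close> gives
  \<open>norm x \<le> norm y\<close>, since \<open>h\<close> is positive. By symmetry the radii
  agree, and then the same inequality forces the normals to coincide.\<close>

lemma G_inj:
  assumes t: "t > 0"
  shows "inj_on (G t) (- {0})"
proof (rule inj_onI)
  have le: "norm x \<le> norm y \<and> (norm x = norm y \<longrightarrow> sgn x = sgn y)"
    if x: "x \<noteq> 0" and y: "y \<noteq> 0" and eq: "G t x = G t y" for x y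
  proof -
    have u: "norm (sgn x) = 1" "norm (sgn y) = 1" "sgn x \<noteq> 0" using x y by (auto simp: norm_sgn sgn_zero_iff)
    have hp: "h (sgn x) > 0" using u by (intro h_pos)
    have 1: "t + norm x ^ CARD('n) * h (sgn x) \<le> t * (sgn y \<bullet> sgn x) + norm y ^ CARD('n) * h (sgn x)"
      using G_inner_sgn[OF x, of t] G_inner_le[OF y u(1), of t] eq t by simp
    moreover have 2: "t * (sgn y \<bullet> sgn x) \<le> t * 1"
      using t u by (intro mult_left_mono inner_unit_le) auto
    ultimately have "norm x ^ CARD('n) * h (sgn x) \<le> norm y ^ CARD('n) * h (sgn x)" by simp
    then have "norm x ^ CARD('n) \<le> norm y ^ CARD('n)" using hp by simp
    then have "norm x \<le> norm y" by (simp add: power_mono_iff)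
    moreover have "sgn x = sgn y" if "norm x = norm y"
    proof -
      have "t \<le> t * (sgn y \<bullet> sgn x)" using 1 that by simp
      then have "sgn y \<bullet> sgn x \<ge> 1" using t by simp
      then show ?thesis using inner_unit_eq u by metis
    qed
    ultimately show ?thesis by blast
  qed
  fix x y assume "x \<in> - {0}" "y \<in> - {0}" and eq: "G t x = G t y"
  then have "norm x = norm y" "sgn x = sgn y" using le[of x y] le[of y x] by auto
  then have "norm x *\<^sub>R sgn x = norm y *\<^sub>R sgn y" by simp
  then show "x = y" using \<open>x \<in> - {0}\<close> \<open>y \<in> - {0}\<close> by (simp add: sgn_div_norm)
qed

text \<open>A given \<open>z\<close> outside the ball lies on the boundary of \<rho> K + t B for the
  least possible \<rho>. The normal \<open>u\<close> there comes from a maximum over the sphere, and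
  both summands of \<open>z\<close> must be extremal in the direction \<open>u\<close>.\<close>

lemma G_image:
  assumes t: "t > 0" and R: "R > 0"
  shows "G t ` (cball 0 R - {0}) = ((*\<^sub>R) (R ^ CARD('n)) ` K + cball 0 t) - cball 0 t"
proof (intro equalityI subsetI)
  fix z assume "z \<in> G t ` (cball 0 R - {0})"
  then obtain x where x: "x \<noteq> 0" "norm x \<le> R" and z: "z = G t x" by (elim imageE) auto
  have u: "norm (sgn x) = 1" "sgn x \<noteq> 0" using x by (auto simp: norm_sgn sgn_zero_iff)
  have "z \<bullet> w \<le> R ^ CARD('n) * h w + t" if w: "norm w = 1" for w
  proof -
    have "w \<noteq> 0" using w by auto
    have "z \<bullet> w \<le> t * (sgn x \<bullet> w) + norm x ^ CARD('n) * h w"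
      unfolding z using x w t by (intro G_inner_le) auto
    also have "t * (sgn x \<bullet> w) \<le> t * 1"
      using t u w by (intro mult_left_mono inner_unit_le) auto
    also have "norm x ^ CARD('n) * h w \<le> R ^ CARD('n) * h w"
      using x h_pos[OF \<open>w \<noteq> 0\<close>] by (intro mult_right_mono power_mono) auto
    finally show ?thesis by simp
  qed
  then have "z \<in> (*\<^sub>R) (R ^ CARD('n)) ` K + cball 0 t"
    using R t by (subst mem_parallel_iff) auto
  moreover have "t < norm z"
  proof -
    have "t < t + norm x ^ CARD('n) * h (sgn x)" using x h_pos[OF u(2)] by simp
    also have "\<dots> = z \<bullet> sgn x" unfolding z by (rule G_inner_sgn[OF x(1), symmetric])
    also have "\<dots> \<le> norm z" using norm_cauchy_schwarz[of z "sgn x"] u by simp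
    finally show ?thesis .
  qed
  ultimately show "z \<in> ((*\<^sub>R) (R ^ CARD('n)) ` K + cball 0 t) - cball 0 t" by simp
next
  fix z assume z: "z \<in> ((*\<^sub>R) (R ^ CARD('n)) ` K + cball 0 t) - cball 0 t"
  then have zt: "norm z > t" and zL: "\<And>u. norm u = 1 \<Longrightarrow> z \<bullet> u \<le> R ^ CARD('n) * h u + t"
    using mem_parallel_iff[of "R ^ CARD('n)" t z] R t by auto
  have hp: "h u > 0" if "norm u = 1" for u using that by (intro h_pos) auto
  \<comment> \<open>\<open>z\<close> satisfies the half-space condition of \<rho> K + t B at
    \<open>u\<close> exactly if \<open>f u \<le> \<rho>\<close>, so the maximum of \<open>f\<close>
    is the least admissible \<rho>. It is positive because \<open>norm z > t\<close>.\<close>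
  define f where "f u = (z \<bullet> u - t) / h u" for u
  have "continuous_on (sphere 0 1) f" unfolding f_def
    using hp by (intro continuous_intros h_cont_on) force
  moreover have "sphere (0::real^'n) 1 \<noteq> {}" by simp
  ultimately obtain u where u: "norm u = 1" and umax: "\<And>w. norm w = 1 \<Longrightarrow> f w \<le> f u"
    using continuous_attains_sup[of "sphere (0::real^'n) 1" f] by auto
  define \<rho> where "\<rho> = f u"
  have z0: "z \<noteq> 0" using zt t by auto
  have "f (sgn z) > 0"
  proof -
    have "norm (sgn z) = 1" using z0 by (simp add: norm_sgn)
    moreover have "z \<bullet> sgn z = norm z" using z0 by (simp add: sgn_div_norm dot_square_norm power2_eq_square)
    ultimately show ?thesis using zt hp by (simp add: f_def)
  qed
  then have \<rho>: "\<rho> > 0" using umax[of "sgn z"] z0 by (simp add: \<rho>_def norm_sgn)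
  have \<rho>R: "\<rho> \<le> R ^ CARD('n)" using zL[OF u] hp[OF u] by (simp add: \<rho>_def f_def field_simps)
  have zu: "z \<bullet> u = \<rho> * h u + t" using hp[OF u] by (simp add: \<rho>_def f_def)
  have "z \<bullet> w \<le> \<rho> * h w + t" if "norm w = 1" for w
    using umax[OF that, folded \<rho>_def] hp[OF that] by (simp add: f_def pos_divide_le_eq)
  then have "z \<in> (*\<^sub>R) \<rho> ` K + cball 0 t" using \<rho> t by (subst mem_parallel_iff) auto
  then obtain k b where kb: "k \<in> K" "norm b \<le> t" "z = \<rho> *\<^sub>R k + b" by (auto simp: set_plus_def)
  have u0: "u \<noteq> 0" using u by auto
  have bu: "b \<bullet> u \<le> t" using norm_cauchy_schwarz[of b u] kb u by simp
  have ku: "\<rho> * (k \<bullet> u) \<le> \<rho> * h u" using \<rho> kb by (intro mult_left_mono inner_le_h) auto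
  have "\<rho> * (k \<bullet> u) + b \<bullet> u = \<rho> * h u + t" using zu by (simp add: kb inner_add_left)
  then have "\<rho> * (k \<bullet> u) = \<rho> * h u" and but: "b \<bullet> u = t" using bu ku by linarith+
  then have kp: "k = p u" using \<rho> kb u0 by (intro contact_unique) auto
  \<comment> \<open>Equality in \<open>b \<bullet> u \<le> norm b \<le> t\<close> leaves only
    \<open>b = t *\<^sub>R u\<close>.\<close>
  have "(b - t *\<^sub>R u) \<bullet> (b - t *\<^sub>R u) = b \<bullet> b - 2 * t * (b \<bullet> u) + t * t * (u \<bullet> u)"
    by (simp add: inner_diff inner_commute algebra_simps)
  also have "\<dots> = (norm b)\<^sup>2 - t\<^sup>2"
    using but u by (simp add: power2_norm_eq_inner norm_eq_1 power2_eq_square[of t])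
  finally have "(b - t *\<^sub>R u) \<bullet> (b - t *\<^sub>R u) = (norm b)\<^sup>2 - t\<^sup>2" .
  moreover have "(norm b)\<^sup>2 \<le> t\<^sup>2" using kb by (intro power_mono) auto
  ultimately have "(b - t *\<^sub>R u) \<bullet> (b - t *\<^sub>R u) = 0"
    using inner_ge_zero[of "b - t *\<^sub>R u"] by linarith
  then have bt: "b = t *\<^sub>R u" by simp
  define r where "r = root CARD('n) \<rho>"
  have r: "r > 0" "r ^ CARD('n) = \<rho>" using \<rho> by (auto simp: r_def)
  have "r \<le> R" using \<rho>R r R by (metis power_mono_iff less_imp_le zero_less_card_finite)
  have "z = G t (r *\<^sub>R u)" using r u by (simp add: G_def kb kp bt sgn_scaleR p_scale sgn_div_norm)
  moreover have "r *\<^sub>R u \<in> cball 0 R - {0}" using r u u0 \<open>r \<le> R\<close> by simp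
  ultimately show "z \<in> G t ` (cball 0 R - {0})" by blast
qed


text \<open>Arranged for \<open>det_polar_jacobian\<close>: the bracket is the map treated there for
  q = n p(u) and \<tau> = t / |x|^n.\<close>

definition G' :: "real \<Rightarrow> real^'n \<Rightarrow> real^'n \<Rightarrow> real^'n" where
  "G' t x v = norm x ^ (CARD('n) - 1) *\<^sub>R ((sgn x \<bullet> v) *\<^sub>R (real CARD('n) *\<^sub>R p (sgn x)) + A (sgn x) *v v +
     (t / norm x ^ CARD('n)) *\<^sub>R (v - (sgn x \<bullet> v) *\<^sub>R sgn x))"

lemma G_der:
  assumes x: "x \<noteq> 0"
  shows "(G t has_derivative G' t x) (at x)"
proof -
  obtain m where m: "CARD('n) = Suc m" using zero_less_card_finite[where 'a = 'n] gr0_implies_Suc by blast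
  have nx: "norm x > 0" using x by simp
  have "(G t has_derivative (\<lambda>v. t *\<^sub>R ((v - (sgn x \<bullet> v) *\<^sub>R sgn x) /\<^sub>R norm x) +
      (norm x ^ CARD('n) *\<^sub>R (A x *v v) + (real CARD('n) * (sgn x \<bullet> v) * norm x ^ (CARD('n) - 1)) *\<^sub>R p x))) (at x)"
    unfolding G_def[abs_def]
    by (auto intro!: derivative_eq_intros has_derivative_sgn has_derivative_norm p_der x simp: inner_commute)
  moreover have eq: "t *\<^sub>R ((v - (sgn x \<bullet> v) *\<^sub>R sgn x) /\<^sub>R norm x) +
      (norm x ^ CARD('n) *\<^sub>R (A x *v v) + (real CARD('n) * (sgn x \<bullet> v) * norm x ^ (CARD('n) - 1)) *\<^sub>R p x) = G' t x v" for v
  proof -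
    have "A x = A (norm x *\<^sub>R sgn x)" using x by (simp add: sgn_div_norm)
    also have "\<dots> = (1 / norm x) *\<^sub>R A (sgn x)" using x by (intro A_scale) (auto simp: sgn_zero_iff)
    finally have Ax: "norm x ^ CARD('n) *\<^sub>R (A x *v v) = norm x ^ (CARD('n) - 1) *\<^sub>R (A (sgn x) *v v)"
      using nx by (simp add: m scaleR_matrix_vector_assoc[symmetric])
    show ?thesis
      unfolding G'_def Ax p_sgn[OF x] using nx
      by (simp add: m scaleR_add_right mult_ac divide_inverse)
  qed
  ultimately show ?thesis unfolding eq by simp
qed

text \<open>The coefficient of \<open>t ^ j\<close> in the Jacobian determinant of
  \<open>G t\<close>. Of the radial exponent, n(n-1) comes from the prefactor of \<open>G'\<close>,
  and n j is lost to the j-th power of \<tau>.\<close>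

definition J :: "nat \<Rightarrow> real^'n \<Rightarrow> real" where
  "J j x = real CARD('n) * (h (sgn x) * char_coeff (Suc j) (A (sgn x))) * norm x ^ (CARD('n) * (CARD('n) - 1 - j))"

lemma det_G':
  assumes x: "x \<noteq> 0" and t: "t > 0"
  shows "\<bar>det (matrix (G' t x))\<bar> = (\<Sum>j<CARD('n). J j x * t ^ j)"
proof -
  let ?n = "CARD('n)"
  define u where "u = sgn x"
  have u: "norm u = 1" "u \<noteq> 0" using x by (auto simp: u_def norm_sgn sgn_zero_iff)
  define \<tau> where "\<tau> = t / norm x ^ ?n"
  have \<tau>: "\<tau> > 0" using t x by (simp add: \<tau>_def)
  define D where "D v = (u \<bullet> v) *\<^sub>R (real ?n *\<^sub>R p u) + A u *v v + \<tau> *\<^sub>R (v - (u \<bullet> v) *\<^sub>R u)" for v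
  define S where "S = (\<Sum>j<?n. char_coeff (Suc j) (A u) * \<tau> ^ j)"
  \<comment> \<open>Positivity of this determinant shows that \<open>G t\<close> preserves
    orientation, which removes the absolute value.\<close>
  have "\<tau> * S = det (mat \<tau> + A u)"
    unfolding S_def using det_mat_add_singular[OF u(2) A_radial[OF u(2)]] by simp
  also have "\<dots> > 0" using \<tau> A_nonneg[OF u(2)] by (intro det_mat_add_pos)
  finally have S: "S > 0" using \<tau> by (simp add: zero_less_mult_iff)
  have detD: "det (matrix D) = real ?n * h u * S"
    unfolding D_def S_def
    by (subst det_polar_jacobian[OF u(1) A_radial[OF u(2)] inner_A_left[OF u(2)]])
       (use \<tau> u(2) in \<open>simp_all add: h_eq\<close>)
  have linD: "linear D"
    unfolding D_def by (rule linearI) (simp_all add: algebra_simps inner_add_right matrix_vector_right_distrib matrix_vector_mult_scaleR)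
  define c where "c = norm x ^ (?n - 1)"
  have "G' t x = (*\<^sub>R) c \<circ> D" by (simp add: fun_eq_iff G'_def D_def c_def u_def \<tau>_def)
  then have "matrix (G' t x) = matrix ((*\<^sub>R) c) ** matrix D"
    using matrix_compose[OF linD linear_scale_self] by simp
  then have "det (matrix (G' t x)) = c ^ ?n * (real ?n * h u * S)"
    by (simp add: det_mul detD)
  also have "\<dots> = (\<Sum>j<?n. J j x * t ^ j)"
    unfolding S_def sum_distrib_left
  proof (intro sum.cong refl)
    fix j assume "j \<in> {..<?n}"
    then have "?n - 1 - j + j = ?n - 1" by auto
    then have e: "?n * (?n - 1 - j) + ?n * j = (?n - 1) * ?n"
      by (simp only: add_mult_distrib2[symmetric] mult.commute[of "?n - 1"])
    have "c ^ ?n = norm x ^ (?n * (?n - 1 - j)) * (norm x ^ ?n) ^ j"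
      unfolding c_def power_mult[symmetric] power_add[symmetric] e ..
    then show "c ^ ?n * (real ?n * h u * (char_coeff (Suc j) (A u) * \<tau> ^ j)) = J j x * t ^ j"
      using x by (simp add: J_def u_def \<tau>_def power_divide)
  qed
  finally have *: "det (matrix (G' t x)) = (\<Sum>j<?n. J j x * t ^ j)" .
  have "c ^ ?n * (real ?n * h u * S) \<ge> 0" using S h_pos[OF u(2)] by (simp add: c_def)
  then show ?thesis using * \<open>det (matrix (G' t x)) = c ^ ?n * (real ?n * h u * S)\<close> by simp
qed

lemma J_measurable [measurable]: "J j \<in> borel_measurable borel"
proof -
  have [measurable]: "h \<in> borel_measurable borel"
    by (rule borel_measurable_continuous_onI[OF h_cont])
  have [measurable]: "(\<lambda>x. char_coeff (Suc j) (A x)) \<in> borel_measurable borel"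
    by (intro borel_measurable_off_zero continuous_on_char_coeff A_cont)
  show ?thesis unfolding J_def[abs_def] by measurable
qed

lemma J_scale: "c > 0 \<Longrightarrow> J j (c *\<^sub>R x) = c ^ (CARD('n) * (CARD('n) - 1 - j)) * J j x"
  by (simp add: J_def sgn_scale_pos power_mult_distrib)

lemma J_bounded: "\<exists>B\<ge>0. \<forall>x. norm x \<le> 1 \<longrightarrow> x \<noteq> 0 \<longrightarrow> \<bar>J j x\<bar> \<le> B"
proof -
  have "continuous_on (- {0}) (\<lambda>u. h u * char_coeff (Suc j) (A u))"
    by (intro continuous_intros continuous_on_char_coeff h_cont_on A_cont)
  from bounded_on_unit_sphere[OF this] obtain B
    where B: "\<And>u. norm u = 1 \<Longrightarrow> \<bar>h u * char_coeff (Suc j) (A u)\<bar> \<le> B" by blast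
  show ?thesis
  proof (intro exI[of _ "real CARD('n) * \<bar>B\<bar>"] conjI allI impI)
    fix x :: "real^'n" assume x: "norm x \<le> 1" "x \<noteq> 0"
    have "\<bar>J j x\<bar> = real CARD('n) * \<bar>h (sgn x) * char_coeff (Suc j) (A (sgn x))\<bar> * norm x ^ (CARD('n) * (CARD('n) - 1 - j))"
      by (simp add: J_def abs_mult)
    also have "\<dots> \<le> real CARD('n) * \<bar>B\<bar> * 1"
      using x B[of "sgn x"] by (intro mult_mono power_le_one) (auto simp: norm_sgn)
    finally show "\<bar>J j x\<bar> \<le> real CARD('n) * \<bar>B\<bar>" by simp
  qed simp
qed

text \<open>The sweep never reaches the ball \<open>t B\<close>; its volume supplies the coefficient
  of index n.\<close>

definition steiner_coeff :: "nat \<Rightarrow> real" where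
  "steiner_coeff j = (if j < CARD('n) then integral\<^sup>L lball (J j) else measure (lball :: (real^'n) measure) UNIV)"

text \<open>Scaling to the unit ball: the volume element gives R^n and \<open>J j\<close> gives
  R^(n(n-1-j)), together the power n - j of R^n.\<close>

lemma
  assumes R: "R > 0"
  shows J_set_integrable: "set_integrable lborel (cball 0 R - {0}) (J j)"
    and J_set_integral: "j < CARD('n) \<Longrightarrow> (LINT x:cball 0 R - {0}|lborel. J j x) = steiner_coeff j * (R ^ CARD('n)) ^ (CARD('n) - j)"
proof -
  let ?n = "CARD('n)"
  let ?c = "R ^ (?n * (?n - 1 - j))"
  let ?F = "\<lambda>x. indicator (cball 0 R - {0}) x *\<^sub>R J j x"
  have eq: "?F (R *\<^sub>R x) = ?c * (indicator (cball 0 1 - {0}) x *\<^sub>R J j x)" for x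
    using R by (auto simp: indicator_def J_scale)
  obtain B where B: "\<And>x. norm x \<le> 1 \<Longrightarrow> x \<noteq> 0 \<Longrightarrow> \<bar>J j x\<bar> \<le> B" "B \<ge> 0" using J_bounded[of j] by blast
  have bd: "\<bar>J j x\<bar> \<le> ?c * B" if "x \<in> cball 0 R - {0}" for x
  proof -
    have "J j x = ?c * J j (x /\<^sub>R R)" using J_scale[OF R, of j "x /\<^sub>R R"] R by simp
    moreover have "\<bar>J j (x /\<^sub>R R)\<bar> \<le> B" using that R by (intro B) (auto simp: field_simps)
    ultimately show ?thesis using R by (simp add: abs_mult mult_left_mono)
  qed
  show si: "set_integrable lborel (cball 0 R - {0}) (J j)"
    unfolding set_integrable_def
  proof (rule integrableI_bounded_set_indicator[where B = "?c * B"])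
    have "emeasure lborel (cball 0 R - {0} :: (real^'n) set) \<le> emeasure lborel (cball (0::real^'n) R)"
      by (rule emeasure_mono) auto
    then show "emeasure lborel (cball 0 R - {0} :: (real^'n) set) < \<infinity>"
      using emeasure_lborel_cball_finite[of "0::real^'n" R] by (simp add: less_le_trans order_le_less_trans)
  qed (use bd in auto)
  assume j: "j < ?n"
  have "cball 0 R - {0 :: real^'n} \<in> sets borel" by (intro sets.Diff) auto
  then have F: "?F \<in> borel_measurable borel"
    by (intro borel_measurable_scaleR borel_measurable_indicator J_measurable)
  have "(LINT x:cball 0 R - {0}|lborel. J j x) = R ^ ?n * (LINT x|lborel. ?c * (indicator (cball 0 1 - {0}) x *\<^sub>R J j x))"
    using integral_lborel_scale[OF F, of R] R unfolding eq set_lebesgue_integral_def by simp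
  also have "(LINT x|lborel. ?c * (indicator (cball 0 1 - {0}) x *\<^sub>R J j x)) = ?c * (LINT x|lborel. indicator (cball 0 1) x *\<^sub>R J j x)"
  proof -
    have "(LINT x|lborel. indicator (cball 0 1 - {0}) x *\<^sub>R J j x) = (LINT x|lborel. indicator (cball 0 1) x *\<^sub>R J j x)"
      by (rule integral_cong_AE) (use AE_lborel_singleton[of "0::real^'n"] in \<open>auto simp: indicator_def elim!: eventually_mono\<close>)
    then show ?thesis by simp
  qed
  also have "(LINT x|lborel. indicator (cball 0 1) x *\<^sub>R J j x) = steiner_coeff j"
    using integral_lball[OF J_measurable[of j]] j by (simp add: set_lebesgue_integral_def steiner_coeff_def)
  also have "R ^ ?n * (?c * steiner_coeff j) = steiner_coeff j * (R ^ ?n) ^ (?n - j)"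
  proof -
    have "?n - j = Suc (?n - 1 - j)" using j by simp
    then show ?thesis by (simp add: power_mult)
  qed
  finally show "(LINT x:cball 0 R - {0}|lborel. J j x) = steiner_coeff j * (R ^ ?n) ^ (?n - j)" .
qed

lemma steiner_pos:
  assumes s: "s > 0" and t: "t > 0"
  shows "measure lebesgue ((*\<^sub>R) s ` K + cball 0 t) = (\<Sum>j\<le>CARD('n). steiner_coeff j * s ^ (CARD('n) - j) * t ^ j)"
proof -
  let ?n = "CARD('n)"
  define R where "R = root ?n s"
  have R: "R > 0" "R ^ ?n = s" using s by (auto simp: R_def)
  let ?S = "cball 0 R - {0} :: (real^'n) set"
  let ?L = "(*\<^sub>R) s ` K + cball 0 t"
  have Lc: "compact ?L" by (intro compact_set_plus compact_scaling compact_body compact_cball)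
  have "0 \<in> K" using zero_interior interior_subset by auto
  have sub: "cball 0 t \<subseteq> ?L"
  proof
    fix z :: "real^'n" assume "z \<in> cball 0 t"
    then have "s *\<^sub>R 0 + z \<in> ?L" using \<open>0 \<in> K\<close> by (intro set_plus_intro imageI)
    then show "z \<in> ?L" by simp
  qed
  have JI: "integrable lborel (\<lambda>x. indicator ?S x *\<^sub>R (J j x * t ^ j))" for j
    using set_integrable_mult_left[OF J_set_integrable[OF R(1)]] by (simp add: set_integrable_def)
  have si: "set_integrable lborel ?S (\<lambda>x. \<bar>det (matrix (G' t x))\<bar>)"
  proof -
    have "set_integrable lborel ?S (\<lambda>x. \<Sum>j<?n. J j x * t ^ j)"
      unfolding set_integrable_def scaleR_sum_right using JI by (intro Bochner_Integration.integrable_sum) auto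
    then show ?thesis
      by (subst set_integrable_cong[OF refl refl det_G'[OF _ t]]) auto
  qed
  have "measure lebesgue (?L - cball 0 t) = (LINT x:?S|lborel. \<bar>det (matrix (G' t x))\<bar>)"
  proof -
    have "measure lebesgue (G t ` ?S) = (LINT x:?S|lborel. \<bar>det (matrix (G' t x))\<bar>)"
    proof (rule measure_differentiable_image_finite(2)[where f = "G t" and f' = "G' t"])
      show "?S \<in> sets borel" by (intro sets.Diff) auto
      show "(G t has_derivative G' t x) (at x within ?S)" if "x \<in> ?S" for x
        using that by (intro has_derivative_at_withinI[OF G_der]) simp
      show "inj_on (G t) ?S" by (rule inj_on_subset[OF G_inj[OF t]]) auto
    qed (rule si)
    then show ?thesis using G_image[OF t R(1)] by (simp add: R(2))
  qed
  also have "\<dots> = (LINT x:?S|lborel. \<Sum>j<?n. J j x * t ^ j)"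
    by (intro set_lebesgue_integral_cong) (auto simp: det_G'[OF _ t])
  also have "\<dots> = (\<Sum>j<?n. (LINT x:?S|lborel. J j x * t ^ j))"
    unfolding set_lebesgue_integral_def scaleR_sum_right using JI by (intro Bochner_Integration.integral_sum) auto
  also have "\<dots> = (\<Sum>j<?n. steiner_coeff j * s ^ (?n - j) * t ^ j)"
    by (intro sum.cong refl) (simp add: J_set_integral[OF R(1)] R(2))
  finally have 1: "measure lebesgue (?L - cball 0 t) = \<dots>" .
  have "measure lebesgue ?L = measure lebesgue (?L - cball 0 t) + measure lebesgue (cball (0::real^'n) t)"
    using measurable_measure_Diff[OF lmeasurable_compact[OF Lc], of "cball 0 t"] sub by simp
  also have "measure lebesgue (cball (0::real^'n) t) = steiner_coeff ?n * t ^ ?n"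
    using t by (simp add: steiner_coeff_def unit_ball_vol_eq[symmetric] content_cball)
  finally show ?thesis by (simp add: 1 lessThan_Suc_atMost[symmetric])
qed

text \<open>The sweep settles positive \<open>s\<close> and \<open>t\<close>. For
  \<open>s = 0\<close> the body is a ball; for \<open>t = 0\<close> the volume is the limit from the
  right.\<close>

lemma steiner:
  assumes s: "s \<ge> 0" and t: "t \<ge> 0"
  shows "measure lebesgue ((*\<^sub>R) s ` K + cball 0 t) = (\<Sum>j\<le>CARD('n). steiner_coeff j * s ^ (CARD('n) - j) * t ^ j)"
proof -
  let ?n = "CARD('n)"
  let ?P = "\<lambda>t. \<Sum>j\<le>?n. steiner_coeff j * s ^ (?n - j) * t ^ j"
  consider "s = 0" | "s > 0" "t > 0" | "s > 0" "t = 0" using s t by force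
  then show ?thesis
  proof cases
    case 1
    have "(*\<^sub>R) s ` K = {0}" using 1 body_nonempty by (simp add: image_constant_conv)
    moreover have "{0} + cball (0::real^'n) t = cball 0 t" by (auto simp: set_plus_def)
    ultimately have "measure lebesgue ((*\<^sub>R) s ` K + cball 0 t) = measure lebesgue (cball (0::real^'n) t)"
      by simp
    also have "\<dots> = steiner_coeff ?n * t ^ ?n"
      using t by (simp add: steiner_coeff_def unit_ball_vol_eq[symmetric] content_cball)
    also have "\<dots> = ?P t"
    proof -
      have "(\<Sum>j<?n. steiner_coeff j * s ^ (?n - j) * t ^ j) = 0"
        using 1 by (intro sum.neutral) (auto simp: zero_power)
      then show ?thesis by (simp add: lessThan_Suc_atMost[symmetric])
    qed
    finally show ?thesis .
  next
    case 2
    then show ?thesis by (rule steiner_pos)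
  next
    case 3
    define V where "V t = measure lebesgue ((*\<^sub>R) s ` K + cball 0 t)" for t
    obtain e where e: "e > 0" "cball 0 e \<subseteq> K" using zero_interior by (auto simp: mem_interior_cball)
    have scale: "measure lebesgue ((*\<^sub>R) c ` K) = c ^ ?n * measure lebesgue K" if "c \<ge> 0" for c
      using measure_lebesgue_affine[of c 0 K] that by simp
    have Klm: "(*\<^sub>R) c ` K \<in> lmeasurable" for c
      by (intro lmeasurable_compact compact_scaling compact_body)
    \<comment> \<open>A ball of radius \<open>e\<close> inside \<open>K\<close> gives t B
      \<subseteq> (t/e) K, so the parallel body lies between s K and (s + t/e) K.\<close>
    have up: "V t \<le> (s + t / e) ^ ?n * measure lebesgue K" and lo: "s ^ ?n * measure lebesgue K \<le> V t" if t: "t > 0" for t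
    proof -
      have Llm: "(*\<^sub>R) s ` K + cball 0 t \<in> lmeasurable"
        by (intro lmeasurable_compact compact_set_plus compact_scaling compact_body compact_cball)
      have "cball 0 t = (*\<^sub>R) (t / e) ` cball (0::real^'n) e"
        using cball_scale[of "t / e" "0::real^'n" e] e t by simp
      also have "\<dots> \<subseteq> (*\<^sub>R) (t / e) ` K" using e(2) by (rule image_mono)
      finally have "(*\<^sub>R) s ` K + cball 0 t \<subseteq> (*\<^sub>R) s ` K + (*\<^sub>R) (t / e) ` K"
        by (intro set_plus_mono2) auto
      also have "\<dots> = (*\<^sub>R) (s + t / e) ` K" using s t e by (intro convex_scale_plus convex_body) auto
      finally have "V t \<le> measure lebesgue ((*\<^sub>R) (s + t / e) ` K)"
        unfolding V_def using Klm Llm by (intro measure_mono_fmeasurable) auto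
      then show "V t \<le> (s + t / e) ^ ?n * measure lebesgue K" using s t e by (simp add: scale)
      have "(*\<^sub>R) s ` K \<subseteq> (*\<^sub>R) s ` K + cball 0 t"
      proof
        fix z assume "z \<in> (*\<^sub>R) s ` K"
        then have "z + 0 \<in> (*\<^sub>R) s ` K + cball 0 t" using t by (intro set_plus_intro) auto
        then show "z \<in> (*\<^sub>R) s ` K + cball 0 t" by simp
      qed
      then have "measure lebesgue ((*\<^sub>R) s ` K) \<le> V t"
        unfolding V_def using Klm Llm by (intro measure_mono_fmeasurable) auto
      then show "s ^ ?n * measure lebesgue K \<le> V t" using s by (simp add: scale)
    qed
    have lim1: "(V \<longlongrightarrow> s ^ ?n * measure lebesgue K) (at_right 0)"
    proof (rule tendsto_sandwich)
      show "\<forall>\<^sub>F t in at_right 0. s ^ ?n * measure lebesgue K \<le> V t"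
        using lo by (auto simp: eventually_at_right_field intro!: exI[of _ 1])
      show "\<forall>\<^sub>F t in at_right 0. V t \<le> (s + t / e) ^ ?n * measure lebesgue K"
        using up by (auto simp: eventually_at_right_field intro!: exI[of _ 1])
      have "((\<lambda>t. (s + t / e) ^ ?n * measure lebesgue K) \<longlongrightarrow> (s + 0 / e) ^ ?n * measure lebesgue K) (at_right 0)"
        using e by (intro tendsto_intros) auto
      then show "((\<lambda>t. (s + t / e) ^ ?n * measure lebesgue K) \<longlongrightarrow> s ^ ?n * measure lebesgue K) (at_right 0)"
        by simp
    qed simp
    have "(?P \<longlongrightarrow> ?P 0) (at_right 0)" by (intro tendsto_intros)
    moreover have "\<forall>\<^sub>F t in at_right 0. ?P t = V t"
      using steiner_pos[OF 3(1)] by (auto simp: V_def eventually_at_right_field intro!: exI[of _ 1])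
    ultimately have "(V \<longlongrightarrow> ?P 0) (at_right 0)" by (rule Lim_transform_eventually)
    then have "?P 0 = s ^ ?n * measure lebesgue K"
      using tendsto_unique[OF _ _ lim1] by (simp add: trivial_limit_at_right_real)
    moreover have "(*\<^sub>R) s ` K + cball 0 t = (*\<^sub>R) s ` K" using 3 by (simp add: set_plus_def)
    ultimately show ?thesis using 3 s by (simp add: scale)
  qed
qed

text \<open>For j = n - 2 the coefficient of the characteristic polynomial is the trace, and the
  radial factor \<open>norm x ^ n\<close> has mean 1/2. This gives n/2 times the integral, to be
  divided by the binomial coefficient n(n-1)/2.\<close>

lemma quermassintegral_smooth:
  assumes n: "CARD('n) \<ge> 2"
  shows "quermassintegral (CARD('n) - 2) K = (LINT x|lball. h (sgn x) * trace (A (sgn x))) / (real CARD('n) - 1)"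
proof -
  let ?n = "CARD('n)"
  let ?q = "\<lambda>u. h u * trace (A u)"
  \<comment> \<open>The cut-off makes the radial weight bounded and non-negative on the whole line,
    as \<open>integral_lball_polar\<close> requires, and changes nothing on the unit ball.\<close>
  let ?w = "\<lambda>r. if 0 \<le> r \<and> r \<le> 1 then r ^ ?n else (0::real)"
  have qc: "continuous_on (- {0}) ?q"
    unfolding trace_def by (intro continuous_intros continuous_on_char_coeff h_cont_on A_cont)
  obtain B where B: "\<And>u. norm u = 1 \<Longrightarrow> \<bar>?q u\<bar> \<le> B"
    using bounded_on_unit_sphere[OF qc] by blast
  have "steiner_coeff (?n - 2) = (LINT x|lball. real ?n * (?q (sgn x) * ?w (norm x)))"
  proof -
    have "Suc (?n - 2) = ?n - 1" "?n - 1 - (?n - 2) = 1" using n by auto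
    then have J: "J (?n - 2) x = real ?n * (?q (sgn x) * norm x ^ ?n)" for x
      unfolding J_def by (simp only: char_coeff_trace mult_1_right mult_1_left mult_ac)
    have [measurable]: "?q \<in> borel_measurable borel" by (rule borel_measurable_off_zero[OF qc])
    have "integral\<^sup>L lball (J (?n - 2)) = (LINT x|lball. real ?n * (?q (sgn x) * ?w (norm x)))"
      by (rule integral_cong_AE) (use AE_lball_cball in \<open>auto simp: J elim!: eventually_mono\<close>)
    then show ?thesis using n by (simp add: steiner_coeff_def)
  qed
  also have "\<dots> = real ?n * (LINT x|lball. ?q (sgn x) * ?w (norm x))" by (rule integral_mult_right_zero)
  also have "(LINT x|lball. ?q (sgn x) * ?w (norm x)) = (LINT x|lball. ?q (sgn x)) / 2"
  proof -
    let ?m = "measure (lball :: (real^'n) measure) UNIV"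
    have "(LINT x|lball. ?q (sgn x) * ?w (norm x)) * ?m = (LINT (x::real^'n)|lball. ?w (norm x)) * (LINT x|lball. ?q (sgn x))"
      by (rule integral_lball_polar[OF borel_measurable_off_zero[OF qc] _ B, of _ 1]) (auto simp: power_le_one)
    also have "(LINT (x::real^'n)|lball. ?w (norm x)) = (LINT (x::real^'n)|lball. norm x ^ DIM(real^'n))"
      by (rule integral_cong_AE) (use AE_lball_cball in \<open>auto elim!: eventually_mono\<close>)
    also have "\<dots> = ?m / 2" by (rule integral_lball_norm_power)
    finally show ?thesis using measure_lball_pos[where 'a = "real^'n"] by simp
  qed
  finally have a: "steiner_coeff (?n - 2) = real ?n * ((LINT x|lball. ?q (sgn x)) / 2)" .
  have b: "real (?n choose 2) = real ?n * (real ?n - 1) / 2"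
    using n by (simp add: choose_two real_of_nat_div even_mult_iff of_nat_diff)
  have c: "quermassintegral (?n - 2) K = steiner_coeff (?n - 2) / real (?n choose 2)"
    by (rule quermassintegral_eqI[OF n convex_body body_nonempty]) (rule steiner)
  show ?thesis unfolding c a b using n by (simp add: field_simps)
qed

end

section \<open>Great circles\<close>

text \<open>
  The difference of the two sides of Wirtinger's inequality is the integral of
  \<open>(\<phi>' - \<phi> cot)\<^sup>2\<close>, up to the boundary terms of \<open>\<phi>\<^sup>2 cot\<close>. These vanish, and division by
  \<open>sin 0 = 0\<close> gives the continuous extension \<open>0\<close> at both ends.
\<close>

lemma wirtinger_vanishing:
  fixes \<phi> \<phi>' \<Psi> :: "real \<Rightarrow> real"
  assumes der: "\<And>t. (\<phi> has_real_derivative \<phi>' t) (at t)"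
    and anti: "\<And>t. \<phi> (t + pi) = - \<phi> t" and 0: "\<phi> 0 = 0"
    and \<Psi>: "\<And>t. (\<Psi> has_real_derivative (\<phi>' t)\<^sup>2 - (\<phi> t)\<^sup>2) (at t)"
  shows "\<Psi> 0 \<le> \<Psi> pi"
    and "\<Psi> pi = \<Psi> 0 \<Longrightarrow> \<exists>c. \<forall>t\<in>{0..pi}. \<phi> t = c * sin t"
proof -
  define B where "B t = (\<phi> t)\<^sup>2 * cos t / sin t" for t
  have B0: "B 0 = 0" "B pi = 0" by (simp_all add: B_def)
  \<comment> \<open>\<open>\<phi> s / s\<close> and \<open>sin s / s\<close> have the limits
    \<phi>'(0) and 1, and one more factor \<open>\<phi> s\<close> remains, which tends to 0.\<close>
  have "isCont B 0"
  proof -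
    have "((\<lambda>s. \<phi> s / s) \<longlongrightarrow> \<phi>' 0) (at 0)"
      using der[of 0] by (simp add: has_field_derivative_iff 0)
    moreover have "((\<lambda>s. sin s / s) \<longlongrightarrow> 1) (at (0::real))"
      using DERIV_sin[of "0::real"] by (simp add: has_field_derivative_iff)
    moreover have "(\<phi> \<longlongrightarrow> 0) (at 0)"
      using DERIV_isCont[OF der[of 0]] by (simp add: isCont_def 0)
    moreover have "(cos \<longlongrightarrow> 1) (at (0::real))"
      using isCont_cos[of "0::real"] by (simp add: isCont_def)
    ultimately have "((\<lambda>s. \<phi> s * cos s * ((\<phi> s / s) / (sin s / s))) \<longlongrightarrow> 0 * 1 * (\<phi>' 0 / 1)) (at 0)"
      by (intro tendsto_intros) auto
    then have "((\<lambda>s. \<phi> s * cos s * ((\<phi> s / s) / (sin s / s))) \<longlongrightarrow> 0) (at 0)" by simp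
    moreover have "\<forall>\<^sub>F s in at 0. \<phi> s * cos s * ((\<phi> s / s) / (sin s / s)) = B s"
      by (auto simp: eventually_at_filter B_def power2_eq_square intro!: always_eventually)
    ultimately have "(B \<longlongrightarrow> 0) (at 0)" by (rule Lim_transform_eventually)
    then show ?thesis by (simp add: isCont_def B0)
  qed
  moreover have Bper: "B (t + pi) = B t" for t by (simp add: B_def anti)
  ultimately have Bpi: "isCont B pi"
  proof -
    have "isCont (\<lambda>t. B (t - pi)) pi"
      by (rule isCont_o2[where f = "\<lambda>t. t - pi" and g = B]) (use \<open>isCont B 0\<close> in auto)
    moreover have "B (t - pi) = B t" for t using Bper[of "t - pi"] by simp
    ultimately show ?thesis by simp
  qed
  define W where "W t = \<Psi> t - B t" for t
  \<comment> \<open>The square is completed by 1/sin^2 = 1 + cot^2.\<close>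
  have Wder: "(W has_real_derivative (\<phi>' t - \<phi> t * cos t / sin t)\<^sup>2) (at t)" if t: "0 < t" "t < pi" for t
  proof -
    have s: "sin t > 0" using t by (rule sin_gt_zero)
    have "(B has_real_derivative (2 * \<phi> t * \<phi>' t * cos t / sin t - (\<phi> t)\<^sup>2 / (sin t)\<^sup>2)) (at t)"
    proof -
      have "(B has_real_derivative ((2 * \<phi> t * \<phi>' t * cos t - (\<phi> t)\<^sup>2 * sin t) * sin t - (\<phi> t)\<^sup>2 * cos t * cos t) / (sin t * sin t)) (at t)"
        unfolding B_def[abs_def] using s
        by (auto intro!: derivative_eq_intros der simp: power2_eq_square algebra_simps)
      moreover have "((2 * \<phi> t * \<phi>' t * cos t - (\<phi> t)\<^sup>2 * sin t) * sin t - (\<phi> t)\<^sup>2 * cos t * cos t) =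
          2 * \<phi> t * \<phi>' t * cos t * sin t - (\<phi> t)\<^sup>2 * ((sin t)\<^sup>2 + (cos t)\<^sup>2)"
        by (simp add: power2_eq_square algebra_simps del: sin_cos_squared_add sin_cos_squared_add2 sin_cos_squared_add3)
      ultimately have "(B has_real_derivative (2 * \<phi> t * \<phi>' t * cos t * sin t - (\<phi> t)\<^sup>2) / (sin t * sin t)) (at t)"
        by (simp only: sin_cos_squared_add mult_1_right)
      then show ?thesis using s by (simp add: diff_divide_distrib power2_eq_square)
    qed
    then have "(W has_real_derivative (\<phi>' t)\<^sup>2 - (\<phi> t)\<^sup>2 - (2 * \<phi> t * \<phi>' t * cos t / sin t - (\<phi> t)\<^sup>2 / (sin t)\<^sup>2)) (at t)"
      unfolding W_def[abs_def] by (intro DERIV_diff \<Psi>)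
    moreover have "(\<phi>' t)\<^sup>2 - (\<phi> t)\<^sup>2 - (2 * \<phi> t * \<phi>' t * cos t / sin t - (\<phi> t)\<^sup>2 / (sin t)\<^sup>2) =
        (\<phi>' t - \<phi> t * cos t / sin t)\<^sup>2"
    proof -
      have "(\<phi> t)\<^sup>2 / (sin t)\<^sup>2 = (\<phi> t)\<^sup>2 + (\<phi> t * cos t / sin t)\<^sup>2"
      proof -
        have "(\<phi> t)\<^sup>2 / (sin t)\<^sup>2 = (\<phi> t)\<^sup>2 * ((sin t)\<^sup>2 + (cos t)\<^sup>2) / (sin t)\<^sup>2"
          by (simp only: sin_cos_squared_add mult_1_right)
        also have "\<dots> = (\<phi> t)\<^sup>2 + (\<phi> t * cos t / sin t)\<^sup>2"
          using s by (simp add: power_divide power_mult_distrib distrib_left add_divide_distrib del: sin_cos_squared_add)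
        finally show ?thesis .
      qed
      then show ?thesis by (simp add: power2_eq_square algebra_simps)
    qed
    ultimately show ?thesis by simp
  qed
  have Wcont: "continuous_on {0..pi} W"
  proof (intro continuous_at_imp_continuous_on ballI)
    fix t assume t: "t \<in> {0..pi}"
    have "isCont \<Psi> t" using \<Psi> DERIV_isCont by blast
    then have "isCont W t" if "isCont B t" unfolding W_def[abs_def] using that by (intro continuous_intros)
    moreover have "isCont W t" if "0 < t" "t < pi" using Wder[OF that] DERIV_isCont by blast
    ultimately show "isCont W t" using t \<open>isCont B 0\<close> Bpi by force
  qed
  have mono: "W a \<le> W b" if "0 \<le> a" "a \<le> b" "b \<le> pi" for a b
  proof (rule DERIV_nonneg_imp_increasing_open[of a b W])
    show "a \<le> b" by fact
    show "\<exists>y. DERIV W x :> y \<and> 0 \<le> y" if "a < x" "x < b" for x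
      using Wder[of x] that \<open>0 \<le> a\<close> \<open>b \<le> pi\<close>
      by (intro exI[of _ "(\<phi>' x - \<phi> x * cos x / sin x)\<^sup>2"]) auto
    show "continuous_on {a..b} W" using Wcont by (rule continuous_on_subset) (use that in auto)
  qed
  show "\<Psi> 0 \<le> \<Psi> pi" using mono[of 0 pi] by (simp add: W_def B0)
  assume eq: "\<Psi> pi = \<Psi> 0"
  \<comment> \<open>In the equality case the monotone function \<open>W\<close> has equal end
    values, so it is constant. Its derivative vanishes, which is the equation \<phi>' = \<phi> cot,
    and \<phi> / sin is constant.\<close>
  have Wc: "W t = W 0" if "0 \<le> t" "t \<le> pi" for t
    using mono[of 0 t] mono[of t pi] that eq by (simp add: W_def B0)
  have ode: "\<phi>' t = \<phi> t * cos t / sin t" if t: "0 < t" "t < pi" for t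
  proof -
    have "(W has_real_derivative 0) (at t)"
    proof (rule has_field_derivative_transform_within_open[OF DERIV_const[of "W 0"], of "{0<..<pi}"])
      show "W 0 = W x" if "x \<in> {0<..<pi}" for x
        using that by (intro Wc[symmetric]) auto
    qed (use t in auto)
    then have "(\<phi>' t - \<phi> t * cos t / sin t)\<^sup>2 = 0" using Wder[OF t] DERIV_unique by blast
    then show ?thesis by simp
  qed
  have quot: "((\<lambda>t. \<phi> t / sin t) has_real_derivative 0) (at t)" if t: "0 < t" "t < pi" for t
  proof -
    have s: "sin t > 0" using t by (rule sin_gt_zero)
    have "((\<lambda>t. \<phi> t / sin t) has_real_derivative (\<phi>' t * sin t - \<phi> t * cos t) / (sin t * sin t)) (at t)"
      using s by (intro DERIV_divide der DERIV_sin) auto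
    then show ?thesis using s by (simp add: ode[OF t])
  qed
  have "\<exists>c. \<forall>t\<in>{0<..<pi}. \<phi> t / sin t = c"
  proof (rule has_field_derivative_zero_constant)
    show "((\<lambda>t. \<phi> t / sin t) has_real_derivative 0) (at t within {0<..<pi})" if "t \<in> {0<..<pi}" for t
      by (rule has_field_derivative_at_within[OF quot]) (use that in auto)
  qed simp
  then obtain c where c: "\<And>t. t \<in> {0<..<pi} \<Longrightarrow> \<phi> t / sin t = c" by blast
  have "\<phi> t = c * sin t" if t: "0 < t" "t < pi" for t
    using c[of t] t sin_gt_zero[OF t] by (simp add: field_simps)
  moreover have "\<phi> pi = 0" using anti[of 0] 0 by simp
  ultimately show "\<exists>c. \<forall>t\<in>{0..pi}. \<phi> t = c * sin t"
    using 0 by (intro exI[of _ c]) (force simp: less_eq_real_def)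
qed

lemma antiderivative_real:
  fixes f :: "real \<Rightarrow> real"
  assumes "continuous_on UNIV f"
  obtains F where "\<And>t. (F has_real_derivative f t) (at t)"
proof -
  define F where "F t = (LBINT s=ereal 0..ereal t. f s)" for t
  have "(F has_real_derivative f t) (at t)" for t
  proof -
    obtain a b where ab: "a < 0" "a < t" "0 < b" "t < b"
      by (meson lt_ex gt_ex min_less_iff_conj max_less_iff_conj that)
    have "(F has_vector_derivative f t) (at t within {a..b})"
      unfolding F_def[abs_def]
      by (rule interval_integral_FTC2[of a 0 b f]) (use ab assms continuous_on_subset in auto)
    moreover have "at t within {a..b} = at t" using ab by (intro at_within_interior) auto
    ultimately show ?thesis by (simp add: has_real_derivative_iff_has_vector_derivative)
  qed
  then show ?thesis by (rule that)
qed

text \<open>Antiperiodicity gives a zero \<open>t0\<close> by the intermediate value theorem. It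
  also makes the integrand periodic of period pi, so \<open>I\<close> is twice the integral over the
  half period that starts at \<open>t0\<close>. In the equality case \<phi> is a multiple of sin(t -
  t0) on [0, pi]; only the relation of three of its values is recorded, since this relation becomes
  additivity.\<close>

lemma wirtinger_antiperiodic:
  fixes \<phi> \<phi>' :: "real \<Rightarrow> real"
  assumes der: "\<And>t. (\<phi> has_real_derivative \<phi>' t) (at t)" and cont: "continuous_on UNIV \<phi>'"
    and anti: "\<And>t. \<phi> (t + pi) = - \<phi> t"
  defines "I \<equiv> (LINT t:{0..2 * pi}|lborel. (\<phi>' t)\<^sup>2 - (\<phi> t)\<^sup>2)"
  shows "I \<ge> 0" and "I = 0 \<Longrightarrow> \<phi> (pi / 4) = (\<phi> 0 + \<phi> (pi / 2)) / sqrt 2"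
proof -
  have \<phi>c: "continuous_on UNIV \<phi>" using der DERIV_isCont by (blast intro: continuous_at_imp_continuous_on)
  have \<psi>c: "continuous_on UNIV (\<lambda>t. (\<phi>' t)\<^sup>2 - (\<phi> t)\<^sup>2)" by (intro continuous_intros cont \<phi>c)
  then obtain \<Psi> where \<Psi>: "\<And>t. (\<Psi> has_real_derivative (\<phi>' t)\<^sup>2 - (\<phi> t)\<^sup>2) (at t)"
    using antiderivative_real by blast
  have anti': "\<phi>' (t + pi) = - \<phi>' t" for t
  proof -
    have "((\<lambda>t. \<phi> (t + pi)) has_real_derivative \<phi>' (t + pi)) (at t)"
      using der[of "t + pi"] by (simp add: DERIV_shift)
    moreover have "((\<lambda>t. \<phi> (t + pi)) has_real_derivative - \<phi>' t) (at t)"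
      unfolding anti by (intro DERIV_minus der)
    ultimately show ?thesis by (rule DERIV_unique)
  qed
  have I: "I = \<Psi> (2 * pi) - \<Psi> 0"
    using integral_FTC_Icc_real[of 0 "2 * pi" \<Psi> "\<lambda>t. (\<phi>' t)\<^sup>2 - (\<phi> t)\<^sup>2"] \<Psi> \<psi>c
    by (simp add: I_def set_lebesgue_integral_def mult.commute continuous_on_eq_continuous_at)
  define D where "D a = \<Psi> (a + pi) - \<Psi> a" for a
  have "(D has_real_derivative 0) (at a)" for a
  proof -
    have "((\<lambda>a. \<Psi> (a + pi)) has_real_derivative (\<phi>' a)\<^sup>2 - (\<phi> a)\<^sup>2) (at a)"
      using \<Psi>[of "a + pi"] by (simp add: DERIV_shift anti anti')
    from DERIV_diff[OF this \<Psi>[of a]] show ?thesis by (simp add: D_def[abs_def])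
  qed
  then have D: "D a = D b" for a b using DERIV_isconst_all by blast
  have "\<exists>t0. 0 \<le> t0 \<and> t0 \<le> pi \<and> \<phi> t0 = 0"
  proof (cases "\<phi> 0 \<le> 0")
    case True
    then show ?thesis
      using IVT'[of \<phi> 0 0 pi] anti[of 0] continuous_on_subset[OF \<phi>c] by auto
  next
    case False
    then show ?thesis
      using IVT2'[of \<phi> pi 0 0] anti[of 0] continuous_on_subset[OF \<phi>c] by auto
  qed
  then obtain t0 where t0: "0 \<le> t0" "t0 \<le> pi" "\<phi> t0 = 0" by blast
  have I2: "I = 2 * D t0" using I D[of 0 t0] D[of pi t0] by (simp add: D_def)
  have W1: "((\<lambda>s. \<phi> (s + t0)) has_real_derivative \<phi>' (t + t0)) (at t)" for t
    using der[of "t + t0"] by (simp add: DERIV_shift)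
  have W2: "\<phi> (t + pi + t0) = - \<phi> (t + t0)" for t using anti[of "t + t0"] by (simp add: add_ac)
  have W3: "((\<lambda>s. \<Psi> (s + t0)) has_real_derivative (\<phi>' (t + t0))\<^sup>2 - (\<phi> (t + t0))\<^sup>2) (at t)" for t
    using \<Psi>[of "t + t0"] by (simp add: DERIV_shift)
  note w = wirtinger_vanishing[of "\<lambda>s. \<phi> (s + t0)" "\<lambda>t. \<phi>' (t + t0)" "\<lambda>s. \<Psi> (s + t0)", OF W1 W2 _ W3]
  show "I \<ge> 0" using w(1) t0(3) I2 by (simp add: D_def add.commute)
  assume "I = 0"
  then have "\<exists>c. \<forall>t\<in>{0..pi}. \<phi> (t + t0) = c * sin t"
    using w(2) t0(3) I2 by (simp add: D_def add.commute)
  then obtain c where c: "\<And>t. t \<in> {0..pi} \<Longrightarrow> \<phi> (t + t0) = c * sin t" by blast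
  have val: "\<phi> t = c * sin (t - t0)" if t: "0 \<le> t" "t \<le> pi" for t
  proof (cases "t0 \<le> t")
    case True
    then show ?thesis using c[of "t - t0"] t t0 by auto
  next
    case False
    then have "\<phi> (t + pi) = c * sin (t + pi - t0)" using c[of "t + pi - t0"] t t0 by auto
    also have "sin (t + pi - t0) = - sin (t - t0)"
      using sin_periodic_pi[of "t - t0"] by (simp add: algebra_simps)
    finally show ?thesis using anti[of t] by simp
  qed
  have "\<phi> (pi / 4) = c * (sqrt 2 / 2 * cos t0 - sqrt 2 / 2 * sin t0)"
    using val[of "pi / 4"] by (simp only: sin_diff sin_45 cos_45) simp
  moreover have "\<phi> 0 = - (c * sin t0)" using val[of 0] by simp
  moreover have "\<phi> (pi / 2) = c * cos t0" using val[of "pi / 2"] by (simp only: sin_diff) simp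
  moreover have "sqrt 2 / 2 = 1 / sqrt (2::real)" by (simp add: field_simps)
  ultimately show "\<phi> (pi / 4) = (\<phi> 0 + \<phi> (pi / 2)) / sqrt 2"
    by (simp add: diff_divide_distrib right_diff_distrib)
qed


section \<open>Rotations of pairs and averages over circles\<close>

lemma AE_cos_nonzero: "AE t in lborel. cos t \<noteq> (0::real)"
proof -
  have "{t::real. cos t = 0} \<subseteq> (\<lambda>i::int. of_int i * (pi / 2)) ` UNIV"
    by (auto simp: cos_zero_iff_int)
  then have "countable {t::real. cos t = 0}" by (rule countable_subset) simp
  then have "{t::real. cos t = 0} \<in> null_sets lborel" by (rule countable_imp_null_set_lborel)
  then show ?thesis by (rule AE_I') auto
qed

text \<open>The second component is the velocity of the first: a function of \<open>fst\<close> and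
  its derivative along the curve are both functions of \<open>rot t z\<close>.\<close>

definition rot :: "real \<Rightarrow> 'a::real_vector \<times> 'a \<Rightarrow> 'a \<times> 'a" where
  "rot t z = (cos t *\<^sub>R fst z + sin t *\<^sub>R snd z, - sin t *\<^sub>R fst z + cos t *\<^sub>R snd z)"

lemma norm_rot: "norm (rot t z) = norm (z :: 'a::real_inner \<times> 'a)"
proof -
  have "rot t z \<bullet> rot t z = ((sin t)\<^sup>2 + (cos t)\<^sup>2) * (fst z \<bullet> fst z) + ((sin t)\<^sup>2 + (cos t)\<^sup>2) * (snd z \<bullet> snd z)"
    by (simp add: rot_def inner_prod_def inner_add inner_commute power2_eq_square algebra_simps del: sin_cos_squared_add sin_cos_squared_add2 sin_cos_squared_add3)
  then have "rot t z \<bullet> rot t z = z \<bullet> z" by (simp add: inner_prod_def)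
  then show ?thesis by (simp add: norm_eq_sqrt_inner)
qed

lemma borel_measurable_rot [measurable]:
  "(\<lambda>(t, z). rot t z) \<in> borel_measurable (borel :: (real \<times> ('a::euclidean_space \<times> 'a)) measure)"
  by (rule borel_measurable_continuous_onI) (auto simp: rot_def[abs_def] case_prod_beta intro!: continuous_intros)

lemma borel_measurable_rot1 [measurable]:
  "rot t \<in> borel_measurable (borel :: ('a::euclidean_space \<times> 'a) measure)"
  by (rule borel_measurable_continuous_onI) (auto simp: rot_def[abs_def] intro!: continuous_intros)

lemma borel_measurable_fst_snd [measurable]:
  "fst \<in> borel_measurable (borel :: ('a::euclidean_space \<times> 'a) measure)"
  "snd \<in> borel_measurable (borel :: ('a::euclidean_space \<times> 'a) measure)"
  by (auto intro!: borel_measurable_continuous_onI continuous_intros)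

lemma nn_integral_pair_lborel:
  fixes F :: "'a::euclidean_space \<times> 'a \<Rightarrow> ennreal"
  assumes [measurable]: "F \<in> borel_measurable borel"
  shows "(\<integral>\<^sup>+z. F z \<partial>lborel) = (\<integral>\<^sup>+x. \<integral>\<^sup>+y. F (x, y) \<partial>lborel \<partial>lborel)"
    and "(\<integral>\<^sup>+z. F z \<partial>lborel) = (\<integral>\<^sup>+y. \<integral>\<^sup>+x. F (x, y) \<partial>lborel \<partial>lborel)"
proof -
  have [measurable]: "F \<in> borel_measurable (lborel \<Otimes>\<^sub>M lborel)" by (simp add: lborel_prod)
  show "(\<integral>\<^sup>+z. F z \<partial>lborel) = (\<integral>\<^sup>+x. \<integral>\<^sup>+y. F (x, y) \<partial>lborel \<partial>lborel)"
    by (simp add: lborel_prod[symmetric] lborel.nn_integral_fst)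
  show "(\<integral>\<^sup>+z. F z \<partial>lborel) = (\<integral>\<^sup>+y. \<integral>\<^sup>+x. F (x, y) \<partial>lborel \<partial>lborel)"
    by (simp add: lborel_prod[symmetric] lborel_pair.nn_integral_snd)
qed

text \<open>A rotation with \<open>cos t \<noteq> 0\<close> is a shear with scaling in each variable in turn.\<close>

lemma nn_integral_rot:
  fixes F :: "'a::euclidean_space \<times> 'a \<Rightarrow> ennreal"
  assumes [measurable]: "F \<in> borel_measurable borel" and c: "cos t \<noteq> 0"
  shows "(\<integral>\<^sup>+z. F (rot t z) \<partial>lborel) = (\<integral>\<^sup>+z. F z \<partial>lborel)"
proof -
  define n where "n = DIM('a)"
  let ?c = "cos t" and ?s = "sin t"
  have e1: "ennreal (\<bar>1 / ?c\<bar> ^ n) * ennreal (\<bar>?c\<bar> ^ n) = 1"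
    using c by (simp add: ennreal_mult'[symmetric] power_mult_distrib[symmetric] abs_mult[symmetric] del: ennreal_1)
  have in1: "(\<integral>\<^sup>+x. F (?c *\<^sub>R x + ?s *\<^sub>R y, - ?s *\<^sub>R x + ?c *\<^sub>R y) \<partial>lborel) =
      ennreal (\<bar>1 / ?c\<bar> ^ n) * (\<integral>\<^sup>+x. F (x, (- ?s / ?c) *\<^sub>R x + (1 / ?c) *\<^sub>R y) \<partial>lborel)" for y :: 'a
  proof -
    have eq: "- ?s *\<^sub>R (- (?s / ?c) *\<^sub>R y + (1 / ?c) *\<^sub>R x) + ?c *\<^sub>R y = (- ?s / ?c) *\<^sub>R x + (1 / ?c) *\<^sub>R y" for x
    proof -
      have "?s * (?s / ?c) + ?c = ((?s)\<^sup>2 + (?c)\<^sup>2) / ?c" using c by (simp add: power2_eq_square field_simps)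
      then have "?s * (?s / ?c) + ?c = 1 / ?c" by simp
      moreover have "- ?s *\<^sub>R (- (?s / ?c) *\<^sub>R y + (1 / ?c) *\<^sub>R x) + ?c *\<^sub>R y = (- ?s / ?c) *\<^sub>R x + (?s * (?s / ?c) + ?c) *\<^sub>R y"
        by (simp add: algebra_simps)
      ultimately show ?thesis by simp
    qed
    have eq2: "?c *\<^sub>R (- (?s / ?c) *\<^sub>R y + (1 / ?c) *\<^sub>R x) + ?s *\<^sub>R y = x" for x
      using c by (simp add: algebra_simps)
    have m: "(\<lambda>x. F (?c *\<^sub>R x + ?s *\<^sub>R y, - ?s *\<^sub>R x + ?c *\<^sub>R y)) \<in> borel_measurable borel" by measurable
    show ?thesis
      using nn_integral_lborel_scale[OF m, of "1 / ?c" "- (?s / ?c) *\<^sub>R y"] c unfolding eq eq2 n_def by simp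
  qed
  have in2: "(\<integral>\<^sup>+y. F (x, (- ?s / ?c) *\<^sub>R x + (1 / ?c) *\<^sub>R y) \<partial>lborel) = ennreal (\<bar>?c\<bar> ^ n) * (\<integral>\<^sup>+y. F (x, y) \<partial>lborel)" for x :: 'a
  proof -
    have m: "(\<lambda>y. F (x, (- ?s / ?c) *\<^sub>R x + (1 / ?c) *\<^sub>R y)) \<in> borel_measurable borel" by measurable
    have eq: "(- ?s / ?c) *\<^sub>R x + (1 / ?c) *\<^sub>R (?s *\<^sub>R x + ?c *\<^sub>R y) = y" for y
      using c by (simp add: algebra_simps)
    show ?thesis using nn_integral_lborel_scale[OF m c, of "?s *\<^sub>R x"] unfolding eq n_def .
  qed
  have "(\<integral>\<^sup>+z. F (rot t z) \<partial>lborel) = (\<integral>\<^sup>+y. \<integral>\<^sup>+x. F (?c *\<^sub>R x + ?s *\<^sub>R y, - ?s *\<^sub>R x + ?c *\<^sub>R y) \<partial>lborel \<partial>lborel)"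
  proof -
    have "(\<lambda>z. F (rot t z)) \<in> borel_measurable borel" by measurable
    from nn_integral_pair_lborel(2)[OF this] show ?thesis by (simp add: rot_def)
  qed
  also have "\<dots> = ennreal (\<bar>1 / ?c\<bar> ^ n) * (\<integral>\<^sup>+y. \<integral>\<^sup>+x. F (x, (- ?s / ?c) *\<^sub>R x + (1 / ?c) *\<^sub>R y) \<partial>lborel \<partial>lborel)"
    unfolding in1 by (rule nn_integral_cmult) measurable
  also have "(\<integral>\<^sup>+(y::'a). \<integral>\<^sup>+x. F (x, (- ?s / ?c) *\<^sub>R x + (1 / ?c) *\<^sub>R y) \<partial>lborel \<partial>lborel) =
      (\<integral>\<^sup>+x. \<integral>\<^sup>+y. F (x, (- ?s / ?c) *\<^sub>R x + (1 / ?c) *\<^sub>R y) \<partial>lborel \<partial>lborel)"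
    by (rule lborel_pair.Fubini') measurable
  also have "\<dots> = ennreal (\<bar>?c\<bar> ^ n) * (\<integral>\<^sup>+x. \<integral>\<^sup>+y. F (x, y) \<partial>lborel \<partial>lborel)"
    unfolding in2 by (rule nn_integral_cmult) measurable
  also have "(\<integral>\<^sup>+x. \<integral>\<^sup>+y. F (x, y) \<partial>lborel \<partial>lborel) = (\<integral>\<^sup>+z. F z \<partial>lborel)"
    by (rule nn_integral_pair_lborel(1)[symmetric]) simp
  finally show ?thesis by (simp only: mult.assoc[symmetric] e1 mult_1_left)
qed

lemma integral_lball_invariant:
  fixes f :: "'a::euclidean_space \<Rightarrow> real"
  assumes [measurable]: "f \<in> borel_measurable borel" "T \<in> borel_measurable borel"
    and inv: "\<And>F :: 'a \<Rightarrow> ennreal. F \<in> borel_measurable borel \<Longrightarrow> (\<integral>\<^sup>+z. F (T z) \<partial>lborel) = (\<integral>\<^sup>+z. F z \<partial>lborel)"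
    and norm: "\<And>z. norm (T z) = norm z"
  shows "(LINT z|lball. f (T z)) = (LINT z|lball. f z)"
proof -
  have "distr lball borel T = lball"
  proof (rule measure_eqI)
    fix X assume "X \<in> sets (distr lball borel T)"
    then have [measurable]: "X \<in> sets borel" by simp
    have "emeasure (distr lball borel T) X = (\<integral>\<^sup>+z. indicator X (T z) \<partial>lball)"
      by (simp add: nn_integral_distr flip: nn_integral_indicator)
    also have "\<dots> = (\<integral>\<^sup>+z. indicator (cball 0 1) (T z) * indicator X (T z) \<partial>lborel)"
      by (subst nn_integral_lball) (auto simp: norm indicator_def intro!: nn_integral_cong)
    also have "\<dots> = (\<integral>\<^sup>+z. indicator (cball 0 1) z * indicator X z \<partial>lborel)"
      by (rule inv) measurable
    also have "\<dots> = emeasure lball X"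
      by (subst nn_integral_lball[symmetric]) auto
    finally show "emeasure (distr lball borel T) X = emeasure lball X" .
  qed simp
  then show ?thesis using integral_distr[of T lball borel f] by simp
qed

lemma integral_lball_rot:
  fixes f :: "'a::euclidean_space \<times> 'a \<Rightarrow> real"
  assumes "f \<in> borel_measurable borel" "cos t \<noteq> 0"
  shows "(LINT z|lball. f (rot t z)) = (LINT z|lball. f z)"
  by (rule integral_lball_invariant) (auto simp: assms norm_rot nn_integral_rot)

lemma integral_lball_snd:
  fixes f :: "'a::euclidean_space \<times> 'a \<Rightarrow> real" and T :: "'a \<Rightarrow> 'a"
  assumes f: "f \<in> borel_measurable borel" and [measurable]: "T \<in> borel_measurable borel"
    and T: "distr lborel borel T = lborel" "\<And>y. norm (T y) = norm y"
  shows "(LINT z|lball. f (fst z, T (snd z))) = (LINT z|lball. f z)"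
proof (rule integral_lball_invariant[where T = "\<lambda>z. (fst z, T (snd z))", OF f])
  show "norm (fst z, T (snd z)) = norm z" for z by (simp add: norm_prod_def T)
  fix F :: "'a \<times> 'a \<Rightarrow> ennreal" assume [measurable]: "F \<in> borel_measurable borel"
  have "(\<integral>\<^sup>+y. F (x, T y) \<partial>lborel) = (\<integral>\<^sup>+y. F (x, y) \<partial>lborel)" for x
    using nn_integral_distr[of T lborel borel "\<lambda>y. F (x, y)"] by (simp add: T)
  moreover have "(\<lambda>z. F (fst z, T (snd z))) \<in> borel_measurable borel" by measurable
  ultimately show "(\<integral>\<^sup>+z. F (fst z, T (snd z)) \<partial>lborel) = (\<integral>\<^sup>+z. F z \<partial>lborel)"
    by (subst (1 2) nn_integral_pair_lborel(1)) simp_all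
qed measurable

text \<open>Fubini, and invariance of the ball under \<open>rot t\<close> for almost every
  \<open>t\<close>. Cutting \<open>f\<close> off outside the ball makes its bound global, hence the
  integrand integrable on the product.\<close>

lemma integral_lball_circle:
  fixes f :: "'a::euclidean_space \<times> 'a \<Rightarrow> real"
  assumes [measurable]: "f \<in> borel_measurable borel" and B: "\<And>z. norm z \<le> 1 \<Longrightarrow> \<bar>f z\<bar> \<le> B"
  shows "(LINT z|lball. (LINT t:{0..2 * pi}|lborel. f (rot t z))) = 2 * pi * (LINT z|lball. f z)"
    and "integrable lball (\<lambda>z. (LINT t:{0..2 * pi}|lborel. f (rot t z)))"
proof -
  define M where "M = density lborel (indicator {0..2 * pi} :: real \<Rightarrow> ennreal)"
  have sM [measurable_cong]: "sets M = sets borel" by (simp add: M_def)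
  have finM: "finite_measure M"
    by standard (simp add: M_def emeasure_density)
  interpret M: finite_measure M by (rule finM)
  interpret P: pair_sigma_finite "lball :: ('a \<times> 'a) measure" M ..
  interpret PF: finite_measure "(lball :: ('a \<times> 'a) measure) \<Otimes>\<^sub>M M"
    by (rule finite_measure_pair_measure) (auto intro: lball.finite_measure_axioms finM)
  define g where "g z = (if norm z \<le> 1 then f z else 0)" for z
  have [measurable]: "g \<in> borel_measurable borel" unfolding g_def[abs_def] by measurable
  have gB: "\<bar>g z\<bar> \<le> \<bar>B\<bar>" for z using B[of z] by (auto simp: g_def)
  have "(\<lambda>p. (snd p, fst p)) \<in> (lball :: ('a \<times> 'a) measure) \<Otimes>\<^sub>M M \<rightarrow>\<^sub>M borel \<Otimes>\<^sub>M borel"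
    by measurable
  then have "(\<lambda>p. (snd p, fst p)) \<in> (lball :: ('a \<times> 'a) measure) \<Otimes>\<^sub>M M \<rightarrow>\<^sub>M borel"
    by (simp add: borel_prod)
  from measurable_compose[OF this borel_measurable_rot]
  have [measurable]: "(\<lambda>p. rot (snd p) (fst p)) \<in> (lball :: ('a \<times> 'a) measure) \<Otimes>\<^sub>M M \<rightarrow>\<^sub>M borel"
    by simp
  have int: "integrable (lball \<Otimes>\<^sub>M M) (\<lambda>(z, t). g (rot t z))"
    unfolding case_prod_beta by (rule PF.integrable_const_bound[where B = "\<bar>B\<bar>"]) (use gB in auto)
  have Mint: "(LINT t|M. g (rot t z)) = (LINT t:{0..2 * pi}|lborel. g (rot t z))" for z
  proof -
    have [measurable]: "(\<lambda>t. rot t z) \<in> borel_measurable borel"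
      by (rule borel_measurable_continuous_onI) (auto simp: rot_def intro!: continuous_intros)
    show ?thesis
      unfolding M_def set_lebesgue_integral_def
      by (subst integral_density[of _ _ "indicator {0..2 * pi}", simplified ennreal_indicator]) auto
  qed
  have gf: "(LINT t:{0..2 * pi}|lborel. g (rot t z)) = (LINT t:{0..2 * pi}|lborel. f (rot t z))" if "norm z \<le> 1" for z
    using that by (simp add: g_def norm_rot)
  have cong: "AE z in lball. (LINT t|M. g (rot t z)) = (LINT t:{0..2 * pi}|lborel. f (rot t z))"
    using AE_lball_cball by eventually_elim (simp add: Mint gf)
  have cm: "(\<lambda>z. (LINT t:{0..2 * pi}|lborel. f (rot t z))) \<in> borel_measurable (lball :: ('a \<times> 'a) measure)"
  proof -
    have "(\<lambda>p. (snd p, fst p)) \<in> (lball :: ('a \<times> 'a) measure) \<Otimes>\<^sub>M (lborel :: real measure) \<rightarrow>\<^sub>M borel \<Otimes>\<^sub>M borel"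
      by measurable
    then have "(\<lambda>p. (snd p, fst p)) \<in> (lball :: ('a \<times> 'a) measure) \<Otimes>\<^sub>M (lborel :: real measure) \<rightarrow>\<^sub>M borel"
      by (simp add: borel_prod)
    from measurable_compose[OF this borel_measurable_rot]
    have [measurable]: "(\<lambda>p. rot (snd p) (fst p)) \<in> (lball :: ('a \<times> 'a) measure) \<Otimes>\<^sub>M (lborel :: real measure) \<rightarrow>\<^sub>M borel"
      by simp
    show ?thesis
      unfolding set_lebesgue_integral_def
      by (rule lborel.borel_measurable_lebesgue_integral) (simp add: case_prod_beta)
  qed
  have IL: "integrable lball (\<lambda>z. LINT t|M. g (rot t z))"
    using P.integrable_fst'[OF int] by simp
  show "integrable lball (\<lambda>z. (LINT t:{0..2 * pi}|lborel. f (rot t z)))"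
    by (rule integrable_cong_AE_imp[OF IL cm cong])
  have "(LINT z|lball. (LINT t:{0..2 * pi}|lborel. f (rot t z))) = (LINT z|lball. LINT t|M. g (rot t z))"
    by (rule integral_cong_AE[OF borel_measurable_integrable[OF IL] cm cong, symmetric])
  also have "\<dots> = (LINT t|M. LINT z|lball. g (rot t z))"
    using P.Fubini_integral[OF int] by simp
  also have "\<dots> = (LINT t|M. LINT z|lball. g z)"
  proof (rule integral_cong_AE)
    show "AE t in M. (LINT z|lball. g (rot t z)) = (LINT z|lball. g z)"
      unfolding M_def by (subst AE_density) (use AE_cos_nonzero in \<open>auto simp: integral_lball_rot elim!: eventually_mono\<close>)
    show "(\<lambda>t. LINT z|lball. g (rot t z)) \<in> borel_measurable M"
      using borel_measurable_integrable[OF P.integrable_snd[OF int]] by simp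
  qed simp
  also have "\<dots> = 2 * pi * (LINT z|lball. g z)"
    by (simp add: M_def measure_def emeasure_density)
  also have "(LINT z|lball. g z) = (LINT z|lball. f z)"
    by (rule integral_cong_AE) (use AE_lball_cball in \<open>auto simp: g_def elim!: eventually_mono\<close>)
  finally show "(LINT z|lball. (LINT t:{0..2 * pi}|lborel. f (rot t z))) = 2 * pi * (LINT z|lball. f z)" .
qed

lemma nn_integral_lborel_uminus:
  fixes F :: "'a::euclidean_space \<Rightarrow> ennreal"
  shows "F \<in> borel_measurable borel \<Longrightarrow> (\<integral>\<^sup>+x. F (- x) \<partial>lborel) = (\<integral>\<^sup>+x. F x \<partial>lborel)"
  using nn_integral_lborel_scale[of F "-1" 0] by simp

lemma integral_lball_uminus:
  fixes f :: "'a::euclidean_space \<Rightarrow> real"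
  assumes "f \<in> borel_measurable borel"
  shows "(LINT x|lball. f (- x)) = (LINT x|lball. f x)"
  by (rule integral_lball_invariant[OF assms]) (auto simp: nn_integral_lborel_uminus)

lemma integral_lball_sgn_odd:
  fixes q :: "'a::euclidean_space \<Rightarrow> real"
  assumes [measurable]: "q \<in> borel_measurable borel" and odd: "\<And>x. x \<noteq> 0 \<Longrightarrow> q (- x) = - q x"
  shows "(LINT x|lball. q (sgn x)) = 0"
proof -
  have "(LINT x|lball. q (sgn x)) = (LINT (x::'a)|lball. q (sgn (- x)))"
    by (rule integral_lball_uminus[symmetric]) measurable
  also have "\<dots> = (LINT (x::'a)|lball. - q (sgn x))"
    by (rule integral_cong_AE) (use AE_lball_nonzero in \<open>auto simp: sgn_minus odd sgn_zero_iff elim!: eventually_mono\<close>)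
  finally show ?thesis by simp
qed

lemma integral_lball_swap:
  fixes f :: "'a::euclidean_space \<times> 'a \<Rightarrow> real"
  assumes "f \<in> borel_measurable borel"
  shows "(LINT z|lball. f (snd z, fst z)) = (LINT z|lball. f z)"
proof (rule integral_lball_invariant[where T = "\<lambda>z. (snd z, fst z)", OF assms])
  show "norm (snd z, fst z) = norm z" for z :: "'a \<times> 'a" by (simp add: norm_prod_def add.commute)
  fix F :: "'a \<times> 'a \<Rightarrow> ennreal" assume [measurable]: "F \<in> borel_measurable borel"
  have "(\<lambda>z. F (snd z, fst z)) \<in> borel_measurable borel" by measurable
  from nn_integral_pair_lborel(1)[OF this] nn_integral_pair_lborel(2)[of F]
  show "(\<integral>\<^sup>+z. F (snd z, fst z) \<partial>lborel) = (\<integral>\<^sup>+z. F z \<partial>lborel)" by simp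
qed measurable

section \<open>Second moments of the second vector\<close>

definition flip :: "'n \<Rightarrow> real^'n \<Rightarrow> real^'n" where
  "flip i y = (\<chi> j. (if j = i then - 1 else 1) * y $ j)"

lemma flip_nth [simp]: "flip i y $ j = (if j = i then - 1 else 1) * y $ j"
  by (simp add: flip_def)

lemma norm_flip: "norm (flip i y) = norm y"
  unfolding norm_vec_def L2_set_def by (intro arg_cong[where f = sqrt] sum.cong) auto

lemma borel_measurable_flip [measurable]: "flip (i :: 'n::finite) \<in> borel_measurable borel"
proof (rule borel_measurable_continuous_onI)
  have "continuous_on UNIV (\<lambda>y :: real^'n. (if j = i then - 1 else 1) * y $ j)" for j
    by (intro continuous_intros)
  then show "continuous_on UNIV (flip i)"
    unfolding flip_def[abs_def] by (rule continuous_on_vec_lambda)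
qed

lemma lborel_distr_flip: "distr lborel borel (flip (i :: 'n::finite)) = lborel"
proof -
  define c where "c = (\<lambda>b :: real^'n. if b = axis i 1 then -1 else (1::real))"
  have "0 + (\<Sum>b\<in>Basis. (c b * (x \<bullet> b)) *\<^sub>R b) = flip i x" for x
  proof (rule euclidean_eqI)
    fix b :: "real^'n" assume b: "b \<in> Basis"
    then obtain k where k: "b = axis k 1" by (auto simp: Basis_vec_def)
    have "(0 + (\<Sum>b\<in>Basis. (c b * (x \<bullet> b)) *\<^sub>R b)) \<bullet> b = c b * (x \<bullet> b)"
      using inner_sum_left_Basis[OF b, of "\<lambda>b. c b * (x \<bullet> b)"] by simp
    also have "\<dots> = flip i x \<bullet> b" by (simp add: k inner_axis c_def axis_eq_axis)
    finally show "(0 + (\<Sum>b\<in>Basis. (c b * (x \<bullet> b)) *\<^sub>R b)) \<bullet> b = flip i x \<bullet> b" .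
  qed
  moreover have "(\<Prod>b\<in>Basis. \<bar>c b\<bar>) = 1" by (intro prod.neutral) (simp add: c_def)
  ultimately show ?thesis
    using lborel_affine_euclidean[of c 0] by (simp add: c_def density_1 flip: one_ennreal_def)
qed

text \<open>Symmetries that act on the second vector only: reversing the sign of coordinate
  \<open>i\<close> changes the sign of a mixed moment, and exchanging the coordinates
  \<open>i\<close> and \<open>j\<close> exchanges two diagonal moments.\<close>

lemma
  fixes q :: "real^'n \<Rightarrow> real"
  assumes [measurable]: "q \<in> borel_measurable borel"
  shows moment_off_diagonal: "i \<noteq> j \<Longrightarrow> (LINT (z::(real^'n) \<times> (real^'n))|lball. q (fst z) * (snd z $ i * snd z $ j)) = 0"
    and moment_diagonal: "(LINT (z::(real^'n) \<times> (real^'n))|lball. q (fst z) * (snd z $ i * snd z $ i)) = (LINT (z::(real^'n) \<times> (real^'n))|lball. q (fst z) * (snd z $ j * snd z $ j))"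
proof -
  have nth [measurable]: "(\<lambda>z::(real^'n) \<times> (real^'n). snd z $ k) \<in> borel_measurable borel" for k
    by (intro borel_measurable_continuous_onI continuous_intros)
  have qm: "(\<lambda>z::(real^'n) \<times> (real^'n). q (fst z)) \<in> borel_measurable borel"
    by (rule measurable_compose[OF borel_measurable_fst_snd(1) assms])
  have m: "(\<lambda>z::(real^'n) \<times> (real^'n). q (fst z) * (snd z $ i * snd z $ j)) \<in> borel_measurable borel" for i j
    by (intro borel_measurable_times qm nth)
  show "(LINT (z::(real^'n) \<times> (real^'n))|lball. q (fst z) * (snd z $ i * snd z $ j)) = 0" if "i \<noteq> j"
    using integral_lball_snd[OF m[of i j], of "flip i"] that by (simp add: lborel_distr_flip norm_flip)
  let ?r = "Transposition.transpose i j"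
  have r: "bij ?r" by simp
  have "norm (reindex ?r y) = norm y" for y :: "real^'n"
    unfolding norm_vec_def L2_set_def using sum.reindex_bij_betw[OF r, of "\<lambda>k. (norm (y $ k))\<^sup>2"] by simp
  then show "(LINT (z::(real^'n) \<times> (real^'n))|lball. q (fst z) * (snd z $ i * snd z $ i)) = (LINT (z::(real^'n) \<times> (real^'n))|lball. q (fst z) * (snd z $ j * snd z $ j))"
    using integral_lball_snd[OF m[of i i], of "reindex ?r"] lborel_distr_reindex[OF r] by simp
qed

text \<open>Only the diagonal moments survive, and they are equal. Used for the matrices with
  entries P_i P_j, giving |P|^2, and for h A, giving h tr A.\<close>

lemma moment_quadratic:
  fixes m :: "'n \<Rightarrow> 'n \<Rightarrow> real^'n \<Rightarrow> real"
  assumes [measurable]: "\<And>i j. m i j \<in> borel_measurable borel" and B: "\<And>i j x. \<bar>m i j x\<bar> \<le> B"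
  shows "(LINT (z::(real^'n) \<times> (real^'n))|lball. (\<Sum>i\<in>UNIV. \<Sum>j\<in>UNIV. m i j (fst z) * (snd z $ i * snd z $ j))) * real CARD('n) =
    (LINT (z::(real^'n) \<times> (real^'n))|lball. (\<Sum>i\<in>UNIV. m i i (fst z)) * (norm (snd z))\<^sup>2)"
proof -
  have nth [measurable]: "(\<lambda>z::(real^'n) \<times> (real^'n). snd z $ k) \<in> borel_measurable borel" for k
    by (intro borel_measurable_continuous_onI continuous_intros)
  have mm: "(\<lambda>z::(real^'n) \<times> (real^'n). m i j (fst z)) \<in> borel_measurable borel" for i j
    by (rule measurable_compose[OF borel_measurable_fst_snd(1) assms(1)])
  have int: "integrable lball (\<lambda>z::(real^'n) \<times> (real^'n). m i j (fst z) * (snd z $ k * snd z $ l))" for i j k l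
  proof (rule integrable_lballI[of _ "\<bar>B\<bar>"])
    fix z :: "(real^'n) \<times> (real^'n)" assume z: "norm z \<le> 1"
    have 1: "\<bar>snd z $ k\<bar> \<le> 1" for k
      using component_le_norm_cart[of "snd z" k] norm_snd_le[of "snd z" "fst z"] z by simp
    have "\<bar>m i j (fst z) * (snd z $ k * snd z $ l)\<bar> = \<bar>m i j (fst z)\<bar> * (\<bar>snd z $ k\<bar> * \<bar>snd z $ l\<bar>)"
      by (simp add: abs_mult)
    also have "\<dots> \<le> \<bar>B\<bar> * (1 * 1)"
      by (intro mult_mono 1) (use B[of i j "fst z"] in auto)
    finally show "\<bar>m i j (fst z) * (snd z $ k * snd z $ l)\<bar> \<le> \<bar>B\<bar>" by simp
  qed (intro borel_measurable_times mm nth)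
  have "(LINT (z::(real^'n) \<times> (real^'n))|lball. (\<Sum>i\<in>UNIV. \<Sum>j\<in>UNIV. m i j (fst z) * (snd z $ i * snd z $ j))) =
      (\<Sum>i\<in>UNIV. \<Sum>j\<in>UNIV. LINT (z::(real^'n) \<times> (real^'n))|lball. m i j (fst z) * (snd z $ i * snd z $ j))"
    using int by simp
  also have "\<dots> = (\<Sum>i\<in>UNIV. \<Sum>j\<in>UNIV. if i = j then LINT (z::(real^'n) \<times> (real^'n))|lball. m i i (fst z) * (snd z $ i * snd z $ i) else 0)"
    by (intro sum.cong refl) (auto simp: moment_off_diagonal)
  also have "\<dots> = (\<Sum>i\<in>UNIV. LINT (z::(real^'n) \<times> (real^'n))|lball. m i i (fst z) * (snd z $ i * snd z $ i))"
    by simp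
  finally have 1: "(LINT (z::(real^'n) \<times> (real^'n))|lball. (\<Sum>i\<in>UNIV. \<Sum>j\<in>UNIV. m i j (fst z) * (snd z $ i * snd z $ j))) = \<dots>" .
  have "(LINT (z::(real^'n) \<times> (real^'n))|lball. (\<Sum>i\<in>UNIV. m i i (fst z)) * (norm (snd z))\<^sup>2) =
      (LINT (z::(real^'n) \<times> (real^'n))|lball. (\<Sum>i\<in>UNIV. \<Sum>k\<in>UNIV. m i i (fst z) * (snd z $ k * snd z $ k)))"
    by (simp add: power2_norm_eq_inner inner_vec_def sum_product)
  also have "\<dots> = (\<Sum>i\<in>UNIV. \<Sum>k\<in>UNIV. LINT (z::(real^'n) \<times> (real^'n))|lball. m i i (fst z) * (snd z $ k * snd z $ k))"
    using int by simp
  also have "\<dots> = (\<Sum>i\<in>UNIV. \<Sum>k\<in>(UNIV::'n set). LINT (z::(real^'n) \<times> (real^'n))|lball. m i i (fst z) * (snd z $ i * snd z $ i))"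
    by (intro sum.cong refl moment_diagonal) measurable
  finally show ?thesis by (simp add: 1 sum_distrib_left mult.commute)
qed

text \<open>Ball and weight depend on the two norms only, so integrating out the second vector
  leaves a function \<open>w\<close> of \<open>norm x\<close>; the rest is the polar decomposition
  in one vector.\<close>

lemma integral_lball_pair_polar:
  fixes f :: "'a::euclidean_space \<Rightarrow> real" and k :: "real \<times> real \<Rightarrow> real"
  assumes [measurable]: "f \<in> borel_measurable borel" "k \<in> borel_measurable borel"
    and f: "\<And>u. norm u \<le> 1 \<Longrightarrow> \<bar>f u\<bar> \<le> B"
    and k: "\<And>r s. 0 \<le> k (r, s)" "\<And>r s. \<bar>r\<bar> \<le> 1 \<Longrightarrow> \<bar>s\<bar> \<le> 1 \<Longrightarrow> k (r, s) \<le> 1"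
  shows "(LINT (z::'a \<times> 'a)|lball. f (sgn (fst z)) * k (norm (fst z), norm (snd z))) * measure (lball :: 'a measure) UNIV =
    (LINT (z::'a \<times> 'a)|lball. k (norm (fst z), norm (snd z))) * (LINT x|lball. f (sgn x))"
proof -
  define I where "I r s = (if r\<^sup>2 + s\<^sup>2 \<le> 1 then k (r, s) else 0)" for r s
  have [measurable]: "(\<lambda>p. I (fst p) (snd p)) \<in> borel_measurable borel"
    unfolding I_def by measurable
  have [measurable]: "(\<lambda>(x, y). I x y) \<in> borel_measurable (borel \<Otimes>\<^sub>M borel)"
    using \<open>(\<lambda>p. I (fst p) (snd p)) \<in> borel_measurable borel\<close> by (simp add: borel_prod case_prod_beta)
  have abs_le: "\<bar>r\<bar> \<le> 1 \<and> \<bar>s\<bar> \<le> 1" if "r\<^sup>2 + s\<^sup>2 \<le> 1" for r s :: real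
  proof -
    have "r\<^sup>2 \<le> 1" "s\<^sup>2 \<le> 1" using that zero_le_power2[of r] zero_le_power2[of s] by linarith+
    then show ?thesis by (simp add: abs_square_le_1)
  qed
  have I: "0 \<le> I r s" "I r s \<le> indicator {..1} s" for r s
    using k(1)[of r s] k(2)[of r s] abs_le[of r s] by (auto simp: I_def indicator_def)
  define w where "w r = (LINT (y::'a)|lborel. I r (norm y))" for r
  have w0: "0 \<le> w r" for r unfolding w_def by (intro Bochner_Integration.integral_nonneg) (simp add: I)
  have wm [measurable]: "w \<in> borel_measurable borel"
    unfolding w_def[abs_def] by measurable
  have w1: "w r \<le> measure lborel (cball (0::'a) 1)" for r
  proof -
    have "w r \<le> (LINT (y::'a)|lborel. indicator (cball 0 1) y)"
      unfolding w_def
    proof (rule integral_mono')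
      show "integrable lborel (indicator (cball (0::'a) 1) :: 'a \<Rightarrow> real)"
        using emeasure_lborel_cball_finite[of "0::'a" 1] by simp
      show "I r (norm y) \<le> indicator (cball 0 1) y" for y :: 'a
        using I(2)[of r "norm y"] by (simp add: indicator_def)
    qed (simp add: I)
    then show ?thesis by simp
  qed
  have w2: "w r = 0" if "r > 1" for r
  proof -
    have "I r s = 0" for s using abs_le[of r s] that by (auto simp: I_def)
    then show ?thesis by (simp add: w_def)
  qed
  have fub: "(LINT (z::'a \<times> 'a)|lball. f (sgn (fst z)) * k (norm (fst z), norm (snd z))) = (LINT x|lball. f (sgn x) * w (norm x))"
    if [measurable]: "f \<in> borel_measurable borel" and f: "\<And>u. norm u \<le> 1 \<Longrightarrow> \<bar>f u\<bar> \<le> B" for f B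
  proof -
    let ?F = "\<lambda>z::'a \<times> 'a. f (sgn (fst z)) * I (norm (fst z)) (norm (snd z))"
    have ind: "indicator (cball 0 1) z * (f (sgn (fst z)) * k (norm (fst z), norm (snd z))) = ?F z" for z :: "'a \<times> 'a"
      by (auto simp: I_def indicator_def norm_prod_def)
    have m: "(\<lambda>z. f (sgn (fst z)) * k (norm (fst z), norm (snd z))) \<in> borel_measurable (borel :: ('a \<times> 'a) measure)"
      by measurable
    have "integrable lball (\<lambda>z::'a \<times> 'a. f (sgn (fst z)) * k (norm (fst z), norm (snd z)))"
    proof (rule integrable_lballI[OF m, of "\<bar>B\<bar>"])
      fix z :: "'a \<times> 'a" assume "norm z \<le> 1"
      then have "norm (fst z) \<le> 1" "norm (snd z) \<le> 1"
        using norm_fst_le[of "fst z" "snd z"] norm_snd_le[of "snd z" "fst z"] by auto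
      moreover have "\<bar>f (sgn (fst z))\<bar> \<le> \<bar>B\<bar>"
        using f[of "sgn (fst z)"] by (cases "fst z = 0") (auto simp: norm_sgn)
      ultimately have "\<bar>f (sgn (fst z))\<bar> * \<bar>k (norm (fst z), norm (snd z))\<bar> \<le> \<bar>B\<bar> * 1"
        using k by (intro mult_mono) auto
      then show "\<bar>f (sgn (fst z)) * k (norm (fst z), norm (snd z))\<bar> \<le> \<bar>B\<bar>" by (simp add: abs_mult)
    qed
    then have "integrable lborel ?F"
      unfolding lball_def using m
      by (subst (asm) integrable_density[of _ _ "indicator (cball 0 1)", simplified ennreal_indicator]) (auto simp: ind)
    then have iF: "integrable (lborel \<Otimes>\<^sub>M lborel) ?F" by (simp add: lborel_prod)
    have "(LINT (z::'a \<times> 'a)|lball. f (sgn (fst z)) * k (norm (fst z), norm (snd z))) = (LINT z|lborel. ?F z)"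
      using integral_lball[OF m] by (simp add: set_lebesgue_integral_def ind)
    also have "\<dots> = (LINT x|lborel. LINT y|lborel. ?F (x, y))"
      using lborel_pair.integral_fst'[OF iF] by (simp add: lborel_prod)
    also have "\<dots> = (LINT x|lborel. f (sgn x) * w (norm x))"
      by (simp add: w_def)
    also have "\<dots> = (LINT x:cball 0 1|lborel. f (sgn x) * w (norm x))"
      unfolding set_lebesgue_integral_def
      by (intro Bochner_Integration.integral_cong refl) (auto simp: indicator_def w2)
    also have "\<dots> = (LINT x|lball. f (sgn x) * w (norm x))"
      by (rule integral_lball[symmetric]) measurable
    finally show ?thesis .
  qed
  have "(LINT x|lball. f (sgn x) * w (norm x)) * measure (lball :: 'a measure) UNIV =
      (LINT (x::'a)|lball. w (norm x)) * (LINT x|lball. f (sgn x))"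
    by (rule integral_lball_polar[where B = B, OF _ _ _ w0 w1]) (simp_all add: f)
  then show ?thesis
    using fub[OF assms(1) f] fub[of "\<lambda>_. 1" 1] by simp
qed

section \<open>Exact integrands along generic circles\<close>

text \<open>The condition is linear independence, as failure of equality in Cauchy-Schwarz. For
  fixed \<open>x \<noteq> 0\<close> the dependent \<open>y\<close> form a line, which is a null set
  in dimension at least 2. Independent pairs rotate without \<open>fst\<close> ever hitting 0, where
  gradients are singular.\<close>

lemma AE_lball_pair_independent:
  assumes n: "DIM('a::euclidean_space) \<ge> 2"
  shows "AE (z::'a \<times> 'a) in lball. (fst z \<bullet> fst z) * (snd z \<bullet> snd z) \<noteq> (fst z \<bullet> snd z)\<^sup>2"
proof -
  define P where "P z \<longleftrightarrow> (fst z \<bullet> fst z) * (snd z \<bullet> snd z) \<noteq> (fst z \<bullet> snd z)\<^sup>2" for z :: "'a \<times> 'a"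
  have "open {z. P z}"
    unfolding P_def by (intro open_Collect_neq continuous_intros)
  then have Pm: "{z \<in> space (lborel \<Otimes>\<^sub>M lborel). P z} \<in> sets (lborel \<Otimes>\<^sub>M lborel)"
    unfolding lborel_prod by (simp add: borel_open)
  have "AE x in lborel. AE y in lborel. P (x, y)"
    using AE_lborel_singleton[of "0::'a"]
  proof eventually_elim
    case (elim x)
    have "{y. \<not> P (x, y)} \<subseteq> span {x}"
    proof
      fix y assume "y \<in> {y. \<not> P (x, y)}"
      then have e: "(x \<bullet> x) * (y \<bullet> y) = (x \<bullet> y)\<^sup>2" by (simp add: P_def)
      define c where "c = (x \<bullet> y) / (x \<bullet> x)"
      have "(y - c *\<^sub>R x) \<bullet> (y - c *\<^sub>R x) = y \<bullet> y - (x \<bullet> y)\<^sup>2 / (x \<bullet> x)"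
        using elim by (simp add: c_def inner_diff inner_commute power2_eq_square field_simps)
      also have "\<dots> = 0" using elim by (simp add: e[symmetric])
      finally have "y = c *\<^sub>R x" by simp
      then show "y \<in> span {x}" by (simp add: span_base span_scale)
    qed
    moreover have "negligible (span {x})"
    proof (rule negligible_lowdim)
      have "dim (span {x}) \<le> card {x}" by (metis dim_le_card dim_span finite.emptyI finite.insertI span_superset)
      then show "dim (span {x}) < DIM('a)" using n by simp
    qed
    ultimately have "negligible {y. \<not> P (x, y)}" by (rule negligible_subset[rotated])
    moreover have "{y. \<not> P (x, y)} \<in> sets borel"
    proof -
      have "closed {y. \<not> P (x, y)}" unfolding P_def by (simp, intro closed_Collect_eq continuous_intros)
      then show ?thesis by simp
    qed
    ultimately have "{y. \<not> P (x, y)} \<in> null_sets lborel"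
      by (simp add: negligible_iff_null_sets null_sets_completion_iff)
    then show ?case by (rule AE_I') auto
  qed
  then have "AE z in lborel \<Otimes>\<^sub>M lborel. P z" by (rule lborel_pair.AE_pair_measure[OF Pm])
  then have "AE z in lborel. P z" unfolding lborel_prod .
  then show ?thesis unfolding P_def by (rule AE_lball)
qed

lemma fst_rot_nonzero:
  fixes z :: "'a::real_inner \<times> 'a"
  assumes "(fst z \<bullet> fst z) * (snd z \<bullet> snd z) \<noteq> (fst z \<bullet> snd z)\<^sup>2"
  shows "fst (rot t z) \<noteq> 0"
proof
  obtain x y where z: "z = (x, y)" by fastforce
  assume "fst (rot t z) = 0"
  then have e: "cos t *\<^sub>R x + sin t *\<^sub>R y = 0" by (simp add: rot_def z)
  show False
  proof (cases "cos t = 0")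
    case True
    then have "sin t \<noteq> 0" using sin_cos_squared_add[of t] by auto
    then have "y = 0" using e True by simp
    then show False using assms by (simp add: z)
  next
    case False
    have "x = - (sin t / cos t) *\<^sub>R y"
    proof -
      have "x = (1 / cos t) *\<^sub>R (cos t *\<^sub>R x)" using False by simp
      also have "cos t *\<^sub>R x = - (sin t *\<^sub>R y)" using e by (simp add: eq_neg_iff_add_eq_0)
      finally show ?thesis by simp
    qed
    then show False using assms by (simp add: z power2_eq_square)
  qed
qed

lemma rot_derivs:
  "((\<lambda>t. fst (rot t z)) has_vector_derivative snd (rot t z)) (at t)"
  "((\<lambda>t. snd (rot t z)) has_vector_derivative - fst (rot t z)) (at t)"
  by (auto simp: rot_def intro!: derivative_eq_intros)

lemma continuous_on_rot:
  fixes z :: "'a::real_normed_vector \<times> 'a"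
  shows "continuous_on S (\<lambda>t. fst (rot t z))" "continuous_on S (\<lambda>t. snd (rot t z))"
  by (auto simp: rot_def intro!: continuous_intros)

text \<open>Plays the part of the divergence theorem on the sphere: along almost every circle
  \<open>F\<close> is the derivative of a function of period 2 pi.\<close>

lemma integral_lball_circle_exact:
  fixes F :: "'a::euclidean_space \<times> 'a \<Rightarrow> real" and \<Phi> :: "'a \<times> 'a \<Rightarrow> real"
  assumes F: "F \<in> borel_measurable borel" "\<And>z. norm z \<le> 1 \<Longrightarrow> \<bar>F z\<bar> \<le> B"
    and der: "AE z in lball. (\<forall>t. ((\<lambda>t. \<Phi> (rot t z)) has_real_derivative F (rot t z)) (at t)) \<and>
      continuous_on UNIV (\<lambda>t. F (rot t z))"
  shows "(LINT z|lball. F z) = 0"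
proof -
  have "2 * pi * (LINT z|lball. F z) = (LINT z|lball. (LINT t:{0..2 * pi}|lborel. F (rot t z)))"
    by (rule integral_lball_circle(1)[OF F, symmetric])
  also have "\<dots> = (LINT (z::'a \<times> 'a)|lball. 0)"
  proof (rule integral_cong_AE)
    show "AE z in lball. (LINT t:{0..2 * pi}|lborel. F (rot t z)) = 0"
      using der
    proof eventually_elim
      case (elim z)
      have "(LINT t:{0..2 * pi}|lborel. F (rot t z)) = \<Phi> (rot (2 * pi) z) - \<Phi> (rot 0 z)"
        using integral_FTC_Icc_real[of 0 "2 * pi" "\<lambda>t. \<Phi> (rot t z)" "\<lambda>t. F (rot t z)"] elim
        by (simp add: set_lebesgue_integral_def mult.commute continuous_on_eq_continuous_at)
      also have "\<dots> = 0" by (simp add: rot_def)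
      finally show ?case .
    qed
    show "(\<lambda>z. (LINT t:{0..2 * pi}|lborel. F (rot t z))) \<in> borel_measurable lball"
      by (rule borel_measurable_integrable[OF integral_lball_circle(2)[OF F]])
  qed simp
  finally show ?thesis by simp
qed

section \<open>Dirichlet integrals on the sphere\<close>

text \<open>Not normalized: by the cone measure this is the integral over the sphere divided by
  n.\<close>

definition sphere_mean :: "(real^'n \<Rightarrow> real) \<Rightarrow> real" where
  "sphere_mean q = (LINT x|lball. q (sgn x))"

text \<open>The argument carries the dimension. Only positivity of this number is used, as it
  cancels in every identity.\<close>

definition second_moment :: "'n::finite itself \<Rightarrow> real" where
  "second_moment _ = (LINT (z::(real^'n) \<times> (real^'n))|lball. (norm (snd z))\<^sup>2)"

text \<open>Exchanging the two vectors shows that twice the moment is the mean of |z|^2. On the ball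
  this dominates |z|^d with d = 2n, whose integral is known to be half the volume.\<close>

lemma second_moment_pos: "second_moment TYPE('n::finite) > 0"
proof -
  let ?E = "\<lambda>f. LINT (z::(real^'n) \<times> (real^'n))|lball. f z"
  have i1: "integrable lball (\<lambda>z::(real^'n) \<times> (real^'n). (norm (snd z))\<^sup>2)"
    and i2: "integrable lball (\<lambda>z::(real^'n) \<times> (real^'n). (norm (fst z))\<^sup>2)"
  proof -
    have "norm (fst z) \<le> 1 \<and> norm (snd z) \<le> 1" if "norm z \<le> 1" for z :: "(real^'n) \<times> (real^'n)"
      using norm_fst_le[of "fst z" "snd z"] norm_snd_le[of "snd z" "fst z"] that by simp
    then show "integrable lball (\<lambda>z::(real^'n) \<times> (real^'n). (norm (snd z))\<^sup>2)"
      "integrable lball (\<lambda>z::(real^'n) \<times> (real^'n). (norm (fst z))\<^sup>2)"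
      by (auto intro!: integrable_lballI[of _ 1] power_le_one)
  qed
  have "?E (\<lambda>z. (norm (fst z))\<^sup>2) = second_moment TYPE('n)"
    using integral_lball_swap[of "\<lambda>z::(real^'n) \<times> (real^'n). (norm (snd z))\<^sup>2"] by (simp add: second_moment_def)
  then have 2: "2 * second_moment TYPE('n) = ?E (\<lambda>z. (norm z)\<^sup>2)"
    using i1 i2 by (simp add: second_moment_def norm_prod_def)
  let ?d = "DIM((real^'n) \<times> (real^'n))"
  have "2 \<le> CARD('n) + CARD('n)" using zero_less_card_finite[where 'a = 'n] by linarith
  then have d: "2 \<le> ?d" by simp
  have "0 < ?E (\<lambda>z. norm z ^ ?d)"
    unfolding integral_lball_norm_power using measure_lball_pos by simp
  also have "\<dots> \<le> ?E (\<lambda>z. (norm z)\<^sup>2)"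
  proof (rule integral_mono_AE)
    show "integrable lball (\<lambda>z::(real^'n) \<times> (real^'n). norm z ^ ?d)"
      by (rule integrable_lballI[of _ 1]) (auto simp: power_le_one)
    show "integrable lball (\<lambda>z::(real^'n) \<times> (real^'n). (norm z)\<^sup>2)"
      by (rule integrable_lballI[of _ 1]) (auto simp: power_le_one)
    show "AE z in lball. norm (z::(real^'n) \<times> (real^'n)) ^ ?d \<le> (norm z)\<^sup>2"
      using AE_lball_cball by eventually_elim (use d in \<open>auto intro!: power_decreasing\<close>)
  qed
  finally show ?thesis using 2 by simp
qed

text \<open>The weights |y|^2 and |x|^2 yield the same factor because the ball is invariant under
  exchanging x and y.\<close>

lemma
  fixes q :: "real^'n \<Rightarrow> real"
  assumes q [measurable]: "q \<in> borel_measurable borel" and B: "\<And>u. norm u \<le> 1 \<Longrightarrow> \<bar>q u\<bar> \<le> B"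
  shows pair_mean_snd: "(LINT (z::(real^'n) \<times> (real^'n))|lball. q (sgn (fst z)) * (norm (snd z))\<^sup>2) * measure (lball :: (real^'n) measure) UNIV =
      second_moment TYPE('n) * sphere_mean q"
    and pair_mean_fst: "(LINT (z::(real^'n) \<times> (real^'n))|lball. q (sgn (fst z)) * (norm (fst z))\<^sup>2) * measure (lball :: (real^'n) measure) UNIV =
      second_moment TYPE('n) * sphere_mean q"
proof -
  have sq: "s\<^sup>2 \<le> 1" if "\<bar>s\<bar> \<le> 1" for s :: real using that by (simp add: abs_square_le_1)
  have m: "(\<lambda>p::real \<times> real. (snd p)\<^sup>2) \<in> borel_measurable borel" "(\<lambda>p::real \<times> real. (fst p)\<^sup>2) \<in> borel_measurable borel"
    by measurable
  show "(LINT (z::(real^'n) \<times> (real^'n))|lball. q (sgn (fst z)) * (norm (snd z))\<^sup>2) * measure (lball :: (real^'n) measure) UNIV =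
      second_moment TYPE('n) * sphere_mean q"
    using integral_lball_pair_polar[OF q m(1) B] sq by (simp add: second_moment_def sphere_mean_def)
  have "(LINT (z::(real^'n) \<times> (real^'n))|lball. (norm (fst z))\<^sup>2) = second_moment TYPE('n)"
    using integral_lball_swap[of "\<lambda>z::(real^'n) \<times> (real^'n). (norm (snd z))\<^sup>2"] by (simp add: second_moment_def)
  then show "(LINT (z::(real^'n) \<times> (real^'n))|lball. q (sgn (fst z)) * (norm (fst z))\<^sup>2) * measure (lball :: (real^'n) measure) UNIV =
      second_moment TYPE('n) * sphere_mean q"
    using integral_lball_pair_polar[OF q m(2) B] sq by (simp add: sphere_mean_def)
qed

lemma sphere_mean_add:
  fixes f g :: "real^'n \<Rightarrow> real"
  assumes f: "continuous_on (- {0}) f" and g: "continuous_on (- {0}) g"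
  shows "sphere_mean (\<lambda>u. f u + c * g u) = sphere_mean f + c * sphere_mean g"
proof -
  have "integrable lball (\<lambda>x. q (sgn x))" if q: "continuous_on (- {0}) q" for q :: "real^'n \<Rightarrow> real"
  proof -
    obtain B where B: "\<forall>u. norm u = 1 \<longrightarrow> \<bar>q u\<bar> \<le> B" using bounded_on_unit_sphere[OF q] by blast
    have [measurable]: "q \<in> borel_measurable borel" by (rule borel_measurable_off_zero[OF q])
    show ?thesis by (rule integrable_lballI[of _ B]) (use B in \<open>auto simp: norm_sgn\<close>)
  qed
  from this[OF f] this[OF g] show ?thesis by (simp add: sphere_mean_def)
qed

lemma sphere_mean_cong: "(\<And>u. norm u = 1 \<Longrightarrow> f u = g u) \<Longrightarrow> f \<in> borel_measurable borel \<Longrightarrow> g \<in> borel_measurable borel \<Longrightarrow>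
   sphere_mean f = sphere_mean g"
  unfolding sphere_mean_def
  by (rule integral_cong_AE) (use AE_lball_nonzero in \<open>auto simp: norm_sgn elim!: eventually_mono\<close>)

text \<open>Functions of degree one, C^1 off the origin, with gradient \<open>P\<close>;
  \<open>f_eq\<close> is Euler's relation. Instances are the support function, its odd part and
  linear functions.\<close>

locale homogeneous_fun =
  fixes f :: "real^'n \<Rightarrow> real" and P :: "real^'n \<Rightarrow> real^'n"
  assumes P_cont: "continuous_on (- {0}) P"
    and P_scale: "c > 0 \<Longrightarrow> x \<noteq> 0 \<Longrightarrow> P (c *\<^sub>R x) = P x"
    and f_eq: "x \<noteq> 0 \<Longrightarrow> f x = P x \<bullet> x" and f_0: "f 0 = 0"
    and f_der: "x \<noteq> 0 \<Longrightarrow> (f has_derivative (\<lambda>v. P x \<bullet> v)) (at x)"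
begin

lemma P_sgn: "x \<noteq> 0 \<Longrightarrow> P (sgn x) = P x"
  using P_scale[of "inverse (norm x)" x] by (simp add: sgn_div_norm)

lemma P_bounded: "\<exists>B\<ge>0. \<forall>x. norm (P x) \<le> B"
proof -
  have "continuous_on (- {0}) (\<lambda>x. norm (P x))" by (intro continuous_intros P_cont)
  from bounded_on_unit_sphere[OF this] obtain B where B: "\<forall>u. norm u = 1 \<longrightarrow> norm (P u) \<le> B" by auto
  have "norm (P x) \<le> max (norm (P 0)) B" for x
    using B[rule_format, of "sgn x"] P_sgn[of x] by (cases "x = 0") (auto simp: norm_sgn le_max_iff_disj)
  then show ?thesis by (intro exI[of _ "max (norm (P 0)) B"]) (auto simp: le_max_iff_disj)
qed

lemma f_scale: "c \<ge> 0 \<Longrightarrow> f (c *\<^sub>R x) = c * f x"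
  by (cases "x = 0 \<or> c = 0") (auto simp: f_0 f_eq P_scale)

lemma f_sgn: "f x = norm x * f (sgn x)"
  using f_scale[of "norm x" "sgn x"] by (cases "x = 0") (auto simp: sgn_div_norm f_0)

lemma f_le: "\<exists>B\<ge>0. \<forall>x. \<bar>f x\<bar> \<le> B * norm x"
proof -
  obtain B where B: "B \<ge> 0" "\<forall>x. norm (P x) \<le> B" using P_bounded by blast
  have "\<bar>f x\<bar> \<le> B * norm x" for x
  proof (cases "x = 0")
    case False
    have "\<bar>P x \<bullet> x\<bar> \<le> norm (P x) * norm x" by (rule Cauchy_Schwarz_ineq2)
    also have "\<dots> \<le> B * norm x" using B by (intro mult_right_mono) auto
    finally show ?thesis using False by (simp add: f_eq)
  qed (simp add: f_0)
  then show ?thesis using B by blast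
qed

lemma f_cont: "continuous_on S f"
proof (rule continuous_at_imp_continuous_on, rule ballI)
  fix x
  show "isCont f x"
  proof (cases "x = 0")
    case False
    then show ?thesis using f_der has_derivative_continuous by blast
  next
    case True
    obtain B where "\<forall>x. \<bar>f x\<bar> \<le> B * norm x" using f_le by blast
    then have "(f \<longlongrightarrow> 0) (at 0)"
      by (intro Lim_null_comparison[of f "\<lambda>y. B * norm y"]) (auto intro!: tendsto_eq_intros)
    then show ?thesis using True by (simp add: isCont_def f_0)
  qed
qed

lemma f_measurable: "f \<in> borel_measurable borel"
  by (rule borel_measurable_continuous_onI[OF f_cont])

lemma P_measurable: "P \<in> borel_measurable borel"
  by (rule borel_measurable_off_zero[OF P_cont])

text \<open>Up to a positive factor the integral of |\<nabla>f|^2 - (n-1) f^2 over the sphere,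
  written so that along a circle the integrand becomes \<phi>'^2 - \<phi>^2.\<close>

definition dirichlet :: real where
  "dirichlet = (LINT (z::(real^'n) \<times> (real^'n))|lball. (P (fst z) \<bullet> snd z)\<^sup>2 - (f (fst z))\<^sup>2)"

lemma
  shows grad_measurable: "(\<lambda>z::(real^'n) \<times> (real^'n). P (fst z) \<bullet> snd z) \<in> borel_measurable borel"
    and fun_measurable: "(\<lambda>z::(real^'n) \<times> (real^'n). f (fst z)) \<in> borel_measurable borel"
  using measurable_compose[OF borel_measurable_fst_snd(1) P_measurable]
    measurable_compose[OF borel_measurable_fst_snd(1) f_measurable] borel_measurable_fst_snd(2)
  by (auto intro!: borel_measurable_inner)

lemma fun_grad_bounded:
  "\<exists>B\<ge>0. \<forall>z::(real^'n) \<times> (real^'n). norm z \<le> 1 \<longrightarrow> \<bar>P (fst z) \<bullet> snd z\<bar> \<le> B \<and> \<bar>f (fst z)\<bar> \<le> B"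
proof -
  obtain B where B: "B \<ge> 0" "\<forall>x. norm (P x) \<le> B" using P_bounded by blast
  obtain C where C: "C \<ge> 0" "\<forall>x. \<bar>f x\<bar> \<le> C * norm x" using f_le by blast
  show ?thesis
  proof (intro exI[of _ "max B C"] conjI allI impI)
    fix z :: "(real^'n) \<times> (real^'n)" assume z: "norm z \<le> 1"
    then have z1: "norm (fst z) \<le> 1" "norm (snd z) \<le> 1"
      using norm_fst_le[of "fst z" "snd z"] norm_snd_le[of "snd z" "fst z"] by auto
    have "\<bar>P (fst z) \<bullet> snd z\<bar> \<le> norm (P (fst z)) * norm (snd z)" by (rule Cauchy_Schwarz_ineq2)
    also have "\<dots> \<le> B * 1" using B z1 by (intro mult_mono) auto
    finally show "\<bar>P (fst z) \<bullet> snd z\<bar> \<le> max B C" by simp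
    have "C * norm (fst z) \<le> C * 1" using C z1 by (intro mult_left_mono) auto
    then show "\<bar>f (fst z)\<bar> \<le> max B C" using C(2)[rule_format, of "fst z"] by simp
  qed (use B in auto)
qed

lemma sq_integrable:
  "integrable lball (\<lambda>z::(real^'n) \<times> (real^'n). (P (fst z) \<bullet> snd z)\<^sup>2)"
  "integrable lball (\<lambda>z::(real^'n) \<times> (real^'n). (f (fst z))\<^sup>2)"
proof -
  obtain B where B: "B \<ge> 0" "\<And>z::(real^'n) \<times> (real^'n). norm z \<le> 1 \<Longrightarrow> \<bar>P (fst z) \<bullet> snd z\<bar> \<le> B \<and> \<bar>f (fst z)\<bar> \<le> B"
    using fun_grad_bounded by blast
  have sq: "\<bar>a\<^sup>2\<bar> \<le> B\<^sup>2" if "\<bar>a\<bar> \<le> B" for a :: real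
    using that B(1) by (metis abs_ge_zero abs_power2 power2_abs power_mono)
  show "integrable lball (\<lambda>z::(real^'n) \<times> (real^'n). (P (fst z) \<bullet> snd z)\<^sup>2)"
    by (rule integrable_lballI[of _ "B\<^sup>2"]) (use B(2) sq grad_measurable in auto)
  show "integrable lball (\<lambda>z::(real^'n) \<times> (real^'n). (f (fst z))\<^sup>2)"
    by (rule integrable_lballI[of _ "B\<^sup>2"]) (use B(2) sq fun_measurable in auto)
qed

text \<open>Averaging over y turns <P, y>^2 into |P|^2 |y|^2 / n, while f(x)^2 is |x|^2 times its
  value at \<open>sgn x\<close>. As |x|^2 and |y|^2 have the same mean, f^2 acquires the factor n
  relative to |P|^2.\<close>

lemma dirichlet_sphere_mean:
  assumes n: "CARD('n) \<ge> 2"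
  shows "real CARD('n) * measure (lball :: (real^'n) measure) UNIV * dirichlet =
    second_moment TYPE('n) * sphere_mean (\<lambda>u. (norm (P u))\<^sup>2 - real CARD('n) * (f u)\<^sup>2)"
proof -
  let ?n = "real CARD('n)" and ?\<omega> = "measure (lball :: (real^'n) measure) UNIV"
  let ?E = "\<lambda>F. LINT (z::(real^'n) \<times> (real^'n))|lball. F z"
  obtain B where B: "B \<ge> 0" "\<And>x. norm (P x) \<le> B" using P_bounded by blast
  have Pi: "\<bar>P x $ i\<bar> \<le> B" for x i using component_le_norm_cart[of "P x" i] B(2)[of x] by linarith
  have Pm [measurable]: "(\<lambda>x. P x $ i) \<in> borel_measurable borel" for i
    by (rule borel_measurable_off_zero) (intro continuous_intros P_cont)
  have ne: "AE z in lball. fst (z::(real^'n) \<times> (real^'n)) \<noteq> 0"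
    using AE_lball_pair_independent[where 'a = "real^'n"] n by (auto elim!: eventually_mono)
  have 1: "?E (\<lambda>z. (P (fst z) \<bullet> snd z)\<^sup>2) * ?n = ?E (\<lambda>z. (norm (P (fst z)))\<^sup>2 * (norm (snd z))\<^sup>2)"
  proof -
    have "?E (\<lambda>z. (\<Sum>i\<in>UNIV. \<Sum>j\<in>UNIV. (P (fst z) $ i * P (fst z) $ j) * (snd z $ i * snd z $ j))) * ?n =
        ?E (\<lambda>z. (\<Sum>i\<in>UNIV. P (fst z) $ i * P (fst z) $ i) * (norm (snd z))\<^sup>2)"
      by (rule moment_quadratic[where m = "\<lambda>i j x. P x $ i * P x $ j" and B = "B * B"])
         (auto simp: abs_mult intro!: mult_mono Pi B)
    moreover have "(\<Sum>i\<in>UNIV. \<Sum>j\<in>UNIV. (P x $ i * P x $ j) * (y $ i * y $ j)) = (P x \<bullet> y)\<^sup>2" for x y :: "real^'n"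
      by (simp add: inner_vec_def power2_eq_square sum_product mult_ac)
    moreover have "(\<Sum>i\<in>UNIV. P x $ i * P x $ i) = (norm (P x))\<^sup>2" for x
      by (simp add: power2_norm_eq_inner inner_vec_def)
    ultimately show ?thesis by simp
  qed
  have qm: "(\<lambda>u. (norm (P u))\<^sup>2) \<in> borel_measurable borel" "(\<lambda>u. (f u)\<^sup>2) \<in> borel_measurable borel"
    using P_measurable f_measurable by measurable
  have 2: "?E (\<lambda>z. (norm (P (fst z)))\<^sup>2 * (norm (snd z))\<^sup>2) * ?\<omega> = second_moment TYPE('n) * sphere_mean (\<lambda>u. (norm (P u))\<^sup>2)"
  proof -
    have "?E (\<lambda>z. (norm (P (fst z)))\<^sup>2 * (norm (snd z))\<^sup>2) = ?E (\<lambda>z. (norm (P (sgn (fst z))))\<^sup>2 * (norm (snd z))\<^sup>2)"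
    proof (rule integral_cong_AE)
      have m1: "(\<lambda>z::(real^'n) \<times> (real^'n). P (fst z)) \<in> borel_measurable borel"
        by (rule measurable_compose[OF borel_measurable_fst_snd(1) P_measurable])
      have m2: "(\<lambda>z::(real^'n) \<times> (real^'n). P (sgn (fst z))) \<in> borel_measurable borel"
        by (rule measurable_compose[OF measurable_compose[OF borel_measurable_fst_snd(1) borel_measurable_sgn] P_measurable])
      show "(\<lambda>z::(real^'n) \<times> (real^'n). (norm (P (fst z)))\<^sup>2 * (norm (snd z))\<^sup>2) \<in> borel_measurable lball"
        "(\<lambda>z::(real^'n) \<times> (real^'n). (norm (P (sgn (fst z))))\<^sup>2 * (norm (snd z))\<^sup>2) \<in> borel_measurable lball"
        using m1 m2 by measurable
      show "AE z in lball. (norm (P (fst z)))\<^sup>2 * (norm (snd (z::(real^'n) \<times> (real^'n))))\<^sup>2 = (norm (P (sgn (fst z))))\<^sup>2 * (norm (snd z))\<^sup>2"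
        using ne by eventually_elim (simp add: P_sgn)
    qed
    then show ?thesis
      using pair_mean_snd[OF qm(1), of "B\<^sup>2"] B by (simp add: power_mono)
  qed
  obtain C where C: "C \<ge> 0" "\<And>x. \<bar>f x\<bar> \<le> C * norm x" using f_le by blast
  have 3: "?E (\<lambda>z. (f (fst z))\<^sup>2) * ?\<omega> = second_moment TYPE('n) * sphere_mean (\<lambda>u. (f u)\<^sup>2)"
  proof -
    have "?E (\<lambda>z. (f (fst z))\<^sup>2) = ?E (\<lambda>z. (f (sgn (fst z)))\<^sup>2 * (norm (fst z))\<^sup>2)"
      by (intro Bochner_Integration.integral_cong refl, subst f_sgn) (simp add: power_mult_distrib)
    moreover have "\<bar>(f u)\<^sup>2\<bar> \<le> C\<^sup>2" if "norm u \<le> 1" for u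
    proof -
      have "C * norm u \<le> C * 1" using C that by (intro mult_left_mono) auto
      then have "\<bar>f u\<bar> \<le> C" using C(2)[of u] by linarith
      then show ?thesis using power_mono[of "\<bar>f u\<bar>" C 2] by simp
    qed
    ultimately show ?thesis using pair_mean_fst[OF qm(2), of "C\<^sup>2"] by simp
  qed
  have "sphere_mean (\<lambda>u. (norm (P u))\<^sup>2 + (- ?n) * (f u)\<^sup>2) = sphere_mean (\<lambda>u. (norm (P u))\<^sup>2) + (- ?n) * sphere_mean (\<lambda>u. (f u)\<^sup>2)"
    by (rule sphere_mean_add) (intro continuous_intros P_cont f_cont)+
  then have s0: "sphere_mean (\<lambda>u. (norm (P u))\<^sup>2 - ?n * (f u)\<^sup>2) =
      sphere_mean (\<lambda>u. (norm (P u))\<^sup>2) - ?n * sphere_mean (\<lambda>u. (f u)\<^sup>2)" by simp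
  have s: "second_moment TYPE('n) * sphere_mean (\<lambda>u. (norm (P u))\<^sup>2 - ?n * (f u)\<^sup>2) =
      second_moment TYPE('n) * sphere_mean (\<lambda>u. (norm (P u))\<^sup>2) - ?n * (second_moment TYPE('n) * sphere_mean (\<lambda>u. (f u)\<^sup>2))"
    unfolding s0 by (simp add: algebra_simps)
  have d: "dirichlet = ?E (\<lambda>z. (P (fst z) \<bullet> snd z)\<^sup>2) - ?E (\<lambda>z. (f (fst z))\<^sup>2)"
    unfolding dirichlet_def by (rule Bochner_Integration.integral_diff[OF sq_integrable])
  have "?n * ?\<omega> * dirichlet = (?E (\<lambda>z. (P (fst z) \<bullet> snd z)\<^sup>2) * ?n) * ?\<omega> - ?n * (?E (\<lambda>z. (f (fst z))\<^sup>2) * ?\<omega>)"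
    unfolding d by (simp add: algebra_simps)
  then show ?thesis unfolding 1 2 3 s .
qed

lemma circle_der:
  assumes "fst (rot t z) \<noteq> 0"
  shows "((\<lambda>t. f (fst (rot t z))) has_real_derivative P (fst (rot t z)) \<bullet> snd (rot t z)) (at t)"
proof -
  have 1: "((\<lambda>t. fst (rot t z)) has_derivative (\<lambda>s. s *\<^sub>R snd (rot t z))) (at t)"
    using rot_derivs(1)[of z t] by (simp add: has_vector_derivative_def)
  from has_derivative_compose[OF 1 f_der[OF assms]]
  show ?thesis by (simp add: has_field_derivative_def mult.commute[of _ "_ \<bullet> _"] fun_eq_iff)
qed

lemma circle_cont:
  assumes "\<And>t. fst (rot t z) \<noteq> 0"
  shows "continuous_on S (\<lambda>t. P (fst (rot t z)))"
  by (rule continuous_on_compose2[OF P_cont continuous_on_rot(1)]) (use assms in auto)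

lemma AE_circle:
  assumes "CARD('n) \<ge> 2"
  shows "AE z in lball. \<forall>t. fst (rot t (z::(real^'n) \<times> (real^'n))) \<noteq> 0"
proof -
  have "AE z in lball. (fst z \<bullet> fst z) * (snd z \<bullet> snd z) \<noteq> (fst z \<bullet> snd (z::(real^'n) \<times> (real^'n)))\<^sup>2"
    by (rule AE_lball_pair_independent) (use assms in simp)
  then show ?thesis by eventually_elim (intro allI, rule fst_rot_nonzero)
qed

text \<open>Linear functions are eigenfunctions of the spherical Laplacian for n - 1, hence in the
  kernel of the form. Concretely, the increment \<open>F\<close> is exact: 2 f <a, y> differentiates
  to the cross terms and <a, x> <a, y> to the quadratic ones.\<close>

lemma dirichlet_shift:
  assumes n: "CARD('n) \<ge> 2"
  shows "(LINT (z::(real^'n) \<times> (real^'n))|lball. ((P (fst z) + a) \<bullet> snd z)\<^sup>2 - (f (fst z) + a \<bullet> fst z)\<^sup>2) = dirichlet"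
proof -
  define F where "F z = 2 * ((P (fst z) \<bullet> snd z) * (a \<bullet> snd z)) - 2 * (f (fst z) * (a \<bullet> fst z)) + ((a \<bullet> snd z)\<^sup>2 - (a \<bullet> fst z)\<^sup>2)"
    for z :: "(real^'n) \<times> (real^'n)"
  have Fm: "F \<in> borel_measurable borel"
    unfolding F_def[abs_def] using grad_measurable fun_measurable by measurable
  obtain B where B: "B \<ge> 0" "\<And>z::(real^'n) \<times> (real^'n). norm z \<le> 1 \<Longrightarrow> \<bar>P (fst z) \<bullet> snd z\<bar> \<le> B \<and> \<bar>f (fst z)\<bar> \<le> B"
    using fun_grad_bounded by blast
  have FB: "\<bar>F z\<bar> \<le> 4 * (B * norm a) + 2 * (norm a)\<^sup>2" if z: "norm z \<le> 1" for z
  proof -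
    have z1: "norm (fst z) \<le> 1" "norm (snd z) \<le> 1"
      using norm_fst_le[of "fst z" "snd z"] norm_snd_le[of "snd z" "fst z"] z by auto
    have a: "\<bar>a \<bullet> y\<bar> \<le> norm a" if "norm y \<le> 1" for y
    proof -
      have "\<bar>a \<bullet> y\<bar> \<le> norm a * norm y" by (rule Cauchy_Schwarz_ineq2)
      also have "\<dots> \<le> norm a * 1" using that by (intro mult_left_mono) auto
      finally show ?thesis by simp
    qed
    have 1: "\<bar>(P (fst z) \<bullet> snd z) * (a \<bullet> snd z)\<bar> \<le> B * norm a" "\<bar>f (fst z) * (a \<bullet> fst z)\<bar> \<le> B * norm a"
      unfolding abs_mult using B(2)[OF z] a z1 B(1) by (intro mult_mono; simp)+
    have 2: "(a \<bullet> snd z)\<^sup>2 \<le> (norm a)\<^sup>2" "(a \<bullet> fst z)\<^sup>2 \<le> (norm a)\<^sup>2"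
      using a z1 by (auto simp: abs_le_square_iff[symmetric])
    have 3: "0 \<le> (a \<bullet> snd z)\<^sup>2" "0 \<le> (a \<bullet> fst z)\<^sup>2" by simp_all
    show ?thesis using 1 2 3 unfolding F_def abs_le_iff by linarith
  qed
  have "(LINT z|lball. F z) = 0"
  proof (rule integral_lball_circle_exact[OF Fm FB, where \<Phi> = "\<lambda>z. 2 * (f (fst z) * (a \<bullet> snd z)) + (a \<bullet> fst z) * (a \<bullet> snd z)"])
    show "AE z in lball. (\<forall>t. ((\<lambda>t. 2 * (f (fst (rot t z)) * (a \<bullet> snd (rot t z))) + (a \<bullet> fst (rot t z)) * (a \<bullet> snd (rot t z)))
        has_real_derivative F (rot t z)) (at t)) \<and> continuous_on UNIV (\<lambda>t. F (rot t z))"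
      using AE_circle[OF n]
    proof eventually_elim
      case (elim z)
      have d1: "((\<lambda>t. a \<bullet> fst (rot t z)) has_real_derivative a \<bullet> snd (rot t z)) (at t)" for t
        using bounded_linear.has_vector_derivative[OF bounded_linear_inner_right rot_derivs(1), of a z t]
        by (simp add: has_real_derivative_iff_has_vector_derivative)
      have d2: "((\<lambda>t. a \<bullet> snd (rot t z)) has_real_derivative - (a \<bullet> fst (rot t z))) (at t)" for t
        using bounded_linear.has_vector_derivative[OF bounded_linear_inner_right rot_derivs(2), of a z t]
        by (simp add: has_real_derivative_iff_has_vector_derivative)
      have "((\<lambda>t. 2 * (f (fst (rot t z)) * (a \<bullet> snd (rot t z))) + (a \<bullet> fst (rot t z)) * (a \<bullet> snd (rot t z)))
        has_real_derivative F (rot t z)) (at t)" for t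
        using elim[rule_format, of t]
        by (auto intro!: derivative_eq_intros circle_der d1 d2 simp: F_def power2_eq_square algebra_simps)
      moreover have "continuous_on UNIV (\<lambda>t. F (rot t z))"
        unfolding F_def using elim
        by (intro continuous_intros circle_cont continuous_on_rot continuous_on_compose2[OF f_cont continuous_on_rot(1)]) auto
      ultimately show ?case by blast
    qed
  qed
  have iF: "integrable lball F" by (rule integrable_lballI[OF Fm FB])
  have "((P (fst z) + a) \<bullet> snd z)\<^sup>2 - (f (fst z) + a \<bullet> fst z)\<^sup>2 = ((P (fst z) \<bullet> snd z)\<^sup>2 - (f (fst z))\<^sup>2) + F z" for z
    by (simp add: F_def inner_add_left power2_eq_square algebra_simps)
  then have "(LINT (z::(real^'n) \<times> (real^'n))|lball. ((P (fst z) + a) \<bullet> snd z)\<^sup>2 - (f (fst z) + a \<bullet> fst z)\<^sup>2) =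
      (LINT z|lball. ((P (fst z) \<bullet> snd z)\<^sup>2 - (f (fst z))\<^sup>2) + F z)" by simp
  also have "\<dots> = dirichlet + (LINT z|lball. F z)"
    unfolding dirichlet_def
    by (rule Bochner_Integration.integral_add[OF Bochner_Integration.integrable_diff[OF sq_integrable] iF])
  finally show ?thesis using \<open>(LINT z|lball. F z) = 0\<close> by simp
qed

text \<open>Oddness makes \<open>f\<close> antiperiodic along each circle, so Wirtinger's inequality
  applies there. If the form vanishes, equality holds on almost every circle, which amounts to
  additivity of \<open>f\<close> for almost all pairs.\<close>

lemma dirichlet_odd:
  assumes n: "CARD('n) \<ge> 2" and odd: "\<And>x. f (- x) = - f x"
  shows "dirichlet \<ge> 0" and "dirichlet = 0 \<Longrightarrow> linear f"
proof -
  define F where "F z = (P (fst z) \<bullet> snd z)\<^sup>2 - (f (fst z))\<^sup>2" for z :: "(real^'n) \<times> (real^'n)"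
  define I where "I z = (LINT t:{0..2 * pi}|lborel. F (rot t z))" for z
  have Fm: "F \<in> borel_measurable borel"
    unfolding F_def[abs_def] using grad_measurable fun_measurable by measurable
  obtain B where B: "B \<ge> 0" "\<And>z::(real^'n) \<times> (real^'n). norm z \<le> 1 \<Longrightarrow> \<bar>P (fst z) \<bullet> snd z\<bar> \<le> B \<and> \<bar>f (fst z)\<bar> \<le> B"
    using fun_grad_bounded by blast
  have FB: "\<bar>F z\<bar> \<le> B\<^sup>2" if z: "norm z \<le> 1" for z
  proof -
    have "(P (fst z) \<bullet> snd z)\<^sup>2 \<le> B\<^sup>2" "(f (fst z))\<^sup>2 \<le> B\<^sup>2"
      using B(2)[OF z] B(1) by (auto simp: abs_le_square_iff[symmetric])
    moreover have "0 \<le> (P (fst z) \<bullet> snd z)\<^sup>2" "0 \<le> (f (fst z))\<^sup>2" by simp_all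
    ultimately show ?thesis unfolding F_def abs_le_iff by linarith
  qed
  have EI: "(LINT z|lball. I z) = 2 * pi * dirichlet" and Iint: "integrable lball I"
    using integral_lball_circle[OF Fm FB] by (simp_all add: I_def[abs_def] dirichlet_def F_def)
  have I: "AE z in lball. 0 \<le> I z \<and> (I z = 0 \<longrightarrow> f (fst z + snd z) = f (fst z) + f (snd z))"
    using AE_circle[OF n]
  proof eventually_elim
    case (elim z)
    let ?\<phi> = "\<lambda>t. f (fst (rot t z))" and ?\<phi>' = "\<lambda>t. P (fst (rot t z)) \<bullet> snd (rot t z)"
    have der: "(?\<phi> has_real_derivative ?\<phi>' t) (at t)" for t by (rule circle_der) (use elim in blast)
    have cont: "continuous_on UNIV ?\<phi>'" using elim by (intro continuous_intros circle_cont continuous_on_rot) auto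
    have anti: "?\<phi> (t + pi) = - ?\<phi> t" for t
    proof -
      have "fst (rot (t + pi) z) = - fst (rot t z)" by (simp add: rot_def)
      then show ?thesis by (simp add: odd)
    qed
    note w = wirtinger_antiperiodic[OF der cont anti]
    have "0 \<le> I z" using w(1) by (simp add: I_def F_def)
    moreover have "f (fst z + snd z) = f (fst z) + f (snd z)" if "I z = 0"
    proof -
      have e: "?\<phi> (pi / 4) = (?\<phi> 0 + ?\<phi> (pi / 2)) / sqrt 2" using w(2) that by (simp add: I_def F_def)
      \<comment> \<open>At pi/4 the curve passes through (x + y) / sqrt 2, so by homogeneity the
        relation from the equality case reads f(x + y) = f(x) + f(y).\<close>
      have r: "fst (rot 0 z) = fst z" "fst (rot (pi / 2) z) = snd z"
        "fst (rot (pi / 4) z) = (sqrt 2 / 2) *\<^sub>R (fst z + snd z)"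
        by (simp_all add: rot_def sin_45 cos_45 scaleR_add_right)
      have "(sqrt 2 / 2) * f (fst z + snd z) = (f (fst z) + f (snd z)) / sqrt 2"
        using e unfolding r by (simp only: f_scale real_sqrt_ge_0_iff divide_nonneg_nonneg zero_le_numeral)
      moreover have "sqrt 2 / 2 = 1 / sqrt (2::real)" by (simp add: field_simps)
      ultimately have "(1 / sqrt 2) * f (fst z + snd z) = (f (fst z) + f (snd z)) / sqrt 2" by (simp only:)
      then show ?thesis by simp
    qed
    ultimately show ?case by blast
  qed
  have "0 \<le> (LINT z|lball. I z)"
    by (rule integral_nonneg_AE) (use I in \<open>auto elim!: eventually_mono\<close>)
  then have "0 \<le> (2 * pi) * dirichlet" unfolding EI .
  then show "dirichlet \<ge> 0" using pi_gt_zero by (auto simp: zero_le_mult_iff)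
  assume "dirichlet = 0"
  then have "(LINT z|lball. I z) = 0" using EI by simp
  then have "AE z in lball. I z = 0"
    using integral_nonneg_eq_0_iff_AE[OF Iint] I by (auto elim!: eventually_mono)
  with I have "AE z in lball. f (fst z + snd z) = f (fst z) + f (snd z)"
    by eventually_elim auto
  then have ae: "AE z in lborel. z \<in> cball 0 1 \<longrightarrow> f (fst z + snd z) = f (fst z) + f (snd z)"
    unfolding lball_def by (subst (asm) AE_density) (auto simp: indicator_def elim!: eventually_mono)
  \<comment> \<open>By continuity additivity fails on an open set; an open null set is
    empty.\<close>
  define N where "N = {z. f (fst z + snd z) \<noteq> f (fst z) + f (snd z)} \<inter> ball (0 :: (real^'n) \<times> (real^'n)) 1"
  have "open {z :: (real^'n) \<times> (real^'n). f (fst z + snd z) \<noteq> f (fst z) + f (snd z)}"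
    by (intro open_Collect_neq continuous_intros continuous_on_compose2[OF f_cont[of UNIV]]) auto
  then have Nopen: "open N" unfolding N_def by (intro open_Int) auto
  have "N \<in> null_sets lborel"
    using ae Nopen by (subst AE_iff_null_sets) (auto simp: N_def elim!: eventually_mono)
  then have "negligible N" by (simp add: negligible_iff_null_sets null_sets_completionI)
  then have N: "N = {}" using open_not_negligible[OF Nopen] by blast
  have Nz: "f (fst z + snd z) = f (fst z) + f (snd z)" if "z \<in> ball 0 1" for z
    using N that unfolding N_def by blast
  have add: "f (x + y) = f x + f y" for x y
  proof -
    \<comment> \<open>Shrinks an arbitrary pair into the open unit ball; the factor cancels by
      homogeneity.\<close>
    define c where "c = 1 / (2 * (norm (x, y) + 1))"
    have c: "c > 0" unfolding c_def by (simp add: add_nonneg_pos)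
    have "norm (c *\<^sub>R (x, y)) < 1"
    proof -
      define r where "r = norm (x, y)"
      have r: "r \<ge> 0" by (simp add: r_def)
      have "norm (c *\<^sub>R (x, y)) = c * r" using c by (simp only: norm_scaleR abs_of_pos r_def)
      also have "\<dots> = r / (2 * (r + 1))" by (simp only: c_def r_def[symmetric]) simp
      also have "\<dots> < 1" using r by (simp add: divide_less_eq)
      finally show ?thesis .
    qed
    then have "c *\<^sub>R (x, y) \<in> ball 0 1" by simp
    then have "f (c *\<^sub>R x + c *\<^sub>R y) = f (c *\<^sub>R x) + f (c *\<^sub>R y)" using Nz[of "c *\<^sub>R (x, y)"] by simp
    moreover have "f (c *\<^sub>R x + c *\<^sub>R y) = c * f (x + y)" using c f_scale[of c "x + y"] by (simp add: scaleR_add_right)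
    ultimately have "c * f (x + y) = c * (f x + f y)" using c by (simp add: f_scale algebra_simps)
    then show ?thesis using c by simp
  qed
  show "linear f"
  proof (rule linearI)
    show "f (x + y) = f x + f y" for x y by (rule add)
    show "f (r *\<^sub>R x) = r *\<^sub>R f x" for r x
    proof (cases "r \<ge> 0")
      case False
      then have "f (- ((- r) *\<^sub>R x)) = - ((- r) * f x)" using f_scale[of "- r" x] odd by simp
      then show ?thesis by simp
    qed (simp add: f_scale)
  qed
qed

end

section \<open>Surface measure and spherical gradient\<close>

lemma integral_sphere_measure:
  fixes q :: "real^'n \<Rightarrow> real"
  assumes q: "q \<in> borel_measurable borel"
  shows "integral\<^sup>L sphere_measure q = real CARD('n) * sphere_mean q"
proof -
  let ?B = "cball 0 1 - {0 :: real^'n}"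
  let ?M = "scale_measure (of_nat CARD('n)) lborel :: (real^'n) measure"
  have B: "?B \<in> sets borel" by (intro sets.Diff) auto
  have im: "(\<lambda>x. indicator ?B x *\<^sub>R q (sgn x)) \<in> borel_measurable borel"
    by (intro borel_measurable_scaleR borel_measurable_indicator B measurable_compose[OF borel_measurable_sgn q])
  have im': "(\<lambda>x. indicator (cball 0 1) x *\<^sub>R q (sgn x)) \<in> borel_measurable borel"
    by (intro borel_measurable_scaleR borel_measurable_indicator_cball measurable_compose[OF borel_measurable_sgn q])
  have M: "?M = density lborel (\<lambda>_. ennreal (real CARD('n)))"
  proof (rule measure_eqI)
    fix X :: "(real^'n) set" assume "X \<in> sets ?M"
    then show "emeasure ?M X = emeasure (density lborel (\<lambda>_. ennreal (real CARD('n)))) X"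
      by (simp add: emeasure_density nn_integral_cmult ennreal_of_nat_eq_real_of_nat)
  qed simp
  have sgnm: "sgn \<in> restrict_space ?M ?B \<rightarrow>\<^sub>M restrict_space borel (sphere 0 1)"
  proof (rule measurable_restrict_space2)
    show "sgn \<in> space (restrict_space ?M ?B) \<rightarrow> sphere 0 1"
      by (auto simp: space_restrict_space norm_sgn)
    show "sgn \<in> borel_measurable (restrict_space ?M ?B)"
      by (rule measurable_restrict_space1) simp
  qed
  have "integral\<^sup>L sphere_measure q = (LINT x|restrict_space ?M ?B. q (sgn x))"
    unfolding sphere_measure_def by (rule integral_distr[OF sgnm measurable_restrict_space1[OF q]])
  also have "\<dots> = (LINT x|?M. indicator ?B x *\<^sub>R q (sgn x))"
    by (rule integral_restrict_space) (use B in simp)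
  also have "\<dots> = (LINT x|lborel. real CARD('n) *\<^sub>R (indicator ?B x *\<^sub>R q (sgn x)))"
    unfolding M by (rule integral_density) (use im in auto)
  also have "\<dots> = real CARD('n) * (LINT x|lborel. indicator ?B x *\<^sub>R q (sgn x))" by simp
  also have "(LINT x|lborel. indicator ?B x *\<^sub>R q (sgn x)) = (LINT x:cball 0 1|lborel. q (sgn x))"
    unfolding set_lebesgue_integral_def
  proof (rule integral_cong_AE)
    show "AE x in lborel. indicator ?B x *\<^sub>R q (sgn x) = indicator (cball 0 1) x *\<^sub>R q (sgn x)"
      using AE_lborel_singleton[of "0::real^'n"] by eventually_elim (simp add: indicator_def)
  qed (use im im' in simp_all)
  also have "\<dots> = sphere_mean q"
    unfolding sphere_mean_def by (rule integral_lball[symmetric]) (use q in measurable)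
  finally show ?thesis .
qed

context homogeneous_fun
begin

text \<open>The tangential part of \<open>P u\<close>, since
  \<open>P u \<bullet> u = f u\<close>.\<close>

lemma sphere_gradient_eq:
  assumes u: "norm u = 1"
  shows "sphere_gradient f u = P u - f u *\<^sub>R u"
  unfolding sphere_gradient_def
proof (rule the_equality)
  have u0: "u \<noteq> 0" using u by auto
  have fu: "P u \<bullet> u = f u" using f_eq[OF u0] by simp
  have uu: "u \<bullet> u = 1" using u by (simp add: dot_square_norm)
  define w where "w = P u - f u *\<^sub>R u"
  \<comment> \<open>The subtracted function vanishes on the sphere and has gradient
    \<open>f u *\<^sub>R u\<close> at \<open>u\<close>: it removes the normal component without
    changing values on the sphere.\<close>
  have "((\<lambda>y. f y - f u * (y \<bullet> y - 1) / 2) has_derivative (\<lambda>h. w \<bullet> h)) (at u within sphere 0 1)"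
    using has_derivative_at_withinI[OF f_der[OF u0], of "sphere 0 1"]
    by (auto intro!: derivative_eq_intros simp: w_def inner_diff_left inner_diff_right inner_commute field_simps)
  then have wd: "(f has_derivative (\<lambda>h. w \<bullet> h)) (at u within sphere 0 1)"
    by (rule has_derivative_transform[rotated 2]) (use u in \<open>auto simp: dot_square_norm\<close>)
  show "(P u - f u *\<^sub>R u) \<bullet> u = 0 \<and> (f has_derivative (\<lambda>h. (P u - f u *\<^sub>R u) \<bullet> h)) (at u within sphere 0 1)"
    using wd by (simp add: w_def inner_diff_left fu uu)
  \<comment> \<open>A great circle stays in the sphere, so a derivative within the sphere can be
    evaluated on its tangent \<open>e\<close>; this determines a tangent gradient.\<close>
  have dir: "((\<lambda>t. f (cos t *\<^sub>R u + sin t *\<^sub>R e)) has_derivative (\<lambda>s. d \<bullet> (s *\<^sub>R e))) (at 0)"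
    if d: "(f has_derivative (\<lambda>h. d \<bullet> h)) (at u within sphere 0 1)" and e: "norm e = 1" "e \<bullet> u = 0" for d e
  proof -
    let ?c = "\<lambda>t. cos t *\<^sub>R u + sin t *\<^sub>R e"
    have c: "(?c has_derivative (\<lambda>s. s *\<^sub>R e)) (at 0)" by (auto intro!: derivative_eq_intros)
    have "norm (?c t) = 1" for t
    proof -
      have "?c t \<bullet> ?c t = (sin t)\<^sup>2 * (e \<bullet> e) + (cos t)\<^sup>2 * (u \<bullet> u)"
        using e(2) by (simp add: inner_add inner_commute power2_eq_square)
      also have "\<dots> = 1" using e(1) uu by (simp add: norm_eq_1)
      finally show ?thesis by (simp add: norm_eq_1)
    qed
    then have "range ?c \<subseteq> sphere 0 1" by auto
    then have "(f has_derivative (\<lambda>h. d \<bullet> h)) (at (?c 0) within range ?c)"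
      using has_derivative_subset[OF d] by simp
    from has_derivative_in_compose[OF c this] show ?thesis .
  qed
  fix w' assume w': "w' \<bullet> u = 0 \<and> (f has_derivative (\<lambda>h. w' \<bullet> h)) (at u within sphere 0 1)"
  have "w' = w"
  proof (rule ccontr)
    assume ne: "w' \<noteq> w"
    define e where "e = sgn (w' - w)"
    have "w \<bullet> u = 0" by (simp add: w_def inner_diff_left fu uu)
    then have e: "norm e = 1" "e \<bullet> u = 0" using ne w' by (auto simp: e_def norm_sgn sgn_div_norm inner_diff_left)
    have "(\<lambda>s. w' \<bullet> (s *\<^sub>R e)) = (\<lambda>s. w \<bullet> (s *\<^sub>R e))"
      using has_derivative_unique[OF dir[OF _ e, of w'] dir[OF wd e]] w' by blast
    then have "w' \<bullet> (1 *\<^sub>R e) = w \<bullet> (1 *\<^sub>R e)" by (rule fun_cong)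
    then have "(w' - w) \<bullet> sgn (w' - w) = 0" by (simp add: e_def inner_diff_left)
    then show False using ne by (simp add: sgn_div_norm)
  qed
  then show "w' = P u - f u *\<^sub>R u" by (simp add: w_def)
qed

end

section \<open>Green's formula for the support function\<close>

lemma (in smooth_body) homogeneous_fun_h: "homogeneous_fun h p"
  by standard (simp_all add: p_cont p_scale h_eq h_der)

lemma (in smooth_body) homogeneous_fun_h_odd: "homogeneous_fun (h_odd K) (\<lambda>x. (1 / 2) *\<^sub>R (p x + p (- x)))"
proof
  show "continuous_on (- {0}) (\<lambda>x. (1 / 2) *\<^sub>R (p x + p (- x)))"
    by (intro continuous_intros p_cont continuous_on_compose2[OF p_cont]) auto
  show "(1 / 2) *\<^sub>R (p (c *\<^sub>R x) + p (- (c *\<^sub>R x))) = (1 / 2) *\<^sub>R (p x + p (- x))" if "c > 0" for c x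
    using p_scale[OF that, of x] p_scale[OF that, of "- x"] by simp
  show "h_odd K x = (1 / 2) *\<^sub>R (p x + p (- x)) \<bullet> x" if "x \<noteq> 0" for x
    using that by (simp add: h_odd_def h_eq inner_add_left)
  show "h_odd K 0 = 0" by (simp add: h_odd_def)
  show "(h_odd K has_derivative (\<lambda>v. (1 / 2) *\<^sub>R (p x + p (- x)) \<bullet> v)) (at x)" if "x \<noteq> 0" for x
  proof -
    have "((\<lambda>y. h (- y)) has_derivative (\<lambda>v. p (- x) \<bullet> (- v))) (at x)"
      by (rule has_derivative_compose[of uminus uminus x UNIV h "\<lambda>v. p (- x) \<bullet> v"])
         (use h_der[of "- x"] that in \<open>auto intro!: derivative_eq_intros\<close>)
    from has_derivative_diff[OF h_der[OF that] this]
    have "((\<lambda>y. h y - h (- y)) has_derivative (\<lambda>v. p x \<bullet> v - p (- x) \<bullet> (- v))) (at x)" .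
    from has_derivative_scaleR_right[OF this, of "1/2"]
    show ?thesis by (simp add: h_odd_def[abs_def] inner_add_left add_divide_distrib)
  qed
qed

text \<open>On the sphere tr A is \<Delta>h + (n-1) h, so this is Green's formula. Along a circle h
  <p, y> has derivative <p, y>^2 + h <A y, y> - h^2, and this integrates to zero.\<close>

lemma (in smooth_body) sphere_mean_trace:
  assumes n: "CARD('n) \<ge> 2"
  shows "sphere_mean (\<lambda>u. h u * trace (A u)) = - sphere_mean (\<lambda>u. (norm (p u))\<^sup>2 - real CARD('n) * (h u)\<^sup>2)"
proof -
  interpret H: homogeneous_fun h p by (rule homogeneous_fun_h)
  let ?n = "real CARD('n)" and ?\<omega> = "measure (lball :: (real^'n) measure) UNIV"
  let ?E = "\<lambda>F. LINT (z::(real^'n) \<times> (real^'n))|lball. F z"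
  define m where "m i j x = h x * A x $ i $ j" for i j x
  \<comment> \<open>\<open>h\<close> has degree 1 and \<open>A\<close> degree -1, so the product has
    degree 0 and is bounded although \<open>A\<close> blows up at the origin.\<close>
  have m_sgn: "m i j x = m i j (sgn x)" if "x \<noteq> 0" for i j x
  proof -
    have "A x = A (norm x *\<^sub>R sgn x)" using that by (simp add: sgn_div_norm)
    also have "\<dots> = (1 / norm x) *\<^sub>R A (sgn x)" using that by (intro A_scale) (auto simp: sgn_zero_iff)
    finally show ?thesis using H.f_sgn[of x] that by (simp add: m_def)
  qed
  have mc: "continuous_on (- {0}) (m i j)" for i j
    unfolding m_def by (intro continuous_intros H.f_cont A_cont)
  have mm [measurable]: "m i j \<in> borel_measurable borel" for i j by (rule borel_measurable_off_zero[OF mc])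
  have "continuous_on (- {0}) (\<lambda>u. \<Sum>i\<in>UNIV. \<Sum>j\<in>UNIV. \<bar>m i j u\<bar>)" by (intro continuous_intros mc)
  from bounded_on_unit_sphere[OF this] obtain B
    where B0: "\<forall>u. norm u = 1 \<longrightarrow> \<bar>\<Sum>i\<in>UNIV. \<Sum>j\<in>UNIV. \<bar>m i j u\<bar>\<bar> \<le> B" by blast
  have B: "(\<Sum>i\<in>UNIV. \<Sum>j\<in>UNIV. \<bar>m i j u\<bar>) \<le> B" if "norm u = 1" for u
    using B0[rule_format, OF that] by (rule abs_le_D1)
  have sumB: "(\<Sum>i\<in>UNIV. \<Sum>j\<in>UNIV. \<bar>m i j x\<bar>) \<le> \<bar>B\<bar>" for x
  proof (cases "x = 0")
    case False
    then have "(\<Sum>i\<in>UNIV. \<Sum>j\<in>UNIV. \<bar>m i j (sgn x)\<bar>) \<le> B" by (intro B) (simp add: norm_sgn)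
    then show ?thesis using m_sgn[OF False] by simp
  qed (simp add: m_def)
  have mB: "\<bar>m i j x\<bar> \<le> \<bar>B\<bar>" for i j x
  proof -
    have "\<bar>m i j x\<bar> \<le> (\<Sum>j\<in>UNIV. \<bar>m i j x\<bar>)" by (rule member_le_sum) auto
    also have "\<dots> \<le> (\<Sum>i\<in>UNIV. \<Sum>j\<in>UNIV. \<bar>m i j x\<bar>)"
      by (rule member_le_sum[of i UNIV "\<lambda>i. \<Sum>j\<in>UNIV. \<bar>m i j x\<bar>"]) (auto intro: sum_nonneg)
    finally show ?thesis using sumB[of x] by linarith
  qed
  define Q where "Q z = (\<Sum>i\<in>UNIV. \<Sum>j\<in>UNIV. m i j (fst z) * (snd z $ i * snd z $ j))" for z :: "(real^'n) \<times> (real^'n)"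
  have Q: "Q z = h (fst z) * (snd z \<bullet> (A (fst z) *v snd z))" for z
    by (simp add: Q_def m_def inner_vec_def matrix_vector_mult_def sum_distrib_left mult_ac)
  have nth: "(\<lambda>z::(real^'n) \<times> (real^'n). snd z $ k) \<in> borel_measurable borel" for k
    by (intro borel_measurable_continuous_onI continuous_intros)
  have Qm: "Q \<in> borel_measurable borel"
    unfolding Q_def[abs_def]
    by (intro borel_measurable_sum borel_measurable_times nth measurable_compose[OF borel_measurable_fst_snd(1) mm])
  have QB: "\<bar>Q z\<bar> \<le> \<bar>B\<bar>" if "norm z \<le> 1" for z
  proof -
    have 1: "\<bar>snd z $ k\<bar> \<le> 1" for k
      using component_le_norm_cart[of "snd z" k] norm_snd_le[of "snd z" "fst z"] that by simp
    have "\<bar>Q z\<bar> \<le> (\<Sum>i\<in>UNIV. \<Sum>j\<in>UNIV. \<bar>m i j (fst z) * (snd z $ i * snd z $ j)\<bar>)"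
      unfolding Q_def by (intro order_trans[OF sum_abs] sum_mono sum_abs)
    also have "\<dots> \<le> (\<Sum>i\<in>UNIV. \<Sum>j\<in>UNIV. \<bar>m i j (fst z)\<bar>)"
    proof (intro sum_mono)
      fix i j
      have "\<bar>m i j (fst z)\<bar> * (\<bar>snd z $ i\<bar> * \<bar>snd z $ j\<bar>) \<le> \<bar>m i j (fst z)\<bar> * (1 * 1)"
        using 1 by (intro mult_left_mono mult_mono) auto
      then show "\<bar>m i j (fst z) * (snd z $ i * snd z $ j)\<bar> \<le> \<bar>m i j (fst z)\<bar>" by (simp add: abs_mult)
    qed
    finally show ?thesis using sumB[of "fst z"] by linarith
  qed
  define D where "D z = (p (fst z) \<bullet> snd z)\<^sup>2 - (h (fst z))\<^sup>2" for z :: "(real^'n) \<times> (real^'n)"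
  have Dint: "integrable lball D"
    unfolding D_def[abs_def] by (rule Bochner_Integration.integrable_diff[OF H.sq_integrable])
  have Dm: "D \<in> borel_measurable borel"
    unfolding D_def[abs_def] using H.grad_measurable H.fun_measurable by measurable
  obtain C where C: "C \<ge> 0" "\<And>z::(real^'n) \<times> (real^'n). norm z \<le> 1 \<Longrightarrow> \<bar>p (fst z) \<bullet> snd z\<bar> \<le> C \<and> \<bar>h (fst z)\<bar> \<le> C"
    using H.fun_grad_bounded by blast
  have DB: "\<bar>D z\<bar> \<le> C\<^sup>2" if z: "norm z \<le> 1" for z
  proof -
    have "(p (fst z) \<bullet> snd z)\<^sup>2 \<le> C\<^sup>2" "(h (fst z))\<^sup>2 \<le> C\<^sup>2"
      using C(2)[OF z] C(1) by (auto simp: abs_le_square_iff[symmetric])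
    moreover have "0 \<le> (p (fst z) \<bullet> snd z)\<^sup>2" "0 \<le> (h (fst z))\<^sup>2" by simp_all
    ultimately show ?thesis unfolding D_def abs_le_iff by linarith
  qed
  have "(LINT z|lball. Q z + D z) = 0"
  proof (rule integral_lball_circle_exact[where B = "\<bar>B\<bar> + C\<^sup>2" and \<Phi> = "\<lambda>z. h (fst z) * (p (fst z) \<bullet> snd z)"])
    show "(\<lambda>z. Q z + D z) \<in> borel_measurable borel" by (intro borel_measurable_add Qm Dm)
    show "\<bar>Q z + D z\<bar> \<le> \<bar>B\<bar> + C\<^sup>2" if "norm z \<le> 1" for z
      using QB[OF that] DB[OF that] abs_triangle_ineq[of "Q z" "D z"] by linarith
    show "AE z in lball. (\<forall>t. ((\<lambda>t. h (fst (rot t z)) * (p (fst (rot t z)) \<bullet> snd (rot t z))) has_real_derivative Q (rot t z) + D (rot t z)) (at t)) \<and>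
      continuous_on UNIV (\<lambda>t. Q (rot t z) + D (rot t z))"
      using H.AE_circle[OF n]
    proof eventually_elim
      case (elim z)
      have "((\<lambda>t. h (fst (rot t z)) * (p (fst (rot t z)) \<bullet> snd (rot t z))) has_real_derivative Q (rot t z) + D (rot t z)) (at t)" for t
      proof -
        let ?x = "fst (rot t z)" and ?y = "snd (rot t z)"
        have nz: "?x \<noteq> 0" using elim by blast
        have d1: "((\<lambda>t. fst (rot t z)) has_derivative (\<lambda>s. s *\<^sub>R ?y)) (at t)"
          using rot_derivs(1)[of z t] by (simp add: has_vector_derivative_def)
        have d2: "((\<lambda>t. snd (rot t z)) has_derivative (\<lambda>s. s *\<^sub>R - ?x)) (at t)"
          using rot_derivs(2)[of z t] by (simp add: has_vector_derivative_def)
        have "((\<lambda>t. p (fst (rot t z)) \<bullet> snd (rot t z)) has_derivative (\<lambda>s. p ?x \<bullet> (s *\<^sub>R - ?x) + (A ?x *v (s *\<^sub>R ?y)) \<bullet> ?y)) (at t)"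
          by (rule has_derivative_inner[OF has_derivative_compose[OF d1 p_der[OF nz]] d2])
        moreover have "(\<lambda>s. p ?x \<bullet> (s *\<^sub>R - ?x) + (A ?x *v (s *\<^sub>R ?y)) \<bullet> ?y) = (*) (?y \<bullet> (A ?x *v ?y) - h ?x)"
          by (rule ext) (simp add: h_eq[OF nz] matrix_vector_mult_scaleR inner_commute algebra_simps)
        ultimately have d3: "((\<lambda>t. p (fst (rot t z)) \<bullet> snd (rot t z)) has_real_derivative ?y \<bullet> (A ?x *v ?y) - h ?x) (at t)"
          by (simp only: has_field_derivative_def)
        from DERIV_mult[OF H.circle_der[OF nz] d3]
        show ?thesis by (rule DERIV_cong) (simp add: Q D_def power2_eq_square algebra_simps)
      qed
      moreover have "continuous_on UNIV (\<lambda>t. Q (rot t z) + D (rot t z))"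
      proof -
        have "continuous_on UNIV (\<lambda>t. m i j (fst (rot t z)))" for i j
          by (rule continuous_on_compose2[OF mc continuous_on_rot(1)]) (use elim in auto)
        then show ?thesis
          unfolding Q_def D_def using elim
          by (intro continuous_intros H.circle_cont continuous_on_rot continuous_on_compose2[OF H.f_cont continuous_on_rot(1)]) auto
      qed
      ultimately show ?case by blast
    qed
  qed
  moreover have "integrable lball Q" by (rule integrable_lballI[OF Qm QB])
  ultimately have E: "?E Q = - H.dirichlet"
    using Dint by (simp add: H.dirichlet_def flip: D_def)
  have "?E Q * ?n = ?E (\<lambda>z. (\<Sum>i\<in>UNIV. m i i (fst z)) * (norm (snd z))\<^sup>2)"
    unfolding Q_def by (rule moment_quadratic[OF mm mB])
  also have "\<dots> = ?E (\<lambda>z. (\<Sum>i\<in>UNIV. m i i (sgn (fst z))) * (norm (snd z))\<^sup>2)"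
  proof (rule integral_cong_AE)
    show "AE z in lball. (\<Sum>i\<in>UNIV. m i i (fst z)) * (norm (snd (z::(real^'n) \<times> (real^'n))))\<^sup>2 = (\<Sum>i\<in>UNIV. m i i (sgn (fst z))) * (norm (snd z))\<^sup>2"
      using H.AE_circle[OF n]
    proof eventually_elim
      case (elim z)
      have "fst z \<noteq> 0" using elim[rule_format, of 0] by (simp add: rot_def)
      then show ?case using m_sgn by simp
    qed
    have mf: "(\<lambda>z::(real^'n) \<times> (real^'n). m i i (fst z)) \<in> borel_measurable borel"
      "(\<lambda>z::(real^'n) \<times> (real^'n). m i i (sgn (fst z))) \<in> borel_measurable borel" for i
      by (rule measurable_compose[OF borel_measurable_fst_snd(1) mm],
          rule measurable_compose[OF measurable_compose[OF borel_measurable_fst_snd(1) borel_measurable_sgn] mm])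
    show "(\<lambda>z::(real^'n) \<times> (real^'n). (\<Sum>i\<in>UNIV. m i i (fst z)) * (norm (snd z))\<^sup>2) \<in> borel_measurable lball"
      "(\<lambda>z::(real^'n) \<times> (real^'n). (\<Sum>i\<in>UNIV. m i i (sgn (fst z))) * (norm (snd z))\<^sup>2) \<in> borel_measurable lball"
      using mf by measurable
  qed
  also have "\<dots> * ?\<omega> = second_moment TYPE('n) * sphere_mean (\<lambda>u. \<Sum>i\<in>UNIV. m i i u)"
  proof (rule pair_mean_snd)
    show "\<bar>\<Sum>i\<in>UNIV. m i i u\<bar> \<le> ?n * \<bar>B\<bar>" for u
    proof -
      have "\<bar>\<Sum>i\<in>UNIV. m i i u\<bar> \<le> (\<Sum>i\<in>(UNIV::'n set). \<bar>B\<bar>)"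
        by (rule order_trans[OF sum_abs sum_mono]) (rule mB)
      then show ?thesis by simp
    qed
  qed measurable
  also have "(\<lambda>u. \<Sum>i\<in>UNIV. m i i u) = (\<lambda>u. h u * trace (A u))"
    by (simp add: m_def trace_def sum_distrib_left)
  finally have 1: "?E Q * ?n * ?\<omega> = second_moment TYPE('n) * sphere_mean (\<lambda>u. h u * trace (A u))" .
  have "second_moment TYPE('n) * sphere_mean (\<lambda>u. h u * trace (A u)) = - (?n * ?\<omega> * H.dirichlet)"
    unfolding 1[symmetric] E by (simp add: algebra_simps)
  also have "\<dots> = second_moment TYPE('n) * - sphere_mean (\<lambda>u. (norm (p u))\<^sup>2 - ?n * (h u)\<^sup>2)"
    unfolding H.dirichlet_sphere_mean[OF n] by simp
  finally show ?thesis
    by (rule mult_left_cancel[THEN iffD1, rotated]) (use second_moment_pos[where 'n = 'n] in simp)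
qed

section \<open>The asymmetry functional\<close>

lemma (in smooth_body) mem_body:
  assumes "\<And>u. norm u = 1 \<Longrightarrow> z \<bullet> u \<le> h u"
  shows "z \<in> K"
proof (rule ccontr)
  assume "z \<notin> K"
  then obtain a b where ab: "a \<bullet> z < b" "\<forall>x\<in>K. a \<bullet> x > b"
    using separating_hyperplane_closed_point[OF convex_body compact_imp_closed[OF compact_body]] by blast
  have a: "a \<noteq> 0" using ab body_nonempty by force
  define u where "u = - sgn a"
  have u: "norm u = 1" "u \<noteq> 0" using a by (auto simp: u_def norm_sgn sgn_zero_iff)
  have "norm a * (sgn a \<bullet> z) < norm a * (sgn a \<bullet> p u)"
    using ab p_in[OF u(2)] a by (simp add: sgn_div_norm) force
  then have "p u \<bullet> u < z \<bullet> u" using a by (simp add: u_def inner_commute)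
  then show False using assms[OF u(1)] h_eq[OF u(2)] by simp
qed

text \<open>If h_odd is <b, u>, then h(u) = h(-u) + 2 <b, u> says that \<open>K\<close> and its
  reflection in the point \<open>b\<close> have the same support function, so \<open>b\<close> is
  the centre. Conversely, symmetry of a + K makes h_odd equal to -<a, u>.\<close>

lemma (in smooth_body) h_odd_linear_iff:
  "(\<exists>f::real^'n \<Rightarrow> real. linear f \<and> (\<forall>u\<in>sphere 0 1. h_odd K u = f u)) \<longleftrightarrow>
    centrally_symmetric_up_to_translation K"
proof
  assume "\<exists>f::real^'n \<Rightarrow> real. linear f \<and> (\<forall>u\<in>sphere 0 1. h_odd K u = f u)"
  then obtain f :: "real^'n \<Rightarrow> real" where f: "linear f" "\<And>u. norm u = 1 \<Longrightarrow> h_odd K u = f u" by auto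
  define b where "b = adjoint f 1"
  have fb: "f u = b \<bullet> u" for u using adjoint_works[OF f(1), of u 1] by (simp add: b_def inner_commute)
  have refl: "2 *\<^sub>R b - k \<in> K" if k: "k \<in> K" for k
  proof (rule mem_body)
    fix u :: "real^'n" assume u: "norm u = 1"
    have "h u - h (- u) = 2 * (b \<bullet> u)" using f(2)[OF u] by (simp add: h_odd_def fb field_simps)
    moreover have "k \<bullet> (- u) \<le> h (- u)" by (rule inner_le_h[OF k])
    ultimately show "(2 *\<^sub>R b - k) \<bullet> u \<le> h u" by (simp add: inner_diff_left)
  qed
  have sub: "y \<in> uminus ` (+) (- b) ` K" if "y \<in> (+) (- b) ` K" for y
  proof -
    obtain k where k: "k \<in> K" "y = - b + k" using \<open>y \<in> (+) (- b) ` K\<close> by blast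
    have "y = - (- b + (2 *\<^sub>R b - k))" by (simp add: k scaleR_2)
    then show ?thesis using refl[OF k(1)] by blast
  qed
  have "(+) (- b) ` K = uminus ` (+) (- b) ` K"
  proof (intro equalityI subsetI)
    fix y assume "y \<in> uminus ` (+) (- b) ` K"
    then obtain x where x: "x \<in> (+) (- b) ` K" "y = - x" by blast
    from sub[OF x(1)] obtain x' where "x' \<in> (+) (- b) ` K" "x = - x'" by blast
    then show "y \<in> (+) (- b) ` K" using x(2) by simp
  qed (rule sub)
  then show "centrally_symmetric_up_to_translation K"
    unfolding centrally_symmetric_up_to_translation_def by blast
next
  assume "centrally_symmetric_up_to_translation K"
  then obtain a where a: "(+) a ` K = uminus ` (+) a ` K"
    by (auto simp: centrally_symmetric_up_to_translation_def)
  have le: "h u \<le> h (- u) - 2 * (a \<bullet> u)" if "u \<noteq> 0" for u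
  proof -
    have "a + p u \<in> uminus ` (+) a ` K" using a p_in[OF that] by blast
    then obtain k where k: "k \<in> K" "a + p u = - (a + k)" by blast
    have "p u = (a + p u) - a" by simp
    also have "\<dots> = - k - 2 *\<^sub>R a" unfolding k(2) by (simp add: scaleR_2)
    finally have "p u = - k - 2 *\<^sub>R a" .
    then have "p u \<bullet> u = k \<bullet> (- u) - 2 * (a \<bullet> u)" by (simp add: inner_diff_left)
    then show ?thesis using inner_le_h[OF k(1), of "- u"] h_eq[OF that] by simp
  qed
  have "h_odd K u = - (a \<bullet> u)" if "u \<in> sphere 0 1" for u
  proof -
    have "u \<noteq> 0" using that by auto
    then show ?thesis using le[of u] le[of "- u"] by (simp add: h_odd_def)
  qed
  moreover have "linear (\<lambda>u. - (a \<bullet> u))" by (rule linearI) (simp_all add: inner_add_right)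
  ultimately show "\<exists>f::real^'n \<Rightarrow> real. linear f \<and> (\<forall>u\<in>sphere 0 1. h_odd K u = f u)" by blast
qed

lemma (in smooth_body) smooth_body_translate: "smooth_body ((+) (- a) ` K) (\<lambda>x. p x - a) A"
proof
  show "compact ((+) (- a) ` K)" by (rule compact_translation[OF compact_body])
  show "convex ((+) (- a) ` K)" by (rule convex_translation[OF convex_body])
  show "contact_point ((+) (- a) ` K) x (p x - a)" if "x \<noteq> 0" for x
    using contact[OF that] by (auto simp: contact_point_def inner_add_left inner_diff_left image_iff)
  show "((\<lambda>x. p x - a) has_derivative (\<lambda>v. A x *v v)) (at x)" if "x \<noteq> 0" for x
    using has_derivative_diff[OF p_der[OF that] has_derivative_const[of a]] by simp
qed (rule A_cont)

lemma central_symmetral_translate: "central_symmetral ((+) (- a) ` K) = central_symmetral K"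
proof -
  have "(+) (- a) ` K + uminus ` (+) (- a) ` K = K + uminus ` K"
    unfolding set_plus_def by (auto simp: algebra_simps)
  then show ?thesis by (simp add: central_symmetral_def)
qed

context smooth_body0
begin

lemma quermassintegral_sphere_mean:
  assumes n: "CARD('n) \<ge> 2"
  shows "quermassintegral (CARD('n) - 2) K = - sphere_mean (\<lambda>u. (norm (p u))\<^sup>2 - real CARD('n) * (h u)\<^sup>2) / (real CARD('n) - 1)"
  using quermassintegral_smooth[OF n] sphere_mean_trace[OF n] by (simp add: sphere_mean_def)

text \<open>The support function of the symmetral is the even part of \<open>h\<close>; the data are
  its gradient and Hessian. So the formula for W_(n-2) applies to the symmetral too.\<close>

lemma smooth_body0_symmetral:
  "smooth_body0 (central_symmetral K) (\<lambda>x. (1 / 2) *\<^sub>R (p x - p (- x))) (\<lambda>x. (1 / 2) *\<^sub>R (A x + A (- x)))"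
proof
  show "compact (central_symmetral K)"
    unfolding central_symmetral_def
    by (intro compact_scaling compact_set_plus compact_negations compact_body)
  show "convex (central_symmetral K)"
    unfolding central_symmetral_def
    by (intro convex_scaling convex_set_plus convex_negations convex_body)
  have memI: "(1 / 2) *\<^sub>R (k - k') \<in> central_symmetral K" if "k \<in> K" "k' \<in> K" for k k'
  proof -
    have "k + - k' \<in> K + uminus ` K" using that by (intro set_plus_intro) auto
    then show ?thesis by (simp add: central_symmetral_def)
  qed
  show "contact_point (central_symmetral K) x ((1 / 2) *\<^sub>R (p x - p (- x)))" if x: "x \<noteq> 0" for x
    unfolding contact_point_def
  proof (intro conjI ballI)
    show "(1 / 2) *\<^sub>R (p x - p (- x)) \<in> central_symmetral K" using x by (intro memI p_in) auto
    fix c assume "c \<in> central_symmetral K"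
    then obtain k k' where k: "k \<in> K" "k' \<in> K" "c = (1 / 2) *\<^sub>R (k + - k')"
      by (auto simp: central_symmetral_def set_plus_def)
    have "k \<bullet> x \<le> p x \<bullet> x" "k' \<bullet> (- x) \<le> p (- x) \<bullet> (- x)"
      using contact[of x] contact[of "- x"] x k unfolding contact_point_def by auto
    then show "c \<bullet> x \<le> (1 / 2) *\<^sub>R (p x - p (- x)) \<bullet> x"
      by (simp add: k inner_diff_left inner_add_left)
  qed
  show "((\<lambda>x. (1 / 2) *\<^sub>R (p x - p (- x))) has_derivative (\<lambda>v. ((1 / 2) *\<^sub>R (A x + A (- x))) *v v)) (at x)"
    if x: "x \<noteq> 0" for x
  proof -
    have "((\<lambda>y. p (- y)) has_derivative (\<lambda>v. A (- x) *v (- v))) (at x)"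
      by (rule has_derivative_compose[of uminus uminus x UNIV p "\<lambda>v. A (- x) *v v"])
         (use p_der[of "- x"] x in \<open>auto intro!: derivative_eq_intros\<close>)
    from has_derivative_scaleR_right[OF has_derivative_diff[OF p_der[OF x] this], of "1/2"]
    have "((\<lambda>y. (1 / 2) *\<^sub>R (p y - p (- y))) has_derivative (\<lambda>v. (1 / 2) *\<^sub>R (A x *v v - A (- x) *v (- v)))) (at x)" .
    moreover have "(1 / 2) *\<^sub>R (A x *v v - A (- x) *v (- v)) = ((1 / 2) *\<^sub>R (A x + A (- x))) *v v" for v
      using matrix_vector_mult_scaleR[of "A (- x)" "-1" v]
      by (simp add: matrix_vector_mult_add_rdistrib flip: scaleR_matrix_vector_assoc)
    ultimately show ?thesis by simp
  qed
  show "continuous_on (- {0}) (\<lambda>x. (1 / 2) *\<^sub>R (A x + A (- x)))"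
    by (intro continuous_intros A_cont continuous_on_compose2[OF A_cont]) auto
  obtain e where e: "e > 0" "ball 0 e \<subseteq> K" using zero_interior by (meson mem_interior)
  have "ball 0 e \<subseteq> central_symmetral K"
  proof
    fix x :: "real^'n" assume "x \<in> ball 0 e"
    then have "x \<in> K" "- x \<in> K" using e by auto
    from memI[OF this] show "x \<in> central_symmetral K" by (simp flip: scaleR_2)
  qed
  then show "0 \<in> interior (central_symmetral K)" using e by (auto simp: mem_interior)
qed

text \<open>The gradient \<open>E\<close> of the even part is an odd field and the gradient
  \<open>P\<close> of the odd part an even one. The cross term \<open>x\<close> is therefore odd and
  has mean zero, and the even contribution cancels against the symmetral.\<close>

lemma asymmetry_sphere_mean:
  assumes n: "CARD('n) \<ge> 2"
  shows "asymmetry_2 K = sphere_mean (\<lambda>u. (norm ((1 / 2) *\<^sub>R (p u + p (- u))))\<^sup>2 - real CARD('n) * (h_odd K u)\<^sup>2) / (real CARD('n) - 1)"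
proof -
  let ?n = "real CARD('n)"
  interpret C: smooth_body0 "central_symmetral K" "\<lambda>x. (1 / 2) *\<^sub>R (p x - p (- x))" "\<lambda>x. (1 / 2) *\<^sub>R (A x + A (- x))"
    by (rule smooth_body0_symmetral)
  interpret O: homogeneous_fun "h_odd K" "\<lambda>x. (1 / 2) *\<^sub>R (p x + p (- x))"
    by (rule homogeneous_fun_h_odd)
  define P E H where "P = (\<lambda>x. (1 / 2) *\<^sub>R (p x + p (- x)))" and "E = (\<lambda>x. (1 / 2) *\<^sub>R (p x - p (- x)))"
    and "H = support_function (central_symmetral K)"
  have pPE: "p u = E u + P u" for u
  proof -
    have "E u + P u = (1 / 2) *\<^sub>R (p u + p u)" by (simp add: P_def E_def scaleR_add_right scaleR_diff_right)
    then show ?thesis by (simp flip: scaleR_2)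
  qed
  have H: "H u = E u \<bullet> u" if "u \<noteq> 0" for u using C.h_eq[OF that] by (simp add: H_def E_def)
  have ho: "h_odd K u = P u \<bullet> u" if "u \<noteq> 0" for u using O.f_eq[OF that] by (simp add: P_def)
  have hHo: "h u = H u + h_odd K u" if "u \<noteq> 0" for u
    using that by (simp add: h_eq H ho pPE inner_add_left)
  have cont: "continuous_on (- {0}) P" "continuous_on (- {0}) E" "continuous_on (- {0}) H" "continuous_on (- {0}) (h_odd K)"
    using O.P_cont C.p_cont C.h_cont_on O.f_cont by (simp_all add: P_def E_def H_def)
  define e where "e u = (norm (E u))\<^sup>2 - ?n * (H u)\<^sup>2" for u
  define d where "d u = (norm (P u))\<^sup>2 - ?n * (h_odd K u)\<^sup>2" for u
  define x where "x u = E u \<bullet> P u - ?n * (H u * h_odd K u)" for u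
  have c: "continuous_on (- {0}) e" "continuous_on (- {0}) d" "continuous_on (- {0}) x"
    "continuous_on (- {0}) (\<lambda>u. (norm (p u))\<^sup>2 - ?n * (h u)\<^sup>2)"
    unfolding e_def d_def x_def by (intro continuous_intros cont p_cont h_cont_on)+
  have x0: "sphere_mean x = 0"
    unfolding sphere_mean_def
  proof (rule integral_lball_sgn_odd[OF borel_measurable_off_zero[OF c(3)]])
    fix u :: "real^'n" assume u: "u \<noteq> 0"
    have "E (- u) = - E u" "P (- u) = P u" by (simp_all add: E_def P_def add.commute flip: scaleR_minus_right)
    then show "x (- u) = - x u" using u by (simp add: x_def H ho)
  qed
  have "sphere_mean (\<lambda>u. (norm (p u))\<^sup>2 - ?n * (h u)\<^sup>2) = sphere_mean (\<lambda>u. (e u + 1 * d u) + 2 * x u)"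
  proof (rule sphere_mean_cong)
    fix u :: "real^'n" assume "norm u = 1"
    then have "u \<noteq> 0" by auto
    then show "(norm (p u))\<^sup>2 - ?n * (h u)\<^sup>2 = (e u + 1 * d u) + 2 * x u"
      unfolding hHo[OF \<open>u \<noteq> 0\<close>] pPE[of u] e_def d_def x_def power2_norm_eq_inner
      by (simp add: inner_add inner_commute power2_eq_square algebra_simps)
  qed (intro borel_measurable_off_zero c continuous_intros)+
  also have "\<dots> = sphere_mean (\<lambda>u. e u + 1 * d u) + 2 * sphere_mean x"
    by (intro sphere_mean_add continuous_intros c)
  also have "sphere_mean (\<lambda>u. e u + 1 * d u) = sphere_mean e + 1 * sphere_mean d"
    by (intro sphere_mean_add c)
  finally have "sphere_mean (\<lambda>u. (norm (p u))\<^sup>2 - ?n * (h u)\<^sup>2) = sphere_mean e + sphere_mean d"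
    by (simp add: x0)
  moreover have "quermassintegral (CARD('n) - 2) (central_symmetral K) = - sphere_mean e / (?n - 1)"
    using C.quermassintegral_sphere_mean[OF n] by (simp add: e_def[abs_def] E_def H_def)
  ultimately have "asymmetry_2 K = sphere_mean d / (?n - 1)"
    unfolding asymmetry_2_def quermassintegral_sphere_mean[OF n] by (simp add: diff_divide_distrib add_divide_distrib)
  then show ?thesis by (simp add: d_def[abs_def] P_def)
qed

end

text \<open>Parallel bodies of a translate are translates of parallel bodies, so both sides are read
  off the same Steiner polynomial.\<close>

lemma quermassintegral_translate:
  fixes K :: "(real^'n) set"
  assumes "smooth_body0 ((+) (- a) ` K) p A" and n: "CARD('n) \<ge> 2"
  shows "quermassintegral (CARD('n) - 2) K = quermassintegral (CARD('n) - 2) ((+) (- a) ` K)"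
proof -
  interpret smooth_body0 "(+) (- a) ` K" p A by fact
  have K: "K = (+) a ` (+) (- a) ` K" by (simp add: image_image)
  have conv: "convex K" by (subst K) (rule convex_translation[OF convex_body])
  have ne: "K \<noteq> {}" using body_nonempty by auto
  have "measure lebesgue ((*\<^sub>R) s ` K + cball 0 t) = measure lebesgue ((*\<^sub>R) s ` (+) (- a) ` K + cball 0 t)" for s t
  proof -
    have "(*\<^sub>R) s ` K + cball 0 t = (+) (s *\<^sub>R a) ` ((*\<^sub>R) s ` (+) (- a) ` K + cball 0 t)"
    proof (intro equalityI subsetI)
      fix z assume "z \<in> (*\<^sub>R) s ` K + cball 0 t"
      then obtain k b where kb: "k \<in> K" "b \<in> cball 0 t" "z = s *\<^sub>R k + b" by (auto simp: set_plus_def)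
      have "s *\<^sub>R (- a + k) + b \<in> (*\<^sub>R) s ` (+) (- a) ` K + cball 0 t"
        using kb by (intro set_plus_intro imageI)
      moreover have "z = s *\<^sub>R a + (s *\<^sub>R (- a + k) + b)" by (simp add: kb algebra_simps)
      ultimately show "z \<in> (+) (s *\<^sub>R a) ` ((*\<^sub>R) s ` (+) (- a) ` K + cball 0 t)" by blast
    next
      fix z assume "z \<in> (+) (s *\<^sub>R a) ` ((*\<^sub>R) s ` (+) (- a) ` K + cball 0 t)"
      then obtain k b where kb: "k \<in> K" "b \<in> cball 0 t" "z = s *\<^sub>R a + (s *\<^sub>R (- a + k) + b)"
        by (auto simp: set_plus_def)
      have "z = s *\<^sub>R k + b" unfolding kb(3) by (simp add: algebra_simps)
      moreover have "s *\<^sub>R k + b \<in> (*\<^sub>R) s ` K + cball 0 t"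
        using kb(1,2) by (intro set_plus_intro imageI)
      ultimately show "z \<in> (*\<^sub>R) s ` K + cball 0 t" by simp
    qed
    then show ?thesis by (simp add: measure_translation)
  qed
  then have "quermassintegral (CARD('n) - 2) K = steiner_coeff (CARD('n) - 2) / real (CARD('n) choose 2)"
    by (intro quermassintegral_eqI[OF n conv ne]) (simp only: steiner)
  also have "\<dots> = quermassintegral (CARD('n) - 2) ((+) (- a) ` K)"
    by (rule quermassintegral_eqI[OF n convex_body body_nonempty steiner, symmetric])
  finally show ?thesis .
qed

theorem theorem6p1:
  fixes K :: "(real^'n) set"
  assumes "CARD('n) \<ge> 2"
    and "convex_body K"
    and "C2_plus K"
  shows "asymmetry_2 K =
           1 / (real CARD('n) * (real CARD('n) - 1)) *
           (LINT u|sphere_measure.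
              (norm (sphere_gradient (h_odd K) u))\<^sup>2 - (real CARD('n) - 1) * (h_odd K u)\<^sup>2)
         \<and> asymmetry_2 K \<ge> 0
         \<and> (asymmetry_2 K = 0 \<longleftrightarrow>
              (\<exists>f::real^'n \<Rightarrow> real. linear f \<and> (\<forall>u\<in>sphere 0 1. h_odd K u = f u)))
         \<and> ((\<exists>f::real^'n \<Rightarrow> real. linear f \<and> (\<forall>u\<in>sphere 0 1. h_odd K u = f u)) \<longleftrightarrow>
              centrally_symmetric_up_to_translation K)"
proof -
  note n = assms(1)
  let ?n = "real CARD('n)"
  obtain p A where "smooth_body K p A" using C2_plus_imp_smooth_body[OF assms(2,3)] .
  then interpret smooth_body K p A .
  obtain a where a: "a \<in> interior K" using assms(2) by (auto simp: convex_body_def)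
  define L where "L = (+) (- a) ` K"
  define q where "q = (\<lambda>x. p x - a)"
  have "- a + a \<in> (+) (- a) ` interior K" using a by (rule imageI)
  then have "0 \<in> interior L" unfolding L_def interior_translation by (simp only: left_minus)
  then have L0: "smooth_body0 L q A"
    using smooth_body_translate[of a] unfolding L_def q_def by (simp add: smooth_body0_def smooth_body0_axioms_def)
  then interpret L: smooth_body0 L q A .
  define P where "P = (\<lambda>x. (1 / 2) *\<^sub>R (p x + p (- x)))"
  define Q where "Q = (\<lambda>x. (1 / 2) *\<^sub>R (q x + q (- x)))"
  interpret O: homogeneous_fun "h_odd K" P unfolding P_def by (rule homogeneous_fun_h_odd)
  interpret OL: homogeneous_fun "h_odd L" Q unfolding Q_def by (rule L.homogeneous_fun_h_odd)
  have PQ: "P x = Q x + a" for x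
  proof -
    have "Q x + a = P x - (1 / 2) *\<^sub>R (a + a) + a" by (simp add: P_def Q_def q_def algebra_simps)
    then show ?thesis by (simp flip: scaleR_2)
  qed
  have hKL: "h_odd K x = h_odd L x + a \<bullet> x" for x
    by (cases "x = 0") (simp_all add: O.f_0 OL.f_0 O.f_eq OL.f_eq PQ inner_add_left)
  \<comment> \<open>The asymmetry is computed for the translate \<open>L\<close>, in terms of
    \<open>h_odd L\<close>. The functions h_odd of \<open>K\<close> and \<open>L\<close> differ by a
    linear function, to which the form is blind.\<close>
  have dir: "O.dirichlet = OL.dirichlet"
    using OL.dirichlet_shift[OF n, of a] by (simp add: O.dirichlet_def PQ hKL)
  define S where "S = sphere_mean (\<lambda>u. (norm (P u))\<^sup>2 - ?n * (h_odd K u)\<^sup>2)"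
  have S: "?n * measure (lball :: (real^'n) measure) UNIV * O.dirichlet = second_moment TYPE('n) * S"
    unfolding S_def by (rule O.dirichlet_sphere_mean[OF n])
  have "second_moment TYPE('n) * sphere_mean (\<lambda>u. (norm (Q u))\<^sup>2 - ?n * (h_odd L u)\<^sup>2) = second_moment TYPE('n) * S"
    unfolding S[symmetric] dir by (rule OL.dirichlet_sphere_mean[OF n, symmetric])
  then have SL: "sphere_mean (\<lambda>u. (norm (Q u))\<^sup>2 - ?n * (h_odd L u)\<^sup>2) = S"
    by (rule mult_left_cancel[THEN iffD1, rotated]) (use second_moment_pos[where 'n = 'n] in simp)
  have "asymmetry_2 K = asymmetry_2 L"
    by (simp only: asymmetry_2_def L_def central_symmetral_translate quermassintegral_translate[OF L0[unfolded L_def] n])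
  also have "\<dots> = S / (?n - 1)"
    using L.asymmetry_sphere_mean[OF n] SL by (simp add: Q_def)
  finally have asym: "asymmetry_2 K = S / (?n - 1)" .
  have n1: "?n - 1 > 0" using n by simp
  have pos: "second_moment TYPE('n) > 0" "measure (lball :: (real^'n) measure) UNIV > 0" "?n > 0"
    using second_moment_pos measure_lball_pos n by auto
  have formula: "(LINT u|sphere_measure. (norm (sphere_gradient (h_odd K) u))\<^sup>2 - (?n - 1) * (h_odd K u)\<^sup>2) = ?n * S"
  proof -
    have "(norm (sphere_gradient (h_odd K) u))\<^sup>2 - (?n - 1) * (h_odd K u)\<^sup>2 = (norm (P u))\<^sup>2 - ?n * (h_odd K u)\<^sup>2"
      if "u \<in> space sphere_measure" for u
    proof -
      have u: "norm u = 1" "u \<noteq> 0"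
        using that by (auto simp: sphere_measure_def space_restrict_space)
      \<comment> \<open>Pythagoras: the normal component of \<open>P u\<close> is
        \<open>h_odd K u\<close>, so subtracting it turns the coefficient n of the square into n -
        1.\<close>
      have "(norm (P u - h_odd K u *\<^sub>R u))\<^sup>2 = P u \<bullet> P u - 2 * h_odd K u * (P u \<bullet> u) + (h_odd K u)\<^sup>2 * (u \<bullet> u)"
        unfolding power2_norm_eq_inner by (simp add: inner_diff inner_commute power2_eq_square algebra_simps)
      also have "\<dots> = (norm (P u))\<^sup>2 - (h_odd K u)\<^sup>2"
        using O.f_eq[OF u(2)] u(1) by (simp add: power2_norm_eq_inner norm_eq_1 power2_eq_square[of "P u \<bullet> u"])
      finally show ?thesis unfolding O.sphere_gradient_eq[OF u(1)] by (simp add: algebra_simps)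
    qed
    then have "(LINT u|sphere_measure. (norm (sphere_gradient (h_odd K) u))\<^sup>2 - (?n - 1) * (h_odd K u)\<^sup>2) =
        (LINT u|sphere_measure. (norm (P u))\<^sup>2 - ?n * (h_odd K u)\<^sup>2)"
      by (intro Bochner_Integration.integral_cong refl)
    also have "\<dots> = ?n * S"
      unfolding S_def
      by (intro integral_sphere_measure borel_measurable_off_zero continuous_intros O.P_cont O.f_cont)
    finally show ?thesis .
  qed
  have odd: "h_odd K (- x) = - h_odd K x" for x
    unfolding h_odd_def minus_divide_left by simp
  have "second_moment TYPE('n) * S \<ge> 0"
    unfolding S[symmetric] using O.dirichlet_odd(1)[OF n odd] pos by simp
  then have "S \<ge> 0" using pos by (simp add: zero_le_mult_iff)
  have zero: "S = 0 \<longleftrightarrow> (\<exists>f::real^'n \<Rightarrow> real. linear f \<and> (\<forall>u\<in>sphere 0 1. h_odd K u = f u))"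
  proof
    assume "S = 0"
    then have "O.dirichlet = 0" using S pos by simp
    then have "linear (h_odd K)" by (rule O.dirichlet_odd(2)[OF n odd])
    then show "\<exists>f::real^'n \<Rightarrow> real. linear f \<and> (\<forall>u\<in>sphere 0 1. h_odd K u = f u)" by blast
  next
    assume "\<exists>f::real^'n \<Rightarrow> real. linear f \<and> (\<forall>u\<in>sphere 0 1. h_odd K u = f u)"
    then obtain f :: "real^'n \<Rightarrow> real" where f: "linear f" "\<And>u. norm u = 1 \<Longrightarrow> h_odd K u = f u" by auto
    define b where "b = adjoint f 1"
    have fb: "f u = b \<bullet> u" for u using adjoint_works[OF f(1), of u 1] by (simp add: b_def inner_commute)
    have hb: "h_odd K x = b \<bullet> x" for x
    proof (cases "x = 0")
      case False
      then have "h_odd K (sgn x) = b \<bullet> sgn x" using f(2)[of "sgn x"] by (simp add: norm_sgn fb)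
      then have "h_odd K x = norm x * (b \<bullet> sgn x)" using O.f_sgn[of x] by simp
      then show ?thesis using False by (simp add: sgn_div_norm)
    qed (simp add: O.f_0)
    have Pb: "P x = b" if "x \<noteq> 0" for x
    proof -
      have "((\<lambda>x. b \<bullet> x) has_derivative (\<lambda>v. P x \<bullet> v)) (at x)" using O.f_der[OF that] by (simp add: hb[abs_def])
      moreover have "((\<lambda>x. b \<bullet> x) has_derivative (\<lambda>v. b \<bullet> v)) (at x)" by (auto intro!: derivative_eq_intros)
      ultimately have der: "(\<lambda>v. P x \<bullet> v) = (\<lambda>v. b \<bullet> v)" by (rule has_derivative_unique)
      have "(P x - b) \<bullet> (P x - b) = 0" using fun_cong[OF der, of "P x - b"] by (simp add: inner_diff_left)
      then show ?thesis by simp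
    qed
    \<comment> \<open>A linear function is the zero function shifted, so shift invariance gives it
      Dirichlet form 0.\<close>
    have Zh: "homogeneous_fun (\<lambda>x. 0) (\<lambda>x. 0 :: real^'n)"
      by unfold_locales simp_all
    have Bh: "homogeneous_fun (\<lambda>x. b \<bullet> x) (\<lambda>x. b)"
      by unfold_locales (auto intro!: derivative_eq_intros)
    interpret B: homogeneous_fun "\<lambda>x. b \<bullet> x" "\<lambda>x. b" by (rule Bh)
    have "B.dirichlet = 0"
      using homogeneous_fun.dirichlet_shift[OF Zh n, of b]
      by (simp add: B.dirichlet_def homogeneous_fun.dirichlet_def[OF Zh])
    then have "second_moment TYPE('n) * sphere_mean (\<lambda>u. (norm b)\<^sup>2 - ?n * (b \<bullet> u)\<^sup>2) = 0"
      using B.dirichlet_sphere_mean[OF n] by simp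
    then have B0: "sphere_mean (\<lambda>u. (norm b)\<^sup>2 - ?n * (b \<bullet> u)\<^sup>2) = 0" using pos by simp
    have "sphere_mean (\<lambda>u. (norm (P u))\<^sup>2 - ?n * (h_odd K u)\<^sup>2) = sphere_mean (\<lambda>u. (norm b)\<^sup>2 - ?n * (b \<bullet> u)\<^sup>2)"
    proof (rule sphere_mean_cong)
      show "(norm (P u))\<^sup>2 - ?n * (h_odd K u)\<^sup>2 = (norm b)\<^sup>2 - ?n * (b \<bullet> u)\<^sup>2" if "norm u = 1" for u
      proof -
        have "u \<noteq> 0" using that by auto
        then show ?thesis by (simp add: Pb hb)
      qed
    qed (intro borel_measurable_off_zero continuous_intros O.P_cont O.f_cont)+
    then show "S = 0" using B0 by (simp add: S_def)
  qed
  have "S / (?n - 1) = 1 / (?n * (?n - 1)) * (?n * S)" "S / (?n - 1) \<ge> 0" "S / (?n - 1) = 0 \<longleftrightarrow> S = 0"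
    using n1 pos \<open>S \<ge> 0\<close> by simp_all
  then show ?thesis unfolding asym formula using zero h_odd_linear_iff by blast
qed

end
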